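(* Let $(\Sigma^{\infty,+}_{(L)},\sigma_\infty)$ be an NSFT given by alphabets $(\mathcal{A}_i)_{i\ge0}$ and matrices $(L_i)_{i\ge0}$ satisfying (A1), (A2), (A3) of the context, and let $\mu_\infty$ be an associated Parry IMS, with corresponding numbers $\lambda^{(k,m)}$. (i) The following inequalities hold: $$\limsup_{k\to\infty}\frac1k\log\lambda^{(0,k)}\le h(\sigma_\infty,\mu_\infty)\le\limsup_{k\to\infty}\frac1k\log\|L^{(0,k)}\|_{(k)}.\qquad( * )$$ (ii) The inequalities in $( * )$ are equalities, and hence $h(\sigma_\infty,\mu_\infty)=h_{\mathrm{top}}(\sigma_\infty)$, provided the following assumption holds: there exist $\varepsilon>0$ and $k_0\in\mathbb{N}$ such that for all $k\ge k_0$ and all $m\ge 1$ with $w(k,k+m)>1/\varepsilon$, for each $\gamma\in\mathcal{A}_k$ which maximizes $\sum_\alpha L^{(0,k)}_{\alpha\gamma}$, the inequality $L^{(k,k+m)}_{\gamma\beta}\ge1$ holds for all $\beta\in\mathcal{A}_{k+m}$. (iii) Another sufficient condition for the equalities in $( * )$ is $$\limsup_{k\to\infty}\frac1k\log\lambda^{(k,k+N_k)}=0,$$ where $N_k$ is the smallest integer $n\geq 1$ such that all entries of $L^{(k,k+n)}$ are strictly positive. In particular, this holds if $(L_i)_{i\ge0}$ is uniformly primitive, i.e. if the sequence $(N_k)_{k\ge0}$ is bounded.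
   Context: NSFT. Let $\mathcal{A}_i=\{1,\dots,l_i\}$, $i\ge0$, be finite alphabets and $L_i$ a $0$-$1$-matrix of dimension $l_i\times l_{i+1}$. For $n>k$ put $L^{(k,n)}:=L_kL_{k+1}\cdots L_{n-1}$. Standing assumptions: (A1) no row or column of any $L_i$ is identically zero; (A2) $(l_i)$ is bounded; (A3) $(L_i)$ is primitive: for each $i\ge0$ there is $n>i$ such that all entries of $L^{(i,n)}$ are strictly positive. For $n\le m$ let $w(n,m)$ be the number of words $(x_n,\dots,x_m)$ with $x_i\in\mathcal{A}_i$ and $(L_i)_{x_ix_{i+1}}=1$ for $n\le i\le m-1$. $\|A\|_{(n)}=\sum_{\alpha,\beta}|A_{\alpha\beta}|$ for $A\in\mathbb{R}^{l_0\times l_n}$. "$\gamma$ maximizes $\sum_\alpha L^{(0,k)}_{\alpha\gamma}$" means $\sum_\alpha L^{(0,k)}_{\alpha\gamma}=\max_{\beta\in\mathcal{A}_k}\sum_\alpha L^{(0,k)}_{\alpha\beta}$. $\Sigma^{k,+}_{(L)}:=\{(x_k,x_{k+1},\dots):x_i\in\mathcal{A}_i,\ (L_i)_{x_ix_{i+1}}=1\ \forall i\ge k\}$, with metric $d_k(x,y)=0$ if $x=y$, $1$ if $x_k\ne y_k$, and $w(k,l)^{-1}$ if $x\ne y$, $x_k=y_k$, $l=\max\{r\ge k:x_i=y_i,\ i=k,\dots,r\}$. $\sigma_k:\Sigma^{k,+}_{(L)}\to\Sigma^{k+1,+}_{(L)}$ is the left shift. The spaces are compact and $\sigma_\infty=(\sigma_k)_{k\ge0}$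 is equicontinuous. Parry IMS. By (A1)–(A3) there exist sequences $(\widehat{\mathbf w}_i)_{i\ge0}$ of column vectors $\widehat{\mathbf w}_i\in\mathbb{R}^{l_i}$ with strictly positive entries and $\widehat{\mathbf w}_i=L_i\widehat{\mathbf w}_{i+1}$, and sequences $(\widehat{\mathbf v}_i^t)_{i\ge0}$ of row vectors with strictly positive entries and $\widehat{\mathbf v}_i^tL_i=\widehat{\mathbf v}_{i+1}^t$. For any choice of these, with $\|\mathbf w\|=\sum_\alpha|\mathbf w_\alpha|$, put $\mathbf w_i:=\widehat{\mathbf w}_i/\|\widehat{\mathbf w}_i\|$, $\mathbf v_i^t:=\widehat{\mathbf v}_i^t/(\widehat{\mathbf v}_i^t\mathbf w_i)$, $\lambda_i:=\|\widehat{\mathbf w}_i\|/\|\widehat{\mathbf w}_{i+1}\|$ (so $L_i\mathbf w_{i+1}=\lambda_i\mathbf w_i$, $\mathbf v_i^tL_i=\lambda_i\mathbf v_{i+1}^t$), and $\lambda^{(k,m)}:=\prod_{i=k}^{m-1}\lambda_i$ for $k<m$, $\lambda^{(k,k)}:=1$. The associated Parry IMS $\mu_\infty=(\mu_k)_{k\ge0}$ consists of the Borel probability measures $\mu_k$ on $\Sigma^{k,+}_{(L)}$ determined on cylinder sets $[.x_k\dots x_m]=\{y\in\Sigma^{k,+}_{(L)}:y_i=x_i,\ i=k,\dots,m\}$ of admissible words by $\mu_k([.x_k\dots x_m])=\frac1{\lambda^{(k,m)}}(\mathbf v_k^t)_{x_k}(\mathbf w_m)_{x_m}$; it satisfies $\sigma_k\mu_k=\mu_{k+1}$.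 The theorem is about any measure sequence so obtained. Entropies. For an equicontinuous sequence $f_n:X_n\to X_{n+1}$ of maps between compact metric spaces $(X_n,d_n)$, put $f_0^n=f_{n-1}\circ\cdots\circ f_0$, $f_0^0=\mathrm{id}$, $f_0^{-n}=(f_0^n)^{-1}$. For Borel probability measures $\mu_n$ on $X_n$ with $f_n\mu_n=\mu_{n+1}$ (an IMS), a sequence $\mathcal{P}_\infty=(\mathcal{P}_n)$ of finite Borel partitions $\mathcal{P}_n=\{P_{n,1},\dots,P_{n,k_n}\}$ of $X_n$ is admissible, $\mathcal{P}_\infty\in\mathcal{E}_{\mathrm M}(\mu_\infty)$, iff $(k_n)$ is bounded and for each $\varepsilon>0$ there are $\delta>0$ and compact (possibly empty) $K_{n,i}\subset P_{n,i}$ such that for all $n$: $\mu_n(P_{n,i}\setminus K_{n,i})\le\varepsilon$ for all $i$, and $d_n(x,y)\ge\delta$ for all $x\in K_{n,i}$, $y\in K_{n,j}$, $i\ne j$. The metric entropy is $h(f_\infty,\mu_\infty):=\sup_{\mathcal{P}_\infty\in\mathcal{E}_{\mathrm M}(\mu_\infty)}\limsup_{n\to\infty}\frac1nH_{\mu_0}\big(\bigvee_{i=0}^{n-1}f_0^{-i}\mathcal{P}_i\big)$, where $H_\mu(\mathcal{P})=-\sum_{P\in\mathcal P}\mu(P)\log\mu(P)$. The topological entropy is $h_{\mathrm{top}}(f_\infty):=\sup_{\mathcal{U}_\infty}\limsup_{n\to\infty}\frac1n\log\mathcal{N}\big(\bigvee_{i=0}^{n-1}f_0^{-i}\mathcal{U}_i\big)$,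 the supremum over all sequences of open covers $\mathcal{U}_n$ of $X_n$ with Lebesgue numbers bounded away from zero, $\mathcal{N}$ being the minimal cardinality of a subcover. *)

theory Defs
  imports "HOL-Probability.Probability"
begin

section \<open>Nonautonomous dynamical systems and their entropies\<close>

text \<open>
  A sequence of metric spaces is a pair of sequences \<open>X :: nat \<Rightarrow> 'a set\<close> and
  \<open>d :: nat \<Rightarrow> 'a \<Rightarrow> 'a \<Rightarrow> real\<close> with \<open>Metric_space (X n) (d n)\<close>; all topological notions refer to
  \<open>Metric_space.mtopology (X n) (d n)\<close>.
\<close>

primrec iter :: "(nat \<Rightarrow> 'a \<Rightarrow> 'a) \<Rightarrow> nat \<Rightarrow> 'a \<Rightarrow> 'a" where
  "iter f 0 = id"
| "iter f (Suc n) = f n \<circ> iter f n"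

definition pullback :: "(nat \<Rightarrow> 'a set) \<Rightarrow> (nat \<Rightarrow> 'a \<Rightarrow> 'a) \<Rightarrow> nat \<Rightarrow> 'a set set \<Rightarrow> 'a set set" where
  "pullback X f i C = (\<lambda>c. {x \<in> X 0. iter f i x \<in> c}) ` C"

text \<open>
  \<open>join X f C n\<close> is the common refinement of \<open>pullback X f i (C i)\<close> for \<open>i < n\<close>.  As a set of sets
  it may contain the empty set, which affects neither \<open>part_entropy\<close> (since \<open>0 * ln 0 = 0\<close>)
  nor \<open>min_subcover\<close>.
\<close>

definition join ::
  "(nat \<Rightarrow> 'a set) \<Rightarrow> (nat \<Rightarrow> 'a \<Rightarrow> 'a) \<Rightarrow> (nat \<Rightarrow> 'a set set) \<Rightarrow> nat \<Rightarrow> 'a set set" where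
  "join X f C n =
     {X 0 \<inter> (\<Inter>i\<in>{..<n}. s i) | s. \<forall>i<n. s i \<in> pullback X f i (C i)}"

definition metric_borel_sets :: "'a set \<Rightarrow> ('a \<Rightarrow> 'a \<Rightarrow> real) \<Rightarrow> 'a set set" where
  "metric_borel_sets X d = sigma_sets X {U. openin (Metric_space.mtopology X d) U}"

definition borel_prob :: "'a set \<Rightarrow> ('a \<Rightarrow> 'a \<Rightarrow> real) \<Rightarrow> 'a measure \<Rightarrow> bool" where
  "borel_prob X d M \<longleftrightarrow> prob_space M \<and> space M = X \<and> sets M = metric_borel_sets X d"

definition part_entropy :: "'a measure \<Rightarrow> 'a set set \<Rightarrow> real" where
  "part_entropy M P = - (\<Sum>p\<in>P. measure M p * ln (measure M p))"

text \<open>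
  Partitions are sets of parts instead of enumerated families, and the compact sets
  \<open>K n p\<close> are indexed by the part \<open>p\<close> they approximate.
\<close>

definition admissible_partitions ::
  "(nat \<Rightarrow> 'a set) \<Rightarrow> (nat \<Rightarrow> 'a \<Rightarrow> 'a \<Rightarrow> real) \<Rightarrow> (nat \<Rightarrow> 'a measure) \<Rightarrow> (nat \<Rightarrow> 'a set set) set" where
  "admissible_partitions X d \<mu> = {P.
     (\<forall>n. finite (P n) \<and> partition_on (X n) (P n) \<and> P n \<subseteq> metric_borel_sets (X n) (d n)) \<and>
     bdd_above (range (\<lambda>n. card (P n))) \<and>
     (\<forall>\<epsilon>>0. \<exists>\<delta>>0. \<exists>K :: nat \<Rightarrow> 'a set \<Rightarrow> 'a set. \<forall>n.
        (\<forall>p\<in>P n. compactin (Metric_space.mtopology (X n) (d n)) (K n p) \<and> K n p \<subseteq> p \<and>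
                  measure (\<mu> n) (p - K n p) \<le> \<epsilon>) \<and>
        (\<forall>p\<in>P n. \<forall>q\<in>P n. p \<noteq> q \<longrightarrow> (\<forall>x\<in>K n p. \<forall>y\<in>K n q. d n x y \<ge> \<delta>)))}"

definition metric_entropy ::
  "(nat \<Rightarrow> 'a set) \<Rightarrow> (nat \<Rightarrow> 'a \<Rightarrow> 'a \<Rightarrow> real) \<Rightarrow> (nat \<Rightarrow> 'a \<Rightarrow> 'a) \<Rightarrow> (nat \<Rightarrow> 'a measure) \<Rightarrow> ereal"
where
  "metric_entropy X d f \<mu> =
     (SUP P\<in>admissible_partitions X d \<mu>.
        limsup (\<lambda>n. ereal (1 / real n * part_entropy (\<mu> 0) (join X f P n))))"

definition is_open_cover :: "'a set \<Rightarrow> ('a \<Rightarrow> 'a \<Rightarrow> real) \<Rightarrow> 'a set set \<Rightarrow> bool" where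
  "is_open_cover X d U \<longleftrightarrow> (\<forall>u\<in>U. openin (Metric_space.mtopology X d) u) \<and> \<Union>U = X"

definition is_lebesgue_number :: "'a set \<Rightarrow> ('a \<Rightarrow> 'a \<Rightarrow> real) \<Rightarrow> 'a set set \<Rightarrow> real \<Rightarrow> bool" where
  "is_lebesgue_number X d U \<delta> \<longleftrightarrow>
     \<delta> > 0 \<and> (\<forall>x\<in>X. \<exists>u\<in>U. Metric_space.mball X d x \<delta> \<subseteq> u)"

definition min_subcover :: "'a set \<Rightarrow> 'a set set \<Rightarrow> nat" where
  "min_subcover X U = (LEAST n. \<exists>V\<subseteq>U. finite V \<and> \<Union>V = X \<and> card V = n)"

text \<open>
  Every positive number below a Lebesgue number is again one, so the Lebesgue numbers of the
  covers \<open>U n\<close> are bounded away from zero iff they have a common one.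
\<close>

definition lebesgue_cover_sequences ::
  "(nat \<Rightarrow> 'a set) \<Rightarrow> (nat \<Rightarrow> 'a \<Rightarrow> 'a \<Rightarrow> real) \<Rightarrow> (nat \<Rightarrow> 'a set set) set" where
  "lebesgue_cover_sequences X d = {U.
     (\<forall>n. is_open_cover (X n) (d n) (U n)) \<and>
     (\<exists>\<delta>>0. \<forall>n. is_lebesgue_number (X n) (d n) (U n) \<delta>)}"

definition topological_entropy ::
  "(nat \<Rightarrow> 'a set) \<Rightarrow> (nat \<Rightarrow> 'a \<Rightarrow> 'a \<Rightarrow> real) \<Rightarrow> (nat \<Rightarrow> 'a \<Rightarrow> 'a) \<Rightarrow> ereal" where
  "topological_entropy X d f =
     (SUP U\<in>lebesgue_cover_sequences X d.
        limsup (\<lambda>n. ereal (1 / real n * ln (real (min_subcover (X 0) (join X f U n))))))"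


section \<open>Nonstationary subshifts of finite type\<close>

text \<open>
  The matrix \<open>L i\<close> has rows indexed by \<open>alphabet l i\<close> and columns indexed by
  \<open>alphabet l (Suc i)\<close>; entries outside this range are never used.
\<close>

definition alphabet :: "(nat \<Rightarrow> nat) \<Rightarrow> nat \<Rightarrow> nat set" where
  "alphabet l i = {1..l i}"

primrec mat_prod ::
  "(nat \<Rightarrow> nat) \<Rightarrow> (nat \<Rightarrow> nat \<Rightarrow> nat \<Rightarrow> real) \<Rightarrow> nat \<Rightarrow> nat \<Rightarrow> nat \<Rightarrow> nat \<Rightarrow> real" where
  "mat_prod l L k 0 = (\<lambda>a b. if a = b then 1 else 0)"
| "mat_prod l L k (Suc m) =
     (\<lambda>a b. \<Sum>c\<in>alphabet l (k + m). mat_prod l L k m a c * L (k + m) c b)"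

text \<open>\<open>Lprod l L k n\<close> is \<open>L\<^sub>k L\<^sub>k\<^sub>+\<^sub>1 \<dots> L\<^sub>n\<^sub>-\<^sub>1\<close>, and the identity matrix for \<open>n = k\<close>.\<close>

definition Lprod ::
  "(nat \<Rightarrow> nat) \<Rightarrow> (nat \<Rightarrow> nat \<Rightarrow> nat \<Rightarrow> real) \<Rightarrow> nat \<Rightarrow> nat \<Rightarrow> nat \<Rightarrow> nat \<Rightarrow> real" where
  "Lprod l L k n = mat_prod l L k (n - k)"

definition all_positive ::
  "(nat \<Rightarrow> nat) \<Rightarrow> (nat \<Rightarrow> nat \<Rightarrow> nat \<Rightarrow> real) \<Rightarrow> nat \<Rightarrow> nat \<Rightarrow> bool" where
  "all_positive l L k n \<longleftrightarrow> (\<forall>a\<in>alphabet l k. \<forall>b\<in>alphabet l n. Lprod l L k n a b > 0)"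

locale nsft =
  fixes l :: "nat \<Rightarrow> nat" and L :: "nat \<Rightarrow> nat \<Rightarrow> nat \<Rightarrow> real"
  assumes alphabet_nonempty: "l i \<ge> 1"
    and zero_one: "\<lbrakk>a \<in> alphabet l i; b \<in> alphabet l (Suc i)\<rbrakk> \<Longrightarrow> L i a b \<in> {0, 1}"
    and row_nonzero: "a \<in> alphabet l i \<Longrightarrow> \<exists>b\<in>alphabet l (Suc i). L i a b \<noteq> 0"
    and col_nonzero: "b \<in> alphabet l (Suc i) \<Longrightarrow> \<exists>a\<in>alphabet l i. L i a b \<noteq> 0"
    and alphabets_bounded: "bdd_above (range l)"
    and primitive: "\<exists>n>i. all_positive l L i n"

definition words ::
  "(nat \<Rightarrow> nat) \<Rightarrow> (nat \<Rightarrow> nat \<Rightarrow> nat \<Rightarrow> real) \<Rightarrow> nat \<Rightarrow> nat \<Rightarrow> (nat \<Rightarrow> nat) set" where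
  "words l L n m =
     {x \<in> (\<Pi>\<^sub>E i\<in>{n..m}. alphabet l i). \<forall>i\<in>{n..<m}. L i (x i) (x (Suc i)) = 1}"

definition num_words :: "(nat \<Rightarrow> nat) \<Rightarrow> (nat \<Rightarrow> nat \<Rightarrow> nat \<Rightarrow> real) \<Rightarrow> nat \<Rightarrow> nat \<Rightarrow> nat" where
  "num_words l L n m = card (words l L n m)"

definition norm0 :: "(nat \<Rightarrow> nat) \<Rightarrow> nat \<Rightarrow> (nat \<Rightarrow> nat \<Rightarrow> real) \<Rightarrow> real" where
  "norm0 l n A = (\<Sum>a\<in>alphabet l 0. \<Sum>b\<in>alphabet l n. \<bar>A a b\<bar>)"

text \<open>
  A point \<open>(x\<^sub>k, x\<^sub>k\<^sub>+\<^sub>1, \<dots>)\<close> keeps its absolute indices: it is an extensional function on \<open>{k..}\<close>.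
  Hence the left shift, which drops \<open>x\<^sub>k\<close>, is restriction to \<open>{Suc k..}\<close>.
\<close>

definition shift_space ::
  "(nat \<Rightarrow> nat) \<Rightarrow> (nat \<Rightarrow> nat \<Rightarrow> nat \<Rightarrow> real) \<Rightarrow> nat \<Rightarrow> (nat \<Rightarrow> nat) set" where
  "shift_space l L k =
     {x \<in> (\<Pi>\<^sub>E i\<in>{k..}. alphabet l i). \<forall>i\<ge>k. L i (x i) (x (Suc i)) = 1}"

definition left_shift :: "nat \<Rightarrow> (nat \<Rightarrow> nat) \<Rightarrow> (nat \<Rightarrow> nat)" where
  "left_shift k x = restrict x {Suc k..}"

definition shift_dist ::
  "(nat \<Rightarrow> nat) \<Rightarrow> (nat \<Rightarrow> nat \<Rightarrow> nat \<Rightarrow> real) \<Rightarrow> nat \<Rightarrow> (nat \<Rightarrow> nat) \<Rightarrow> (nat \<Rightarrow> nat) \<Rightarrow> real" where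
  "shift_dist l L k x y =
     (if x = y then 0
      else if x k \<noteq> y k then 1
      else 1 / real (num_words l L k (Max {r. k \<le> r \<and> (\<forall>i\<in>{k..r}. x i = y i)})))"

definition cylinder ::
  "(nat \<Rightarrow> nat) \<Rightarrow> (nat \<Rightarrow> nat \<Rightarrow> nat \<Rightarrow> real) \<Rightarrow> nat \<Rightarrow> nat \<Rightarrow> (nat \<Rightarrow> nat) \<Rightarrow> (nat \<Rightarrow> nat) set" where
  "cylinder l L k m x = {y \<in> shift_space l L k. \<forall>i\<in>{k..m}. y i = x i}"

text \<open>
  \<open>Metric_space.mtopology\<close> and the entropies above are meaningful for these spaces:
\<close>

context nsft
begin

lemma finite_words: "finite (words l L n m)"
proof -
  have "finite (\<Pi>\<^sub>E i\<in>{n..m}. alphabet l i)"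
    by (intro finite_PiE) (auto simp: alphabet_def)
  then show ?thesis
    by (rule rev_finite_subset) (auto simp: words_def)
qed

lemma num_words_Suc_ge:
  assumes "n \<le> m"
  shows "num_words l L n m \<le> num_words l L n (Suc m)"
proof -
  have "words l L n m \<subseteq> (\<lambda>x. restrict x {n..m}) ` words l L n (Suc m)"
  proof
    fix x assume x: "x \<in> words l L n m"
    then have "x m \<in> alphabet l m"
      using assms by (auto simp: words_def)
    then obtain b where b: "b \<in> alphabet l (Suc m)" "L m (x m) b \<noteq> 0"
      using row_nonzero by blast
    then have b1: "L m (x m) b = 1"
      using zero_one \<open>x m \<in> alphabet l m\<close> by blast
    define y where "y = x(Suc m := b)"
    have "y \<in> (\<Pi>\<^sub>E i\<in>{n..Suc m}. alphabet l i)"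
      using x b assms by (auto simp: words_def y_def PiE_iff extensional_def le_Suc_eq)
    moreover have "L i (y i) (y (Suc i)) = 1" if "i \<in> {n..<Suc m}" for i
      using x b1 that assms by (auto simp: words_def y_def less_Suc_eq)
    ultimately have "y \<in> words l L n (Suc m)"
      by (auto simp: words_def)
    moreover have "x = restrict y {n..m}"
      using x assms by (auto simp: words_def y_def PiE_iff extensional_def fun_eq_iff)
    ultimately show "x \<in> (\<lambda>x. restrict x {n..m}) ` words l L n (Suc m)"
      by blast
  qed
  then show ?thesis
    unfolding num_words_def using finite_words surj_card_le by blast
qed

lemma num_words_mono:
  assumes "n \<le> m" "m \<le> m'"
  shows "num_words l L n m \<le> num_words l L n m'"
  using assms(2)
proof (induction m' rule: dec_induct)
  case (step q)
  then show ?case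
    using num_words_Suc_ge[of n q] assms(1) by linarith
qed simp

lemma num_words_pos:
  assumes "n \<le> m"
  shows "num_words l L n m > 0"
proof -
  have "(\<lambda>i\<in>{n..n}. 1) \<in> words l L n n"
    using alphabet_nonempty[of n] by (auto simp: words_def alphabet_def)
  then have "num_words l L n n > 0"
    using finite_words by (auto simp: num_words_def card_gt_0_iff)
  then show ?thesis
    using num_words_mono[of n n m] assms by simp
qed

lemma Metric_space_shift: "Metric_space (shift_space l L k) (shift_dist l L k)"
proof -
  define S where "S = (\<lambda>x y :: nat \<Rightarrow> nat. {r. k \<le> r \<and> (\<forall>i\<in>{k..r}. x i = y i)})"
  define W where "W = (\<lambda>x y. real (num_words l L k (Max (S x y))))"
  have d: "shift_dist l L k x y =
      (if x = y then 0 else if x k \<noteq> y k then 1 else 1 / W x y)" for x y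
    by (simp add: shift_dist_def S_def W_def)
  have Ssym: "S x y = S y x" for x y
    by (auto simp: S_def)
  have fin: "finite (S x y)"
    if "x \<in> shift_space l L k" "y \<in> shift_space l L k" "x \<noteq> y" for x y
  proof -
    obtain i where i: "x i \<noteq> y i"
      using \<open>x \<noteq> y\<close> by blast
    have "x i = undefined" "y i = undefined" if "\<not> k \<le> i"
      using that \<open>x \<in> _\<close> \<open>y \<in> _\<close> by (simp_all add: shift_space_def PiE_iff extensional_def)
    then have "k \<le> i"
      using i by metis
    have "S x y \<subseteq> {..<i}"
    proof
      fix r assume "r \<in> S x y"
      then have "x j = y j" if "k \<le> j" "j \<le> r" for j
        using that by (simp add: S_def)
      then show "r \<in> {..<i}"
        using i \<open>k \<le> i\<close> by (metis lessThan_iff not_less)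
    qed
    then show ?thesis
      using finite_subset by blast
  qed
  have Max_in: "Max (S x y) \<in> S x y"
    if "x \<in> shift_space l L k" "y \<in> shift_space l L k" "x \<noteq> y" "x k = y k" for x y
  proof -
    have "k \<in> S x y"
      using that by (auto simp: S_def)
    then show ?thesis
      using fin that by (intro Max_in) auto
  qed
  have W1: "W x y \<ge> 1"
    if "x \<in> shift_space l L k" "y \<in> shift_space l L k" "x \<noteq> y" "x k = y k" for x y
  proof -
    have "k \<le> r" if "r \<in> S x y" for r
      using that by (simp add: S_def)
    then have "num_words l L k (Max (S x y)) > 0"
      using Max_in[OF that] num_words_pos by blast
    then show ?thesis
      by (simp add: W_def)
  qed
  have le1: "shift_dist l L k x y \<le> 1"
    if "x \<in> shift_space l L k" "y \<in> shift_space l L k" for x y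
    using W1[of x y] that by (auto simp: d)
  have nonneg: "shift_dist l L k x y \<ge> 0" for x y
    by (simp add: d W_def)
  show ?thesis
  proof
    show "0 \<le> shift_dist l L k x y" for x y
      by (rule nonneg)
    show "shift_dist l L k x y = shift_dist l L k y x" for x y
      by (auto simp: d W_def Ssym)
    show "shift_dist l L k x y = 0 \<longleftrightarrow> x = y"
      if "x \<in> shift_space l L k" "y \<in> shift_space l L k" for x y
      using W1[OF that] by (auto simp: d)
    show "shift_dist l L k x z \<le> shift_dist l L k x y + shift_dist l L k y z"
      if xs: "x \<in> shift_space l L k" and ys: "y \<in> shift_space l L k"
        and zs: "z \<in> shift_space l L k" for x y z
    proof (cases "x = y \<or> y = z \<or> x = z \<or> x k \<noteq> y k \<or> y k \<noteq> z k")
      case True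
      have far: "shift_dist l L k u v = 1" if "u k \<noteq> v k" for u v
        using that by (auto simp: d)
      from True consider "x = y" | "y = z" | "x = z" | "x k \<noteq> y k" | "y k \<noteq> z k"
        by blast
      then show ?thesis
        using le1[OF xs zs] nonneg[of x y] nonneg[of y z]
        by cases (simp_all add: far d[of x x] d[of y y] d[of z z])
    next
      case False
      define q where "q = min (Max (S x y)) (Max (S y z))"
      have S_iff: "r \<in> S u v \<longleftrightarrow> k \<le> r \<and> (\<forall>i. k \<le> i \<and> i \<le> r \<longrightarrow> u i = v i)" for r u v
        by (auto simp: S_def)
      have "Max (S x y) \<in> S x y" "Max (S y z) \<in> S y z"
        using Max_in[OF xs ys] Max_in[OF ys zs] False by blast+
      then have "q \<in> S x z"
        unfolding q_def S_iff by simp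
      then have qk: "k \<le> q"
        by (simp add: S_iff)
      have "q \<le> Max (S x z)"
        using fin[OF xs zs] False \<open>q \<in> S x z\<close> by simp
      then have le: "real (num_words l L k q) \<le> W x z"
        using num_words_mono qk by (simp add: W_def)
      have "real (num_words l L k q) > 0"
        using num_words_pos[OF qk] by simp
      then have "1 / W x z \<le> 1 / real (num_words l L k q)"
        using le by (simp add: frac_le)
      also have "\<dots> \<le> 1 / W x y + 1 / W y z"
        by (auto simp: q_def W_def min_def)
      finally show ?thesis
        using False by (simp add: d)
    qed
  qed
qed

end


section \<open>Parry measures\<close>

locale parry_vectors = nsft l L
  for l :: "nat \<Rightarrow> nat" and L :: "nat \<Rightarrow> nat \<Rightarrow> nat \<Rightarrow> real" +
  fixes wh vh :: "nat \<Rightarrow> nat \<Rightarrow> real"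
  assumes wh_pos: "a \<in> alphabet l i \<Longrightarrow> wh i a > 0"
    and wh_eq: "a \<in> alphabet l i \<Longrightarrow> wh i a = (\<Sum>b\<in>alphabet l (Suc i). L i a b * wh (Suc i) b)"
    and vh_pos: "a \<in> alphabet l i \<Longrightarrow> vh i a > 0"
    and vh_eq: "b \<in> alphabet l (Suc i) \<Longrightarrow> (\<Sum>a\<in>alphabet l i. vh i a * L i a b) = vh (Suc i) b"

definition vec_norm :: "(nat \<Rightarrow> nat) \<Rightarrow> nat \<Rightarrow> (nat \<Rightarrow> real) \<Rightarrow> real" where
  "vec_norm l i u = (\<Sum>a\<in>alphabet l i. \<bar>u a\<bar>)"

definition parry_w :: "(nat \<Rightarrow> nat) \<Rightarrow> (nat \<Rightarrow> nat \<Rightarrow> real) \<Rightarrow> nat \<Rightarrow> nat \<Rightarrow> real" where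
  "parry_w l wh i a = wh i a / vec_norm l i (wh i)"

definition parry_v ::
  "(nat \<Rightarrow> nat) \<Rightarrow> (nat \<Rightarrow> nat \<Rightarrow> real) \<Rightarrow> (nat \<Rightarrow> nat \<Rightarrow> real) \<Rightarrow> nat \<Rightarrow> nat \<Rightarrow> real" where
  "parry_v l wh vh i a = vh i a / (\<Sum>b\<in>alphabet l i. vh i b * parry_w l wh i b)"

definition parry_lambda ::
  "(nat \<Rightarrow> nat) \<Rightarrow> (nat \<Rightarrow> nat \<Rightarrow> real) \<Rightarrow> nat \<Rightarrow> real" where
  "parry_lambda l wh i = vec_norm l i (wh i) / vec_norm l (Suc i) (wh (Suc i))"

definition lambda_prod ::
  "(nat \<Rightarrow> nat) \<Rightarrow> (nat \<Rightarrow> nat \<Rightarrow> real) \<Rightarrow> nat \<Rightarrow> nat \<Rightarrow> real" where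
  "lambda_prod l wh k m = (\<Prod>i\<in>{k..<m}. parry_lambda l wh i)"

definition parry_ims ::
  "(nat \<Rightarrow> nat) \<Rightarrow> (nat \<Rightarrow> nat \<Rightarrow> nat \<Rightarrow> real) \<Rightarrow> (nat \<Rightarrow> nat \<Rightarrow> real) \<Rightarrow> (nat \<Rightarrow> nat \<Rightarrow> real) \<Rightarrow>
   (nat \<Rightarrow> (nat \<Rightarrow> nat) measure) \<Rightarrow> bool" where
  "parry_ims l L wh vh \<mu> \<longleftrightarrow>
     (\<forall>k. borel_prob (shift_space l L k) (shift_dist l L k) (\<mu> k) \<and>
          (\<forall>m\<ge>k. \<forall>x\<in>words l L k m.
             measure (\<mu> k) (cylinder l L k m x) =
               1 / lambda_prod l wh k m * parry_v l wh vh k (x k) * parry_w l wh m (x m)))"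


section \<open>Quantities in the entropy estimates\<close>

definition lambda_growth :: "(nat \<Rightarrow> nat) \<Rightarrow> (nat \<Rightarrow> nat \<Rightarrow> real) \<Rightarrow> ereal" where
  "lambda_growth l wh = limsup (\<lambda>k. ereal (1 / real k * ln (lambda_prod l wh 0 k)))"

definition norm_growth :: "(nat \<Rightarrow> nat) \<Rightarrow> (nat \<Rightarrow> nat \<Rightarrow> nat \<Rightarrow> real) \<Rightarrow> ereal" where
  "norm_growth l L = limsup (\<lambda>k. ereal (1 / real k * ln (norm0 l k (Lprod l L 0 k))))"

definition maximizes_colsum ::
  "(nat \<Rightarrow> nat) \<Rightarrow> (nat \<Rightarrow> nat \<Rightarrow> nat \<Rightarrow> real) \<Rightarrow> nat \<Rightarrow> nat \<Rightarrow> bool" where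
  "maximizes_colsum l L k \<gamma> \<longleftrightarrow>
     (\<Sum>\<alpha>\<in>alphabet l 0. Lprod l L 0 k \<alpha> \<gamma>) =
       Max ((\<lambda>\<beta>. \<Sum>\<alpha>\<in>alphabet l 0. Lprod l L 0 k \<alpha> \<beta>) ` alphabet l k)"

definition prim_index :: "(nat \<Rightarrow> nat) \<Rightarrow> (nat \<Rightarrow> nat \<Rightarrow> nat \<Rightarrow> real) \<Rightarrow> nat \<Rightarrow> nat" where
  "prim_index l L k = (LEAST n. n \<ge> 1 \<and> all_positive l L k (k + n))"

end

theory Submission
  imports Defs
begin

text \<open>
  Since \<open>d\<^sub>k\<close> is defined through numbers of words, the orbit segment of length \<open>n\<close> of a point is
  determined to precision \<open>\<delta>\<close> by an initial word that exceeds coordinate \<open>n\<close> only by a stretch on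
  which the number of possible words is bounded.  Hence the number of \<open>\<delta>\<close>-distinguishable orbits of
  length \<open>n\<close> is \<open>w(0,n)\<close> up to a constant factor.  This gives \<open>h\<^sub>t\<^sub>o\<^sub>p = limsup (1/n) log w(0,n)\<close>, and, as
  an admissible partition is predicted from such orbit data outside a set of small measure, it also
  bounds the metric entropy without the power trick of the usual variational inequality.  Conversely,
  the partition into one-letter cylinders is admissible and its joins have atoms of measure at most
  a constant times \<open>1/\<lambda>\<^sup>(\<^sup>0\<^sup>,\<^sup>n\<^sup>-\<^sup>1\<^sup>)\<close>.

  For the equality cases, let \<open>lmax\<close> bound the alphabet sizes; then \<open>w(0,k) \<le> lmax * s\<close> with \<open>s\<close> the maximal column sum of \<open>L\<^sup>(\<^sup>0\<^sup>,\<^sup>k\<^sup>)\<close>, while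
  \<open>\<lambda>\<^sup>(\<^sup>0\<^sup>,\<^sup>k\<^sup>) \<ge> s * w\<^sub>k(\<gamma>)\<close> for a maximizing \<open>\<gamma>\<close>; and if row \<open>\<gamma>\<close> of \<open>L\<^sup>(\<^sup>k\<^sup>,\<^sup>n\<^sup>)\<close> has all entries at
  least \<open>1\<close>, then \<open>w\<^sub>k(\<gamma>) \<ge> 1/\<lambda>\<^sup>(\<^sup>k\<^sup>,\<^sup>n\<^sup>)\<close>.
\<close>

section \<open>Entropy estimates for general partitions\<close>

text \<open>Two things shape the proof. First, the name of an orbit of length n records one window
  per time, and it is counted by a single word only because the last window contains the ends of all
  earlier ones. This holds because least windows are monotone in time, which comes from w(k+1,r)
  \<le> w(k,r), hence from the absence of zero columns. Second, an admissible partition is predicted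
  at each time only up to a small probability of error. Over n times some errors have to be
  expected, and only their mean number is small compared with n. The entropy is therefore compared
  with weights that charge a fixed price per error, and the price \<open>- ln \<eta>\<close> is
  fixed before the error probability \<open>\<epsilon>\<close>. Reading errors at time i in terms of
  the measure at time 0 requires the invariance of the Parry measures, which is derived from the
  cylinder formula. In the equality cases the freedom lies in the choice of n for each k: only
  \<open>ln (lambda_prod l wh k n)\<close> has to grow slower than k.\<close>

lemma growth_le:
  fixes a b c :: "nat \<Rightarrow> real" and e :: ereal
  assumes "\<And>n. n \<ge> n0 \<Longrightarrow> a n \<le> b n + c n"
    and "limsup (\<lambda>n. ereal (1 / real n * c n)) \<le> e"
  shows "limsup (\<lambda>n. ereal (1 / real n * a n)) \<le> limsup (\<lambda>n. ereal (1 / real n * b n)) + e"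
proof -
  have "limsup (\<lambda>n. ereal (1 / real n * a n))
      \<le> limsup (\<lambda>n. ereal (1 / real n * b n) + ereal (1 / real n * c n))"
  proof (rule Limsup_mono)
    have "1 / real n * a n \<le> 1 / real n * b n + 1 / real n * c n" if "n \<ge> n0" for n
      using mult_left_mono[OF assms(1)[OF that], of "1 / real n"] by (simp add: distrib_left add_divide_distrib)
    then show "\<forall>\<^sub>F n in sequentially. ereal (1 / real n * a n)
        \<le> ereal (1 / real n * b n) + ereal (1 / real n * c n)"
      unfolding eventually_sequentially by (intro exI[of _ n0]) simp
  qed
  also have "\<dots> \<le> limsup (\<lambda>n. ereal (1 / real n * b n)) + limsup (\<lambda>n. ereal (1 / real n * c n))"
    by (rule ereal_limsup_add_mono)
  finally show ?thesis
    using assms(2) add_left_mono order_trans by blast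
qed

lemma limsup_bounded_over_n:
  fixes c :: "nat \<Rightarrow> real"
  assumes "\<And>n. \<bar>c n\<bar> \<le> B"
  shows "limsup (\<lambda>n. ereal (1 / real n * c n)) = 0"
proof -
  have "(\<lambda>n. 1 / real n * c n) \<longlonglongrightarrow> 0"
  proof (rule tendsto_0_le[where K = 1])
    show "(\<lambda>n. B * (1 / real n)) \<longlonglongrightarrow> 0"
      by (rule tendsto_mult_right_zero) (rule lim_1_over_n)
    have "\<bar>1 / real n * c n\<bar> \<le> \<bar>B * (1 / real n)\<bar>" for n
    proof -
      have "\<bar>c n\<bar> / real n \<le> \<bar>B\<bar> / real n"
        using assms[of n] by (intro divide_right_mono) auto
      then show ?thesis
        by (simp add: abs_mult)
    qed
    then show "\<forall>\<^sub>F n in sequentially. norm (1 / real n * c n) \<le> norm (B * (1 / real n)) * 1"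
      by (simp add: abs_mult)
  qed
  then have "(\<lambda>n. ereal (1 / real n * c n)) \<longlonglongrightarrow> ereal 0"
    by simp
  then show ?thesis
    using lim_imp_Limsup[OF sequentially_bot] unfolding zero_ereal_def by blast
qed

text \<open>The relative entropy of \<open>p\<close> against the normalized weights
  \<open>q / Z\<close> is nonnegative. The weights stay unnormalized because those used below have a
  total that factorizes over coordinates and is only estimated from above.\<close>

lemma gibbs_inequality:
  fixes p q :: "'a \<Rightarrow> real"
  assumes fin: "finite S" and p: "\<And>s. s \<in> S \<Longrightarrow> 0 \<le> p s" and p1: "(\<Sum>s\<in>S. p s) = 1"
    and q: "\<And>s. s \<in> S \<Longrightarrow> 0 < q s"
  shows "- (\<Sum>s\<in>S. p s * ln (p s)) \<le> ln (\<Sum>s\<in>S. q s) - (\<Sum>s\<in>S. p s * ln (q s))"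
proof -
  define Z where "Z = (\<Sum>s\<in>S. q s)"
  have "S \<noteq> {}"
    using p1 by auto
  then have Z: "Z > 0"
    unfolding Z_def using fin q by (intro sum_pos) auto
  \<comment> \<open>This is \<open>ln t \<le> t - 1\<close> at t = q s / (Z * p s), multiplied by
    \<open>p s\<close>. The right-hand sides sum to zero since \<open>q / Z\<close> and
    \<open>p\<close> both have total one.\<close>
  have *: "p s * ln (q s) - p s * ln (p s) - p s * ln Z \<le> q s / Z - p s" if s: "s \<in> S" for s
  proof (cases "p s = 0")
    case True
    then show ?thesis
      using q[OF s] Z by simp
  next
    case False
    then have ps: "p s > 0"
      using p[OF s] by simp
    have "ln (q s / (Z * p s)) \<le> q s / (Z * p s) - 1"
      using ps q[OF s] Z by (intro ln_le_minus_one) auto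
    then have "p s * ln (q s / (Z * p s)) \<le> p s * (q s / (Z * p s) - 1)"
      using ps by (intro mult_left_mono) auto
    also have "\<dots> = q s / Z - p s"
      using ps Z by (simp add: field_simps)
    also have "ln (q s / (Z * p s)) = ln (q s) - ln Z - ln (p s)"
      using ps q[OF s] Z by (simp add: ln_div ln_mult)
    finally show ?thesis
      by (simp add: algebra_simps)
  qed
  have "(\<Sum>s\<in>S. p s * ln (q s)) - (\<Sum>s\<in>S. p s * ln (p s)) - ln Z
      = (\<Sum>s\<in>S. p s * ln (q s) - p s * ln (p s) - p s * ln Z)"
    by (simp add: sum_subtractf p1 flip: sum_distrib_right)
  also have "\<dots> \<le> (\<Sum>s\<in>S. q s / Z - p s)"
    using * by (rule sum_mono)
  also have "\<dots> = 0"
    using Z p1 by (simp add: sum_subtractf Z_def flip: sum_divide_distrib)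
  finally show ?thesis
    by (simp add: Z_def)
qed

context prob_space
begin

lemma sum_prob_partition:
  assumes "finite S" "disjoint_family_on A S" "\<And>s. s \<in> S \<Longrightarrow> A s \<in> events"
    and "(\<Union>s\<in>S. A s) = space M"
  shows "(\<Sum>s\<in>S. prob (A s)) = 1"
  using finite_measure_finite_Union[of S A] assms prob_space by auto

text \<open>The entropy is the mean of \<open>- ln (prob (A s))\<close>, which is at least
  \<open>- ln c\<close> on every atom of positive measure; null atoms carry no weight in the
  mean.\<close>

lemma entropy_ge_of_prob_le:
  assumes S: "finite S" "disjoint_family_on A S" "\<And>s. s \<in> S \<Longrightarrow> A s \<in> events"
    and cover: "(\<Union>s\<in>S. A s) = space M"
    and le: "\<And>s. s \<in> S \<Longrightarrow> prob (A s) \<le> c" and c: "c > 0"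
  shows "- ln c \<le> - (\<Sum>s\<in>S. prob (A s) * ln (prob (A s)))"
proof -
  have "(\<Sum>s\<in>S. prob (A s) * ln (prob (A s))) \<le> (\<Sum>s\<in>S. prob (A s) * ln c)"
  proof (rule sum_mono)
    fix s assume s: "s \<in> S"
    show "prob (A s) * ln (prob (A s)) \<le> prob (A s) * ln c"
    proof (cases "prob (A s) = 0")
      case False
      then have "prob (A s) > 0"
        by (simp add: zero_less_measure_iff)
      then show ?thesis
        using le[OF s] c by (intro mult_left_mono) auto
    qed simp
  qed
  also have "\<dots> = ln c"
    using sum_prob_partition[OF S cover] by (simp flip: sum_distrib_right)
  finally show ?thesis
    by simp
qed

text \<open>
  Gibbs' inequality is applied to the weights \<open>\<Sum>c. \<Prod>i<n. \<kappa> (s i) (c i)\<close>, where \<open>c\<close> runs over the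
  predicted names and \<open>\<kappa>\<close> is \<open>1\<close> for a correct and \<open>\<eta>\<close> for a wrong prediction.
\<close>

lemma entropy_le_of_prediction:
  fixes p g :: "nat \<Rightarrow> 'a \<Rightarrow> 'b"
  assumes fin: "\<And>i. i < n \<Longrightarrow> finite (B i)" and cardB: "\<And>i. i < n \<Longrightarrow> card (B i) \<le> K"
    and p: "\<And>i x. i < n \<Longrightarrow> x \<in> space M \<Longrightarrow> p i x \<in> B i"
    and g: "\<And>i x. i < n \<Longrightarrow> x \<in> space M \<Longrightarrow> g i x \<in> B i"
    and meas: "\<And>i b. i < n \<Longrightarrow> b \<in> B i \<Longrightarrow> {x \<in> space M. p i x = b} \<in> events"
    and bad: "\<And>i. i < n \<Longrightarrow> bad i \<in> events"
    and pg: "\<And>i x. i < n \<Longrightarrow> x \<in> space M \<Longrightarrow> p i x \<noteq> g i x \<Longrightarrow> x \<in> bad i"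
    and cardC: "card ((\<lambda>x. \<lambda>i\<in>{..<n}. g i x) ` space M) \<le> N"
    and \<eta>: "0 < \<eta>" "\<eta> \<le> 1"
  defines "A \<equiv> \<lambda>s. {x \<in> space M. \<forall>i<n. p i x = s i}"
  shows "- (\<Sum>s\<in>PiE {..<n} B. prob (A s) * ln (prob (A s)))
    \<le> ln N + n * (K * \<eta>) - ln \<eta> * (\<Sum>i<n. prob (bad i))"
proof -
  define S where "S = PiE {..<n} B"
  define C where "C = (\<lambda>x. \<lambda>i\<in>{..<n}. g i x) ` space M"
  define \<kappa> where "\<kappa> = (\<lambda>b c :: 'b. if b = c then 1 else \<eta>)"
  define q where "q = (\<lambda>s. \<Sum>c\<in>C. \<Prod>i<n. \<kappa> (s i) (c i))"
  have finS: "finite S"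
    unfolding S_def using fin by (intro finite_PiE) auto
  have CS: "C \<subseteq> S"
    using g by (auto simp: C_def S_def intro!: restrict_PiE_iff[THEN iffD2])
  then have finC: "finite C"
    using finS finite_subset by blast
  have C0: "C \<noteq> {}"
    using not_empty by (simp add: C_def)
  have \<kappa>0: "\<kappa> b c > 0" for b c
    using \<eta> by (simp add: \<kappa>_def)
  have q0: "q s > 0" for s
    unfolding q_def using finC C0 \<kappa>0 by (intro sum_pos prod_pos) auto
  have Aev: "A s \<in> events" if "s \<in> S" for s
  proof (cases "n = 0")
    case True
    then show ?thesis
      by (simp add: A_def)
  next
    case False
    then have "A s = (\<Inter>i\<in>{..<n}. {x \<in> space M. p i x = s i})"
      by (auto simp: A_def)
    also have "\<dots> \<in> events"
      using False that meas by (intro sets.finite_INT) (auto simp: S_def)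
    finally show ?thesis .
  qed
  have Adisj: "disjoint_family_on A S"
    unfolding disjoint_family_on_def
  proof (intro ballI impI)
    fix s t assume "s \<in> S" "t \<in> S" "s \<noteq> t"
    then obtain i where "i < n" "s i \<noteq> t i"
      unfolding S_def by (metis PiE_ext lessThan_iff)
    then show "A s \<inter> A t = {}"
      by (auto simp: A_def)
  qed
  have Acov: "(\<Union>s\<in>S. A s) = space M"
  proof -
    have "x \<in> A (\<lambda>i\<in>{..<n}. p i x)" "(\<lambda>i\<in>{..<n}. p i x) \<in> S" if "x \<in> space M" for x
      using that p by (auto simp: A_def S_def)
    then have "space M \<subseteq> (\<Union>s\<in>S. A s)"
      by blast
    then show ?thesis
      by (auto simp: A_def)
  qed
  have A1: "(\<Sum>s\<in>S. prob (A s)) = 1"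
    using sum_prob_partition finS Adisj Aev Acov by blast
  \<comment> \<open>For a fixed predicted name the sum over all names factorizes over the
    coordinates. Each factor consists of one match of weight 1 and at most \<open>K\<close>
    mismatches of weight \<open>\<eta>\<close>, hence the bound N * (1 + K * \<eta>) ^ n.\<close>
  have sumq: "ln (\<Sum>s\<in>S. q s) \<le> ln N + n * (K * \<eta>)"
  proof -
    have "(\<Sum>s\<in>S. q s) = (\<Sum>c\<in>C. \<Sum>s\<in>S. \<Prod>i<n. \<kappa> (s i) (c i))"
      unfolding q_def by (rule sum.swap)
    also have "\<dots> = (\<Sum>c\<in>C. \<Prod>i<n. \<Sum>b\<in>B i. \<kappa> b (c i))"
      unfolding S_def using fin by (subst prod_sum_PiE) auto
    also have "\<dots> \<le> (\<Sum>c\<in>C. \<Prod>i<n. 1 + K * \<eta>)"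
    proof (intro sum_mono prod_mono conjI)
      fix c i assume "c \<in> C" and i: "i \<in> {..<n}"
      show "0 \<le> (\<Sum>b\<in>B i. \<kappa> b (c i))"
        using \<kappa>0 by (intro sum_nonneg) (simp add: less_imp_le)
      have "(\<Sum>b\<in>B i. \<kappa> b (c i)) \<le> (\<Sum>b\<in>B i. (if c i = b then 1 else 0) + \<eta>)"
        using \<eta> by (intro sum_mono) (auto simp: \<kappa>_def)
      also have "\<dots> \<le> 1 + card (B i) * \<eta>"
        using fin i by (simp add: sum.distrib)
      also have "\<dots> \<le> 1 + K * \<eta>"
        using cardB i \<eta> by (simp add: mult_right_mono)
      finally show "(\<Sum>b\<in>B i. \<kappa> b (c i)) \<le> 1 + K * \<eta>" .
    qed
    also have "\<dots> = card C * (1 + K * \<eta>) ^ n"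
      by simp
    also have "\<dots> \<le> N * exp (K * \<eta>) ^ n"
      using cardC \<eta> by (intro mult_mono power_mono exp_ge_add_one_self) (auto simp: C_def)
    finally have *: "(\<Sum>s\<in>S. q s) \<le> N * exp (K * \<eta>) ^ n" .
    have "card C > 0"
      using finC C0 by (simp add: card_gt_0_iff)
    then have "N > 0"
      using cardC by (simp add: C_def)
    have "(\<Sum>s\<in>S. q s) > 0"
      using finS CS C0 q0 by (intro sum_pos) auto
    then have "ln (\<Sum>s\<in>S. q s) \<le> ln (N * exp (K * \<eta>) ^ n)"
      using * by simp
    also have "\<dots> = ln N + n * (K * \<eta>)"
      using \<open>N > 0\<close> by (simp add: ln_mult ln_realpow)
    finally show ?thesis .
  qed
  \<comment> \<open>Of the sum defining \<open>q s\<close> only the prediction made at the point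
    itself is kept. It has weight \<open>\<eta>\<close> to the number of its errors, so
    \<open>- ln (q s)\<close> is at most \<open>- ln \<eta>\<close> times the number of bad times;
    integration turns these into probabilities.\<close>
  have cost: "- (\<Sum>s\<in>S. prob (A s) * ln (q s)) \<le> - ln \<eta> * (\<Sum>i<n. prob (bad i))"
  proof -
    have point: "(\<Sum>s\<in>S. - ln (q s) * indicator (A s) x) \<le> (\<Sum>i<n. - ln \<eta> * indicator (bad i) x)"
      if x: "x \<in> space M" for x
    proof -
      define s where "s = (\<lambda>i\<in>{..<n}. p i x)"
      define c where "c = (\<lambda>i\<in>{..<n}. g i x)"
      have s: "s \<in> S" "x \<in> A s" and c: "c \<in> C"
        using x p by (auto simp: A_def S_def s_def c_def C_def)
      have "(\<Sum>t\<in>S. - ln (q t) * indicator (A t) x) = (\<Sum>t\<in>S. if t = s then - ln (q s) else 0)"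
      proof (rule sum.cong)
        fix t assume t: "t \<in> S"
        then have "x \<notin> A t" if "t \<noteq> s"
          using Adisj s that unfolding disjoint_family_on_def by blast
        then show "- ln (q t) * indicator (A t) x = (if t = s then - ln (q s) else 0)"
          using s by auto
      qed simp
      also have "\<dots> = - ln (q s)"
        using s finS by simp
      also have "\<dots> \<le> - ln (\<Prod>i<n. \<kappa> (s i) (c i))"
      proof -
        have "(\<Prod>i<n. \<kappa> (s i) (c i)) \<le> q s"
          unfolding q_def using c finC \<kappa>0
          by (intro member_le_sum[where f = "\<lambda>c. \<Prod>i<n. \<kappa> (s i) (c i)"] prod_nonneg)
            (auto simp: less_imp_le)
        moreover have "(\<Prod>i<n. \<kappa> (s i) (c i)) > 0"
          using \<kappa>0 by (intro prod_pos) auto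
        ultimately show ?thesis
          by simp
      qed
      also have "\<dots> = (\<Sum>i<n. - ln (\<kappa> (s i) (c i)))"
        using \<kappa>0 by (subst ln_prod) (auto simp: sum_negf less_imp_neq[symmetric])
      also have "\<dots> \<le> (\<Sum>i<n. - ln \<eta> * indicator (bad i) x)"
      proof (rule sum_mono)
        fix i assume i: "i \<in> {..<n}"
        have "ln \<eta> \<le> 0"
          using \<eta> by simp
        then show "- ln (\<kappa> (s i) (c i)) \<le> - ln \<eta> * indicator (bad i) x"
          using pg[of i x] i x by (auto simp: \<kappa>_def s_def c_def indicator_def)
      qed
      finally show ?thesis .
    qed
    have intA: "integrable M (\<lambda>x. - ln (q s) * indicator (A s) x)" if "s \<in> S" for s
      using Aev[OF that] by (intro integrable_mult_right) (simp add: emeasure_eq_measure)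
    have intB: "integrable M (\<lambda>x. - ln \<eta> * indicator (bad i) x)" if "i < n" for i
      using bad[OF that] by (intro integrable_mult_right) (simp add: emeasure_eq_measure)
    have "- (\<Sum>s\<in>S. prob (A s) * ln (q s)) = (\<Sum>s\<in>S. \<integral>x. - ln (q s) * indicator (A s) x \<partial>M)"
      unfolding sum_negf[symmetric] using Aev by (intro sum.cong) (auto simp: mult.commute)
    also have "\<dots> = (\<integral>x. (\<Sum>s\<in>S. - ln (q s) * indicator (A s) x) \<partial>M)"
      using intA by (intro Bochner_Integration.integral_sum[symmetric]) auto
    also have "\<dots> \<le> (\<integral>x. (\<Sum>i<n. - ln \<eta> * indicator (bad i) x) \<partial>M)"
      using intA intB point by (intro integral_mono Bochner_Integration.integrable_sum) auto
    also have "\<dots> = (\<Sum>i<n. \<integral>x. - ln \<eta> * indicator (bad i) x \<partial>M)"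
      using intB by (intro Bochner_Integration.integral_sum) auto
    also have "\<dots> = - ln \<eta> * (\<Sum>i<n. prob (bad i))"
      unfolding sum_distrib_left using bad by (intro sum.cong) auto
    finally show ?thesis .
  qed
  have "- (\<Sum>s\<in>S. prob (A s) * ln (prob (A s))) \<le> ln (\<Sum>s\<in>S. q s) - (\<Sum>s\<in>S. prob (A s) * ln (q s))"
    using finS A1 q0 by (intro gibbs_inequality) auto
  then show ?thesis
    using sumq cost by (simp add: S_def)
qed

end

section \<open>Joins as indexed families of atoms\<close>

lemma join_eq:
  "join X f C n = (\<lambda>s. {x \<in> X 0. \<forall>i<n. iter f i x \<in> s i}) ` PiE {..<n} C"
proof (intro equalityI subsetI)
  fix J assume "J \<in> join X f C n"
  then obtain s where J: "J = X 0 \<inter> (\<Inter>i\<in>{..<n}. s i)" and "\<forall>i<n. s i \<in> pullback X f i (C i)"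
    by (auto simp: join_def)
  then have "\<forall>i<n. \<exists>c. c \<in> C i \<and> s i = {x \<in> X 0. iter f i x \<in> c}"
    by (auto simp: pullback_def)
  then obtain c where c: "\<forall>i<n. c i \<in> C i \<and> s i = {x \<in> X 0. iter f i x \<in> c i}"
    by metis
  then have "J = {x \<in> X 0. \<forall>i<n. iter f i x \<in> restrict c {..<n} i}"
    using J by auto
  moreover have "restrict c {..<n} \<in> PiE {..<n} C"
    using c by auto
  ultimately show "J \<in> (\<lambda>s. {x \<in> X 0. \<forall>i<n. iter f i x \<in> s i}) ` PiE {..<n} C"
    by blast
next
  fix J assume "J \<in> (\<lambda>s. {x \<in> X 0. \<forall>i<n. iter f i x \<in> s i}) ` PiE {..<n} C"
  then obtain s where s: "s \<in> PiE {..<n} C" and J: "J = {x \<in> X 0. \<forall>i<n. iter f i x \<in> s i}"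
    by blast
  then have "J = X 0 \<inter> (\<Inter>i\<in>{..<n}. {x \<in> X 0. iter f i x \<in> s i})"
    by auto
  moreover have "\<forall>i<n. {x \<in> X 0. iter f i x \<in> s i} \<in> pullback X f i (C i)"
    using s by (auto simp: pullback_def)
  ultimately show "J \<in> join X f C n"
    unfolding join_def by blast
qed

lemma disjoint_join_atoms:
  assumes "\<And>i. i < n \<Longrightarrow> disjoint (P i)"
  shows "disjoint_family_on (\<lambda>s. {x \<in> X. \<forall>i<n. f i x \<in> s i}) (PiE {..<n} P)"
  unfolding disjoint_family_on_def
proof (intro ballI impI)
  fix s t assume st: "s \<in> PiE {..<n} P" "t \<in> PiE {..<n} P" "s \<noteq> t"
  then obtain i where i: "i < n" "s i \<noteq> t i"
    by (metis PiE_ext lessThan_iff)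
  then have "s i \<inter> t i = {}"
    using st assms[of i] by (auto simp: disjoint_def PiE_iff)
  then show "{x \<in> X. \<forall>i<n. f i x \<in> s i} \<inter> {x \<in> X. \<forall>i<n. f i x \<in> t i} = {}"
    using i by blast
qed

text \<open>Distinct choice functions \<open>s\<close> give the same atom only if it is empty, and
  then the term is \<open>0 * ln 0 = 0\<close>. So the sum over the set of atoms may be taken over
  the choice functions.\<close>

lemma part_entropy_join:
  fixes X :: "nat \<Rightarrow> 'a set" and f :: "nat \<Rightarrow> 'a \<Rightarrow> 'a"
  assumes "\<And>i. i < n \<Longrightarrow> finite (P i)" "\<And>i. i < n \<Longrightarrow> disjoint (P i)"
  defines "A \<equiv> \<lambda>s. {x \<in> X 0. \<forall>i<n. iter f i x \<in> s i}"
  shows "part_entropy M (join X f P n)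
    = - (\<Sum>s\<in>PiE {..<n} P. measure M (A s) * ln (measure M (A s)))"
proof -
  have "measure M (A t) = 0" if "s \<in> PiE {..<n} P" "t \<in> PiE {..<n} P" "s \<noteq> t" "A s = A t" for s t
  proof -
    have "A s \<inter> A t = {}"
      using disjoint_join_atoms[of n P "X 0" "iter f"] assms(2) that
      unfolding disjoint_family_on_def A_def by blast
    then show ?thesis
      using that by simp
  qed
  then have "(\<Sum>J\<in>A ` PiE {..<n} P. measure M J * ln (measure M J))
      = (\<Sum>s\<in>PiE {..<n} P. measure M (A s) * ln (measure M (A s)))"
    using assms(1) by (subst sum.reindex_nontrivial) (fastforce intro!: finite_PiE)+
  then show ?thesis
    by (simp add: part_entropy_def join_eq A_def)
qed


section \<open>Words, cylinders and the metric\<close>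

context nsft
begin

definition lmax :: nat where
  "lmax = (SUP i. l i)"

lemma l_le_lmax: "l i \<le> lmax"
  unfolding lmax_def using alphabets_bounded by (intro cSUP_upper) auto

lemma lmax_pos: "lmax > 0"
  using l_le_lmax[of 0] alphabet_nonempty[of 0] by linarith

lemma finite_alphabet [simp]: "finite (alphabet l i)"
  and card_alphabet [simp]: "card (alphabet l i) = l i"
  by (simp_all add: alphabet_def)

lemma alphabet_not_empty: "alphabet l i \<noteq> {}"
  using alphabet_nonempty[of i] by (simp add: alphabet_def)

section \<open>Restricting, extending and counting words\<close>

lemma words_restrict:
  "x \<in> words l L k m \<Longrightarrow> k \<le> k' \<Longrightarrow> m' \<le> m \<Longrightarrow> restrict x {k'..m'} \<in> words l L k' m'"
  by (auto simp: words_def PiE_iff)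

lemma point_restrict_word:
  "x \<in> shift_space l L k \<Longrightarrow> k \<le> k' \<Longrightarrow> restrict x {k'..m} \<in> words l L k' m"
  by (auto simp: words_def shift_space_def PiE_iff)

lemma point_restrict:
  "x \<in> shift_space l L k \<Longrightarrow> k \<le> k' \<Longrightarrow> restrict x {k'..} \<in> shift_space l L k'"
  by (auto simp: shift_space_def PiE_iff)

lemma point_letter: "x \<in> shift_space l L k \<Longrightarrow> k \<le> i \<Longrightarrow> x i \<in> alphabet l i"
  by (auto simp: shift_space_def PiE_iff)

lemma point_eqI:
  "x \<in> shift_space l L k \<Longrightarrow> y \<in> shift_space l L k \<Longrightarrow> (\<And>i. k \<le> i \<Longrightarrow> x i = y i) \<Longrightarrow> x = y"
  by (rule PiE_ext[of x "{k..}" "alphabet l" y]) (auto simp: shift_space_def)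

lemma word_eqI:
  "x \<in> words l L k m \<Longrightarrow> y \<in> words l L k m \<Longrightarrow> (\<And>i. k \<le> i \<Longrightarrow> i \<le> m \<Longrightarrow> x i = y i) \<Longrightarrow> x = y"
  by (rule PiE_ext[of x "{k..m}" "alphabet l" y]) (auto simp: words_def)

lemma word_extend_left:
  assumes "x \<in> words l L (Suc k) m" "Suc k \<le> m"
  shows "\<exists>a. x(k := a) \<in> words l L k m"
proof -
  have "x (Suc k) \<in> alphabet l (Suc k)"
    using assms by (auto simp: words_def)
  then obtain a where a: "a \<in> alphabet l k" "L k a (x (Suc k)) = 1"
    using col_nonzero[of "x (Suc k)" k] zero_one by blast
  have "x(k := a) \<in> words l L k m"
    using assms a by (auto simp: words_def PiE_iff extensional_def)
  then show ?thesis ..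
qed

lemma word_extends_to_point:
  assumes "x \<in> words l L k m" "k \<le> m"
  obtains y where "y \<in> shift_space l L k" "\<And>i. k \<le> i \<Longrightarrow> i \<le> m \<Longrightarrow> y i = x i"
proof -
  have "\<exists>f. \<forall>n. f n \<in> alphabet l (m + n) \<and> (n = 0 \<longrightarrow> f n = x m) \<and> L (m + n) (f n) (f (Suc n)) = 1"
  proof -
    have "x m \<in> alphabet l m"
      using assms by (auto simp: words_def)
    then have "\<exists>a. a \<in> alphabet l (m + 0) \<and> (0 = (0::nat) \<longrightarrow> a = x m)"
      by simp
    moreover have "\<exists>b. (b \<in> alphabet l (m + Suc n) \<and> (Suc n = 0 \<longrightarrow> b = x m)) \<and> L (m + n) a b = 1"
      if "a \<in> alphabet l (m + n) \<and> (n = 0 \<longrightarrow> a = x m)" for a n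
      using row_nonzero[of a "m + n"] zero_one[of a "m + n"] that by auto
    ultimately show ?thesis
      using dependent_nat_choice[of "\<lambda>n a. a \<in> alphabet l (m + n) \<and> (n = 0 \<longrightarrow> a = x m)"
        "\<lambda>n a b. L (m + n) a b = 1"] by blast
  qed
  then obtain f where f: "\<And>n. f n \<in> alphabet l (m + n)" "f 0 = x m"
    "\<And>n. L (m + n) (f n) (f (Suc n)) = 1"
    by blast
  define y where "y = (\<lambda>i. if i \<le> m then x i else f (i - m))"
  have "L i (y i) (y (Suc i)) = 1" if "k \<le> i" for i
  proof (cases "i < m")
    case True
    then show ?thesis
      using assms that by (auto simp: y_def words_def)
  next
    case False
    then have "y i = f (i - m)" "y (Suc i) = f (Suc (i - m))"
      using f(2) by (auto simp: y_def Suc_diff_le)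
    then show ?thesis
      using f(3)[of "i - m"] False by simp
  qed
  moreover have "y i \<in> alphabet l i" if "k \<le> i" for i
    using f(1)[of "i - m"] assms that by (auto simp: y_def words_def)
  moreover have "y i = undefined" if "\<not> k \<le> i" for i
    using assms that by (auto simp: y_def words_def PiE_iff extensional_def)
  ultimately have "y \<in> shift_space l L k"
    by (auto simp: shift_space_def PiE_iff extensional_def)
  then show ?thesis
    using that by (auto simp: y_def)
qed

text \<open>Since no column vanishes, a letter can be prepended to every word. This inequality is
  the source of \<open>shift_dist_le_tail\<close> and thereby of the monotonicity of
  windows.\<close>

lemma num_words_tail:
  assumes "Suc k \<le> m"
  shows "num_words l L (Suc k) m \<le> num_words l L k m"
proof -
  have "words l L (Suc k) m \<subseteq> (\<lambda>x. restrict x {Suc k..m}) ` words l L k m"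
  proof
    fix x assume x: "x \<in> words l L (Suc k) m"
    then obtain a where a: "x(k := a) \<in> words l L k m"
      using word_extend_left assms by blast
    have "x = restrict (x(k := a)) {Suc k..m}"
      using x by (auto simp: words_def PiE_iff extensional_def fun_eq_iff)
    then show "x \<in> (\<lambda>x. restrict x {Suc k..m}) ` words l L k m"
      using a by blast
  qed
  then show ?thesis
    unfolding num_words_def using finite_words surj_card_le by blast
qed

lemma num_words_split:
  assumes "k \<le> j" "j \<le> m"
  shows "num_words l L k m \<le> num_words l L k j * num_words l L j m"
proof -
  have "inj_on (\<lambda>x. (restrict x {k..j}, restrict x {j..m})) (words l L k m)"
  proof (rule inj_onI)
    fix x y assume x: "x \<in> words l L k m" and y: "y \<in> words l L k m"
      and "(restrict x {k..j}, restrict x {j..m}) = (restrict y {k..j}, restrict y {j..m})"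
    then have e: "restrict x {k..j} = restrict y {k..j}" "restrict x {j..m} = restrict y {j..m}"
      by simp_all
    have "x i = y i" if "i \<in> {k..m}" for i
      using fun_cong[OF e(1), of i] fun_cong[OF e(2), of i] that by (cases "i \<le> j") auto
    then show "x = y"
      by (intro word_eqI[OF x y]) auto
  qed
  moreover have "(\<lambda>x. (restrict x {k..j}, restrict x {j..m})) ` words l L k m
      \<subseteq> words l L k j \<times> words l L j m"
    using words_restrict assms by auto
  ultimately have "card (words l L k m) \<le> card (words l L k j \<times> words l L j m)"
    by (intro card_inj_on_le) (auto simp: finite_words)
  then show ?thesis
    by (simp add: num_words_def card_cartesian_product)
qed

lemma num_words_Suc_le:
  assumes "k \<le> m"
  shows "num_words l L k (Suc m) \<le> num_words l L k m * lmax"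
proof -
  have "inj_on (\<lambda>x. (restrict x {k..m}, x (Suc m))) (words l L k (Suc m))"
  proof (rule inj_onI)
    fix x y assume x: "x \<in> words l L k (Suc m)" and y: "y \<in> words l L k (Suc m)"
      and "(restrict x {k..m}, x (Suc m)) = (restrict y {k..m}, y (Suc m))"
    then have e: "restrict x {k..m} = restrict y {k..m}" "x (Suc m) = y (Suc m)"
      by simp_all
    have "x i = y i" if "i \<in> {k..Suc m}" for i
      using fun_cong[OF e(1), of i] e(2) that by (auto simp: le_Suc_eq)
    then show "x = y"
      by (intro word_eqI[OF x y]) auto
  qed
  moreover have "(\<lambda>x. (restrict x {k..m}, x (Suc m))) ` words l L k (Suc m)
      \<subseteq> words l L k m \<times> alphabet l (Suc m)"
    using words_restrict[of _ k "Suc m" k m] assms by (auto simp: words_def)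
  ultimately have "card (words l L k (Suc m)) \<le> card (words l L k m \<times> alphabet l (Suc m))"
    by (intro card_inj_on_le) (auto simp: finite_words)
  also have "\<dots> \<le> card (words l L k m) * lmax"
    by (simp add: card_cartesian_product l_le_lmax)
  finally show ?thesis
    by (simp add: num_words_def)
qed

lemma num_words_one: "num_words l L k k \<le> lmax"
proof -
  have "inj_on (\<lambda>x. x k) (words l L k k)"
    by (auto simp: inj_on_def words_def intro: PiE_ext)
  then have "card (words l L k k) \<le> card (alphabet l k)"
    by (intro card_inj_on_le[where f = "\<lambda>x. x k"]) (auto simp: words_def)
  then show ?thesis
    using l_le_lmax[of k] by (simp add: num_words_def)
qed

section \<open>Distance and length of agreement\<close>

lemma shift_dist_cases:
  assumes x: "x \<in> shift_space l L k" and y: "y \<in> shift_space l L k" and "x \<noteq> y" "x k = y k"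
  obtains r where "k \<le> r" "\<And>i. k \<le> i \<Longrightarrow> i \<le> r \<Longrightarrow> x i = y i" "x (Suc r) \<noteq> y (Suc r)"
    "shift_dist l L k x y = 1 / real (num_words l L k r)"
proof -
  define S where "S = {r. k \<le> r \<and> (\<forall>i\<in>{k..r}. x i = y i)}"
  obtain i where i: "k \<le> i" "x i \<noteq> y i"
    using point_eqI[OF x y] \<open>x \<noteq> y\<close> by blast
  have "r < i" if "r \<in> S" for r
  proof (rule ccontr)
    assume "\<not> r < i"
    then show False
      using that i by (auto simp: S_def)
  qed
  then have fin: "finite S"
    using finite_subset[of S "{..<i}"] by blast
  have S_iff: "r \<in> S \<longleftrightarrow> k \<le> r \<and> (\<forall>i. k \<le> i \<and> i \<le> r \<longrightarrow> x i = y i)" for r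
    by (auto simp: S_def)
  define M where "M = Max S"
  have "k \<in> S"
    using assms by (auto simp: S_iff dest: le_antisym)
  then have M: "M \<in> S"
    unfolding M_def using fin Max_in by blast
  have "Suc M \<notin> S"
    unfolding M_def using fin Max_ge Suc_n_not_le_n by blast
  then have "x (Suc M) \<noteq> y (Suc M)"
    using M unfolding S_iff by (metis le_Suc_eq)
  moreover have "shift_dist l L k x y = 1 / real (num_words l L k M)"
    using assms by (simp add: shift_dist_def M_def S_def)
  moreover have "k \<le> M" "\<And>i. k \<le> i \<Longrightarrow> i \<le> M \<Longrightarrow> x i = y i"
    using M unfolding S_iff by blast+
  ultimately show ?thesis
    using that by blast
qed

lemma shift_dist_le:
  assumes "x \<in> shift_space l L k" "y \<in> shift_space l L k" "k \<le> m" "\<And>i. k \<le> i \<Longrightarrow> i \<le> m \<Longrightarrow> x i = y i"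
  shows "shift_dist l L k x y \<le> 1 / real (num_words l L k m)"
proof (cases "x = y")
  case True
  then show ?thesis
    by (simp add: shift_dist_def)
next
  case False
  have "x k = y k"
    using assms by simp
  from shift_dist_cases[OF assms(1,2) False this] obtain r where r: "k \<le> r"
    "x (Suc r) \<noteq> y (Suc r)" "shift_dist l L k x y = 1 / real (num_words l L k r)"
    by metis
  then have "m \<le> r"
    using assms(3,4) by (metis le_Suc_eq not_less_eq_eq nat_le_linear order_trans)
  then show ?thesis
    using r num_words_mono[of k m r] num_words_pos[of k m] assms(3) by (simp add: frac_le)
qed

text \<open>Word counts may stay constant over a stretch, so a distance equal to the bound would not
  exclude a disagreement before \<open>m\<close>. Strictness does, since 1 / w(k,r) is never below 1
  / w(k,m) for r \<le> m.\<close>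

lemma shift_dist_lt_imp_agree:
  assumes "x \<in> shift_space l L k" "y \<in> shift_space l L k" "k \<le> m"
    and lt: "shift_dist l L k x y < 1 / real (num_words l L k m)" and i: "k \<le> i" "i \<le> m"
  shows "x i = y i"
proof (cases "x = y \<or> x k \<noteq> y k")
  case True
  have "1 / real (num_words l L k m) \<le> 1"
    using num_words_pos[OF assms(3)] by simp
  then have "x k = y k"
    using lt by (auto simp: shift_dist_def split: if_splits)
  then have "x = y"
    using True by blast
  then show ?thesis
    by simp
next
  case False
  then obtain r where r: "k \<le> r" "\<And>i. k \<le> i \<Longrightarrow> i \<le> r \<Longrightarrow> x i = y i"
    "shift_dist l L k x y = 1 / real (num_words l L k r)"
    using shift_dist_cases[OF assms(1,2)] by metis
  have "\<not> r \<le> m"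
  proof
    assume "r \<le> m"
    then have "1 / real (num_words l L k m) \<le> 1 / real (num_words l L k r)"
      using num_words_mono[of k r m] num_words_pos[of k r] r by (simp add: frac_le)
    then show False
      using lt r by simp
  qed
  then show ?thesis
    using r i by simp
qed

lemma shift_dist_lt_1: "shift_dist l L k x y < 1 \<Longrightarrow> x k = y k"
  by (auto simp: shift_dist_def split: if_splits)

text \<open>Both pairs first disagree at the same absolute index, and with one more letter in front
  there are at least as many words. For distinct points, agreement at \<open>Suc k\<close> puts the
  right-hand side into the branch of the metric that counts words.\<close>

lemma shift_dist_le_tail:
  assumes x: "x \<in> shift_space l L k" and y: "y \<in> shift_space l L k"
    and "x k = y k" "x (Suc k) = y (Suc k)"
  shows "shift_dist l L k x y \<le> shift_dist l L (Suc k) (restrict x {Suc k..}) (restrict y {Suc k..})"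
proof (cases "x = y")
  case False
  define x' y' where "x' = restrict x {Suc k..}" and "y' = restrict y {Suc k..}"
  have x': "x' \<in> shift_space l L (Suc k)" and y': "y' \<in> shift_space l L (Suc k)"
    using point_restrict[of _ k "Suc k"] x y by (auto simp: x'_def y'_def)
  have ne: "x' \<noteq> y'"
  proof
    assume e: "x' = y'"
    have "x i = y i" if "k \<le> i" for i
      using \<open>x k = y k\<close> that fun_cong[OF e, of i] by (cases "i = k") (auto simp: x'_def y'_def)
    then show False
      using point_eqI[OF x y] False by blast
  qed
  have "x' (Suc k) = y' (Suc k)"
    using assms by (simp add: x'_def y'_def)
  from shift_dist_cases[OF x' y' ne this] obtain r where r: "Suc k \<le> r"
    "\<And>i. Suc k \<le> i \<Longrightarrow> i \<le> r \<Longrightarrow> x' i = y' i"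
    "shift_dist l L (Suc k) x' y' = 1 / real (num_words l L (Suc k) r)"
    by metis
  have "x i = y i" if "k \<le> i" "i \<le> r" for i
    using r(2)[of i] that \<open>x k = y k\<close> by (cases "i = k") (auto simp: x'_def y'_def)
  then have "shift_dist l L k x y \<le> 1 / real (num_words l L k r)"
    using r by (intro shift_dist_le x y) auto
  also have "\<dots> \<le> 1 / real (num_words l L (Suc k) r)"
    using num_words_tail[of k r] num_words_pos[of "Suc k" r] r by (simp add: frac_le)
  finally show ?thesis
    using r by (simp add: x'_def y'_def)
qed (simp add: shift_dist_def)

text \<open>One more letter multiplies the number of words by at most \<open>lmax\<close>, so the
  first count above \<open>c\<close> does not overshoot far. The summand 1 covers
  \<open>j = k\<close>, where there is no previous count and only \<open>num_words_one\<close>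
  helps.\<close>

lemma first_many_words:
  fixes c :: real
  assumes c: "c \<ge> 0" and "k \<le> m" "real (num_words l L k m) > c"
  obtains j where "k \<le> j" "real (num_words l L k j) > c" "real (num_words l L k j) \<le> lmax * (1 + c)"
proof -
  define j where "j = (LEAST j. k \<le> j \<and> real (num_words l L k j) > c)"
  have j: "k \<le> j" "real (num_words l L k j) > c"
    using LeastI[of "\<lambda>j. k \<le> j \<and> real (num_words l L k j) > c" m] assms by (auto simp: j_def)
  have "real (num_words l L k j) \<le> lmax * (1 + c)"
  proof (cases "j = k")
    case True
    have "real lmax * 1 \<le> lmax * (1 + c)"
      using c by (intro mult_left_mono) auto
    then show ?thesis
      using num_words_one[of k] True by simp
  next
    case False
    then obtain i where i: "j = Suc i" "k \<le> i"
      using j by (cases j) auto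
    then have "\<not> (real (num_words l L k i) > c)"
      using not_less_Least[of i "\<lambda>j. k \<le> j \<and> real (num_words l L k j) > c"] by (auto simp: j_def)
    then have "real (num_words l L k i) * lmax \<le> (1 + c) * lmax"
      by (intro mult_right_mono) auto
    moreover have "real (num_words l L k j) \<le> real (num_words l L k i) * lmax"
      using num_words_Suc_le[OF i(2)] i(1) of_nat_mono by fastforce
    ultimately show ?thesis
      by (simp add: mult.commute)
  qed
  then show ?thesis
    using j that by blast
qed

text \<open>If the number of words stays bounded, then the space is finite and cylinders become points.\<close>

lemma finite_resolution:
  assumes \<delta>: "\<delta> > 0"
  obtains m where "k \<le> m" "real (num_words l L k m) \<le> lmax * (1 + 1 / \<delta>)"
    "\<And>x y. x \<in> shift_space l L k \<Longrightarrow> y \<in> shift_space l L k \<Longrightarrow>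
      (\<And>i. k \<le> i \<Longrightarrow> i \<le> m \<Longrightarrow> x i = y i) \<Longrightarrow> shift_dist l L k x y < \<delta>"
proof (cases "\<exists>m\<ge>k. real (num_words l L k m) > 1 / \<delta>")
  case True
  then obtain m where m: "k \<le> m" "real (num_words l L k m) > 1 / \<delta>"
    "real (num_words l L k m) \<le> lmax * (1 + 1 / \<delta>)"
    using first_many_words[of "1 / \<delta>" k] \<delta> by auto
  have "1 / real (num_words l L k m) < \<delta>"
    using m \<delta> num_words_pos[of k m] by (simp add: field_simps)
  then show ?thesis
    using that m shift_dist_le[of _ k _ m] by (meson le_less_trans)
next
  case False
  then have le: "real (num_words l L k m) \<le> 1 / \<delta>" if "k \<le> m" for m
    using that by (simp add: not_less)
  \<comment> \<open>The bounded set of counts has a maximum; once w(k,.) reaches it, monotonicity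
    freezes it.\<close>
  have "\<exists>m\<ge>k. \<forall>j\<ge>m. num_words l L k j = num_words l L k m"
  proof -
    define N where "N = num_words l L k ` {k..}"
    have "N \<subseteq> {..nat \<lfloor>1 / \<delta>\<rfloor>}"
      using le by (auto simp: N_def le_nat_floor)
    then have "finite N"
      using finite_subset by blast
    moreover have "N \<noteq> {}"
      by (auto simp: N_def)
    ultimately have "Max N \<in> N"
      using Max_in by blast
    then obtain m where m: "k \<le> m" "num_words l L k m = Max N"
      by (auto simp: N_def)
    have "num_words l L k j = num_words l L k m" if "m \<le> j" for j
    proof (rule antisym)
      show "num_words l L k j \<le> num_words l L k m"
        using m that \<open>finite N\<close> by (auto simp: N_def intro!: Max_ge)
    qed (use num_words_mono[OF m(1) that] in simp)
    then show ?thesis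
      using m by blast
  qed
  then obtain m where m: "k \<le> m" "\<And>j. m \<le> j \<Longrightarrow> num_words l L k j = num_words l L k m"
    by blast
  have "shift_dist l L k x y < \<delta>" if x: "x \<in> shift_space l L k" and y: "y \<in> shift_space l L k"
    and agree: "\<And>i. k \<le> i \<Longrightarrow> i \<le> m \<Longrightarrow> x i = y i" for x y
  proof -
    have "x j = y j" if j: "k \<le> j" for j
    proof (cases "j \<le> m")
      case False
      have sub: "words l L k m \<subseteq> (\<lambda>x. restrict x {k..m}) ` words l L k j"
      proof
        fix u assume u: "u \<in> words l L k m"
        then obtain z where z: "z \<in> shift_space l L k" "\<And>i. k \<le> i \<Longrightarrow> i \<le> m \<Longrightarrow> z i = u i"
          using word_extends_to_point m(1) by blast
        have "u = restrict (restrict z {k..j}) {k..m}"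
          using u z False by (auto simp: words_def PiE_iff extensional_def fun_eq_iff)
        then show "u \<in> (\<lambda>x. restrict x {k..m}) ` words l L k j"
          using point_restrict_word[OF z(1)] by blast
      qed
      \<comment> \<open>Restriction to \<open>{k..m}\<close> reaches every shorter word because
        words extend. Equal counts then make it injective, so agreement up to \<open>m\<close>
        propagates to all \<open>j\<close>.\<close>
      have "card ((\<lambda>x. restrict x {k..m}) ` words l L k j) = card (words l L k j)"
      proof (rule antisym)
        have "card (words l L k m) \<le> card ((\<lambda>x. restrict x {k..m}) ` words l L k j)"
          using sub finite_words by (intro card_mono) auto
        then show "card (words l L k j) \<le> card ((\<lambda>x. restrict x {k..m}) ` words l L k j)"
          using m(2)[of j] False by (simp add: num_words_def)
      qed (use finite_words card_image_le in blast)
      then have inj: "inj_on (\<lambda>x. restrict x {k..m}) (words l L k j)"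
        using finite_words eq_card_imp_inj_on by blast
      have e: "restrict x {k..j} = restrict y {k..j}"
      proof (rule inj_onD[OF inj])
        show "restrict (restrict x {k..j}) {k..m} = restrict (restrict y {k..j}) {k..m}"
          using agree by (auto simp: fun_eq_iff)
      qed (use point_restrict_word x y in auto)
      show ?thesis
        using j fun_cong[OF e, of j] by simp
    qed (use agree that in auto)
    then have "x = y"
      using point_eqI[OF x y] by blast
    then show ?thesis
      using \<delta> by (simp add: shift_dist_def)
  qed
  moreover have "real (num_words l L k m) \<le> lmax * (1 + 1 / \<delta>)"
  proof -
    have "1 * (1 / \<delta>) \<le> real lmax * (1 + 1 / \<delta>)"
      using lmax_pos \<delta> by (intro mult_mono) auto
    then show ?thesis
      using le[OF m(1)] by simp
  qed
  ultimately show ?thesis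
    using that m(1) by blast
qed

section \<open>Least resolving windows\<close>

definition resolves :: "real \<Rightarrow> nat \<Rightarrow> nat \<Rightarrow> bool" where
  "resolves \<delta> k m \<longleftrightarrow> k \<le> m \<and> (\<forall>x\<in>shift_space l L k. \<forall>y\<in>shift_space l L k.
     (\<forall>i. k \<le> i \<and> i \<le> m \<longrightarrow> x i = y i) \<longrightarrow> shift_dist l L k x y < \<delta>)"

text \<open>Taking the least window is what makes it monotone in \<open>k\<close>: any other window
  that resolves \<open>k\<close> bounds it from above.\<close>

definition resolution :: "real \<Rightarrow> nat \<Rightarrow> nat" where
  "resolution \<delta> k = (LEAST m. resolves \<delta> k m)"

lemma
  assumes "\<delta> > 0"
  shows resolution_ge: "k \<le> resolution \<delta> k"
    and resolution_dist: "\<And>x y. x \<in> shift_space l L k \<Longrightarrow> y \<in> shift_space l L k \<Longrightarrow>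
      (\<And>i. k \<le> i \<Longrightarrow> i \<le> resolution \<delta> k \<Longrightarrow> x i = y i) \<Longrightarrow> shift_dist l L k x y < \<delta>"
    and num_words_resolution: "real (num_words l L k (resolution \<delta> k)) \<le> lmax * (1 + 1 / \<delta>)"
proof -
  obtain m where m: "resolves \<delta> k m" "real (num_words l L k m) \<le> lmax * (1 + 1 / \<delta>)"
  proof (rule finite_resolution[OF assms, of k])
    fix m
    assume "k \<le> m" "real (num_words l L k m) \<le> lmax * (1 + 1 / \<delta>)"
      "\<And>x y. x \<in> shift_space l L k \<Longrightarrow> y \<in> shift_space l L k \<Longrightarrow>
        (\<And>i. k \<le> i \<Longrightarrow> i \<le> m \<Longrightarrow> x i = y i) \<Longrightarrow> shift_dist l L k x y < \<delta>"
    then show thesis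
      by (intro that[of m]) (simp_all add: resolves_def)
  qed
  have P: "resolves \<delta> k (resolution \<delta> k)"
    unfolding resolution_def using m(1) by (rule LeastI[of "resolves \<delta> k"])
  then show "k \<le> resolution \<delta> k"
    by (simp add: resolves_def)
  show "shift_dist l L k x y < \<delta>" if "x \<in> shift_space l L k" "y \<in> shift_space l L k"
    "\<And>i. k \<le> i \<Longrightarrow> i \<le> resolution \<delta> k \<Longrightarrow> x i = y i" for x y
    using P that by (simp add: resolves_def)
  have "resolution \<delta> k \<le> m"
    unfolding resolution_def using m(1) by (rule Least_le[of "resolves \<delta> k"])
  then have "num_words l L k (resolution \<delta> k) \<le> num_words l L k m"
    using P by (intro num_words_mono) (auto simp: resolves_def)
  then show "real (num_words l L k (resolution \<delta> k)) \<le> lmax * (1 + 1 / \<delta>)"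
    using m(2) by simp
qed

text \<open>A window that resolves \<open>Suc k\<close> also resolves \<open>k\<close>: it reaches
  at least to \<open>Suc k\<close>, so agreement on it covers the two letters required by
  \<open>shift_dist_le_tail\<close>.\<close>

lemma resolution_mono:
  assumes \<delta>: "\<delta> > 0" and "i \<le> j"
  shows "resolution \<delta> i \<le> resolution \<delta> j"
proof -
  have "resolution \<delta> k \<le> resolution \<delta> (Suc k)" for k
  proof -
    have ge: "Suc k \<le> resolution \<delta> (Suc k)"
      using resolution_ge \<delta> by blast
    have "shift_dist l L k x y < \<delta>" if x: "x \<in> shift_space l L k" and y: "y \<in> shift_space l L k"
      and agree: "\<forall>i. k \<le> i \<and> i \<le> resolution \<delta> (Suc k) \<longrightarrow> x i = y i" for x y
    proof -
      have "shift_dist l L k x y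
          \<le> shift_dist l L (Suc k) (restrict x {Suc k..}) (restrict y {Suc k..})"
        using agree ge by (intro shift_dist_le_tail x y) auto
      also have "\<dots> < \<delta>"
        using agree x y point_restrict[of _ k "Suc k"] by (intro resolution_dist \<delta>) auto
      finally show ?thesis .
    qed
    then have "resolves \<delta> k (resolution \<delta> (Suc k))"
      using ge by (auto simp: resolves_def)
    then show ?thesis
      unfolding resolution_def[of \<delta> k] by (rule Least_le[of "resolves \<delta> k"])
  qed
  then show ?thesis
    using assms(2) by (rule lift_Suc_mono_le)
qed

section \<open>Matrix products as counts of words\<close>

lemma word_letter: "x \<in> words l L k m \<Longrightarrow> k \<le> i \<Longrightarrow> i \<le> m \<Longrightarrow> x i \<in> alphabet l i"
  by (auto simp: words_def PiE_iff)

text \<open>Column sums are the form in which counts are needed: they give both the norm of the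
  product and the quantity maximized in the row hypothesis.\<close>

lemma sum_mat_prod:
  assumes "b \<in> alphabet l (k + m)"
  shows "(\<Sum>a\<in>alphabet l k. mat_prod l L k m a b) = real (card {x \<in> words l L k (k + m). x (k + m) = b})"
  using assms
proof (induction m arbitrary: b)
  case 0
  have "{x \<in> words l L k k. x k = b} = {\<lambda>i\<in>{k}. b}"
    using 0 by (auto simp: words_def PiE_iff extensional_def fun_eq_iff)
  then show ?case
    using 0 by simp
next
  case (Suc m)
  define E where "E = (\<lambda>c. {x \<in> words l L k (k + m). x (k + m) = c})"
  define C where "C = {c \<in> alphabet l (k + m). L (k + m) c b = 1}"
  \<comment> \<open>Deleting the last letter \<open>b\<close> leaves a word that ends in a letter
    allowed before \<open>b\<close>, and appending \<open>b\<close> is the inverse.\<close>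
  have bij: "bij_betw (\<lambda>x. x(Suc (k + m) := b)) (\<Union>c\<in>C. E c)
      {x \<in> words l L k (Suc (k + m)). x (Suc (k + m)) = b}"
  proof (rule bij_betw_byWitness[where f' = "\<lambda>x. restrict x {k..k + m}"])
    show "\<forall>x\<in>\<Union>c\<in>C. E c. restrict (x(Suc (k + m) := b)) {k..k + m} = x"
      by (auto simp: E_def words_def PiE_iff extensional_def fun_eq_iff)
    show "\<forall>x\<in>{x \<in> words l L k (Suc (k + m)). x (Suc (k + m)) = b}.
        (restrict x {k..k + m})(Suc (k + m) := b) = x"
      by (auto simp: words_def PiE_iff extensional_def fun_eq_iff)
    show "(\<lambda>x. x(Suc (k + m) := b)) ` (\<Union>c\<in>C. E c)
        \<subseteq> {x \<in> words l L k (Suc (k + m)). x (Suc (k + m)) = b}"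
      using Suc.prems
      by (auto simp: E_def C_def words_def PiE_iff extensional_def le_Suc_eq less_Suc_eq)
    show "(\<lambda>x. restrict x {k..k + m}) ` {x \<in> words l L k (Suc (k + m)). x (Suc (k + m)) = b}
        \<subseteq> (\<Union>c\<in>C. E c)"
      by (auto simp: E_def C_def words_def PiE_iff)
  qed
  have "(\<Sum>a\<in>alphabet l k. mat_prod l L k (Suc m) a b)
      = (\<Sum>c\<in>alphabet l (k + m). (\<Sum>a\<in>alphabet l k. mat_prod l L k m a c) * L (k + m) c b)"
    by (simp add: sum_distrib_right) (rule sum.swap)
  also have "\<dots> = (\<Sum>c\<in>alphabet l (k + m). real (card (E c)) * L (k + m) c b)"
    using Suc.IH by (simp add: E_def)
  also have "\<dots> = (\<Sum>c\<in>C. real (card (E c)))"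
  proof (intro sum.mono_neutral_cong_right ballI)
    fix c assume "c \<in> alphabet l (k + m) - C"
    then have "L (k + m) c b = 0"
      using zero_one[of c "k + m" b] Suc.prems by (auto simp: C_def)
    then show "real (card (E c)) * L (k + m) c b = 0"
      by simp
  qed (auto simp: C_def)
  also have "\<dots> = real (card (\<Union>c\<in>C. E c))"
    by (subst card_UN_disjoint) (auto simp: C_def E_def finite_words)
  also have "\<dots> = real (card {x \<in> words l L k (Suc (k + m)). x (Suc (k + m)) = b})"
    using bij_betw_same_card[OF bij] by simp
  finally show ?case
    by simp
qed

lemma sum_Lprod:
  assumes "k \<le> n"
  shows "(\<Sum>b\<in>alphabet l n. \<Sum>a\<in>alphabet l k. Lprod l L k n a b) = real (num_words l L k n)"
proof -
  obtain m where n: "n = k + m"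
    using assms le_Suc_ex by blast
  have "words l L k n = (\<Union>b\<in>alphabet l n. {x \<in> words l L k n. x n = b})"
    using assms by (auto intro: word_letter)
  then have "real (num_words l L k n) = real (card (\<Union>b\<in>alphabet l n. {x \<in> words l L k n. x n = b}))"
    by (simp add: num_words_def)
  also have "\<dots> = (\<Sum>b\<in>alphabet l n. real (card {x \<in> words l L k n. x n = b}))"
    by (subst card_UN_disjoint) (auto simp: finite_words)
  finally show ?thesis
    by (simp add: n Lprod_def sum_mat_prod)
qed

text \<open>Integrality turns the strict positivity in the primitivity condition into entries of at
  least 1, the form in which rows are used later.\<close>

lemma mat_prod_in_Nats: "b \<in> alphabet l (k + m) \<Longrightarrow> mat_prod l L k m a b \<in> \<nat>"
proof (induction m arbitrary: b)
  case (Suc m)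
  have "L (k + m) c b \<in> \<nat>" if "c \<in> alphabet l (k + m)" for c
    using zero_one[OF that, of b] Suc.prems by auto
  then have "mat_prod l L k m a c * L (k + m) c b \<in> \<nat>" if "c \<in> alphabet l (k + m)" for c
    using Suc.IH that by (intro Nats_mult) auto
  moreover have "(\<Sum>c\<in>A. g c) \<in> \<nat>" if "\<And>c. c \<in> A \<Longrightarrow> g c \<in> \<nat>" for A :: "nat set" and g :: "nat \<Rightarrow> real"
    using that by (induction A rule: infinite_finite_induct) auto
  ultimately show ?case
    by simp
qed simp

lemma Lprod_nonneg: "k \<le> n \<Longrightarrow> b \<in> alphabet l n \<Longrightarrow> 0 \<le> Lprod l L k n a b"
  using mat_prod_in_Nats[of b k "n - k" a] by (auto simp: Lprod_def elim: Nats_cases)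

lemma Lprod_ge_1: "k \<le> n \<Longrightarrow> b \<in> alphabet l n \<Longrightarrow> Lprod l L k n a b > 0 \<Longrightarrow> Lprod l L k n a b \<ge> 1"
  using mat_prod_in_Nats[of b k "n - k" a] by (auto simp: Lprod_def elim!: Nats_cases)

lemma norm0_Lprod: "norm0 l n (Lprod l L 0 n) = real (num_words l L 0 n)"
  unfolding sum_Lprod[of 0 n, simplified, symmetric] norm0_def
  by (subst sum.swap) (simp add: Lprod_nonneg)

lemma norm_growth_eq:
  "norm_growth l L = limsup (\<lambda>n. ereal (1 / real n * ln (real (num_words l L 0 n))))"
  by (simp add: norm_growth_def norm0_Lprod)

end


section \<open>Topology and topological entropy\<close>

context nsft
begin

lemma cylinder_self: "x \<in> shift_space l L k \<Longrightarrow> x \<in> cylinder l L k m x"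
  by (simp add: cylinder_def)

lemma cylinder_subset: "cylinder l L k m x \<subseteq> shift_space l L k"
  by (auto simp: cylinder_def)

lemma cylinder_nonempty_word: "y \<in> cylinder l L k m x \<Longrightarrow> restrict x {k..m} \<in> words l L k m"
  using point_restrict_word[of y k k m] by (auto simp: cylinder_def cong: restrict_cong)

lemma openin_cylinder:
  assumes "k \<le> m"
  shows "openin (Metric_space.mtopology (shift_space l L k) (shift_dist l L k)) (cylinder l L k m x)"
proof -
  interpret Metric_space "shift_space l L k" "shift_dist l L k"
    by (rule Metric_space_shift)
  have "mball y (1 / real (num_words l L k m)) \<subseteq> cylinder l L k m x" if "y \<in> cylinder l L k m x" for y
  proof
    fix z assume "z \<in> mball y (1 / real (num_words l L k m))"
    then have "z \<in> shift_space l L k" "y i = z i" if "k \<le> i" "i \<le> m" for i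
      using shift_dist_lt_imp_agree[of y k z m i] assms that by auto
    then show "z \<in> cylinder l L k m x"
      using \<open>y \<in> cylinder l L k m x\<close> assms unfolding cylinder_def by simp
  qed
  moreover have "1 / real (num_words l L k m) > 0"
    using num_words_pos[OF assms] by simp
  ultimately show ?thesis
    unfolding openin_mtopology by (meson cylinder_subset)
qed

lemma closedin_cylinder:
  assumes "k \<le> m"
  shows "closedin (Metric_space.mtopology (shift_space l L k) (shift_dist l L k)) (cylinder l L k m x)"
proof -
  interpret Metric_space "shift_space l L k" "shift_dist l L k"
    by (rule Metric_space_shift)
  have "shift_space l L k - cylinder l L k m x
      = (\<Union>y\<in>shift_space l L k - cylinder l L k m x. cylinder l L k m y)"
    by (fastforce simp: cylinder_def)
  also have "openin mtopology \<dots>"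
    using openin_cylinder[OF assms] by (intro openin_Union) auto
  finally show ?thesis
    unfolding closedin_def by (auto simp: cylinder_def)
qed

lemma cylinder_in_openin:
  assumes "openin (Metric_space.mtopology (shift_space l L k) (shift_dist l L k)) U" "x \<in> U"
  obtains m where "k \<le> m" "cylinder l L k m x \<subseteq> U"
proof -
  interpret Metric_space "shift_space l L k" "shift_dist l L k"
    by (rule Metric_space_shift)
  obtain r where r: "r > 0" "mball x r \<subseteq> U" and "U \<subseteq> shift_space l L k"
    using assms unfolding openin_mtopology by blast
  then have x: "x \<in> shift_space l L k"
    using assms by blast
  obtain m where m: "k \<le> m" "\<And>x y. x \<in> shift_space l L k \<Longrightarrow> y \<in> shift_space l L k \<Longrightarrow>
      (\<And>i. k \<le> i \<Longrightarrow> i \<le> m \<Longrightarrow> x i = y i) \<Longrightarrow> shift_dist l L k x y < r"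
    using finite_resolution[OF r(1), of k] by metis
  have "cylinder l L k m x \<subseteq> mball x r"
  proof
    fix y assume "y \<in> cylinder l L k m x"
    then have "y \<in> shift_space l L k" "shift_dist l L k x y < r"
      by (auto simp: cylinder_def intro!: m(2) x)
    then show "y \<in> mball x r"
      using x by simp
  qed
  then show ?thesis
    using that m(1) r(2) by blast
qed

text \<open>Total boundedness comes from the finitely many words over a resolving window,
  completeness from the fact that the coordinates of a Cauchy sequence are eventually
  constant.\<close>

lemma compact_shift_space:
  "compact_space (Metric_space.mtopology (shift_space l L k) (shift_dist l L k))"
proof -
  interpret Metric_space "shift_space l L k" "shift_dist l L k"
    by (rule Metric_space_shift)
  have "mtotally_bounded (shift_space l L k)"
    unfolding mtotally_bounded_def
  proof (intro allI impI)
    fix e :: real assume e: "e > 0"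
    obtain m where m: "k \<le> m" "\<And>x y. x \<in> shift_space l L k \<Longrightarrow> y \<in> shift_space l L k \<Longrightarrow>
        (\<And>i. k \<le> i \<Longrightarrow> i \<le> m \<Longrightarrow> x i = y i) \<Longrightarrow> shift_dist l L k x y < e"
      using finite_resolution[OF e, of k] by metis
    define r where "r = (\<lambda>x. restrict x {k..m} :: nat \<Rightarrow> nat)"
    have "r ` shift_space l L k \<subseteq> words l L k m"
      using point_restrict_word by (auto simp: r_def)
    then have "finite (r ` shift_space l L k)"
      using finite_words finite_subset by blast
    then obtain K where K: "K \<subseteq> shift_space l L k" "finite K" "r ` shift_space l L k = r ` K"
      using finite_subset_image[of "r ` shift_space l L k" r "shift_space l L k"] by blast
    have "shift_space l L k \<subseteq> (\<Union>x\<in>K. mball x e)"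
    proof
      fix y assume y: "y \<in> shift_space l L k"
      then obtain x where x: "x \<in> K" "r x = r y"
        using K(3) by (metis imageE imageI)
      have "shift_dist l L k x y < e"
      proof (rule m(2))
        fix i assume "k \<le> i" "i \<le> m"
        then show "x i = y i"
          using fun_cong[OF x(2), of i] by (simp add: r_def)
      qed (use x K y in auto)
      then show "y \<in> (\<Union>x\<in>K. mball x e)"
        using x K y by auto
    qed
    then show "\<exists>K. finite K \<and> K \<subseteq> shift_space l L k \<and> shift_space l L k \<subseteq> (\<Union>x\<in>K. mball x e)"
      using K by blast
  qed
  moreover have "mcomplete"
    unfolding mcomplete_def
  proof (intro allI impI)
    fix s assume s: "MCauchy s"
    then have sX: "s n \<in> shift_space l L k" for n
      unfolding MCauchy_def by blast
    have "\<exists>N. \<forall>n\<ge>N. \<forall>i. k \<le> i \<and> i \<le> m \<longrightarrow> s n i = s N i" if "k \<le> m" for m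
    proof -
      have "1 / real (num_words l L k m) > 0"
        using num_words_pos[OF that] by simp
      then obtain N where "\<forall>n n'. N \<le> n \<longrightarrow> N \<le> n' \<longrightarrow>
          shift_dist l L k (s n) (s n') < 1 / real (num_words l L k m)"
        using s unfolding MCauchy_def by blast
      then show ?thesis
        using shift_dist_lt_imp_agree[OF sX sX that] by (meson order_refl)
    qed
    then obtain N where N: "\<And>m n i. k \<le> m \<Longrightarrow> N m \<le> n \<Longrightarrow> k \<le> i \<Longrightarrow> i \<le> m \<Longrightarrow> s n i = s (N m) i"
      by metis
    \<comment> \<open>Coordinate \<open>i\<close> is read off at stage \<open>N i\<close>, from
      which on it is frozen.\<close>
    define x where "x = (\<lambda>i\<in>{k..}. s (N i) i)"
    have eq: "s n i = x i" if "k \<le> i" "i \<le> m" "N m \<le> n" for n m i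
    proof -
      have "s n i = s (max (N m) (N i)) i"
        using N[of m n i] N[of m "max (N m) (N i)" i] that by simp
      also have "\<dots> = s (N i) i"
        using N[of i "max (N m) (N i)" i] that by simp
      finally show ?thesis
        using that by (simp add: x_def)
    qed
    have "x \<in> shift_space l L k"
    proof -
      have "x i \<in> alphabet l i" if "k \<le> i" for i
        using eq[of i i "N i"] point_letter[OF sX that, of "N i"] that by simp
      moreover have "L i (x i) (x (Suc i)) = 1" if "k \<le> i" for i
      proof -
        have "s (N (Suc i)) i = x i" "s (N (Suc i)) (Suc i) = x (Suc i)"
          using eq[of _ "Suc i"] that by auto
        then show ?thesis
          using sX[of "N (Suc i)"] that by (auto simp: shift_space_def)
      qed
      ultimately show ?thesis
        by (auto simp: shift_space_def x_def)
    qed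
    moreover have "\<exists>N. \<forall>n\<ge>N. shift_dist l L k (s n) x < e" if "e > 0" for e
    proof -
      obtain m where m: "k \<le> m" "\<And>x y. x \<in> shift_space l L k \<Longrightarrow> y \<in> shift_space l L k \<Longrightarrow>
          (\<And>i. k \<le> i \<Longrightarrow> i \<le> m \<Longrightarrow> x i = y i) \<Longrightarrow> shift_dist l L k x y < e"
        using finite_resolution[OF \<open>e > 0\<close>, of k] by metis
      then have "shift_dist l L k (s n) x < e" if "N m \<le> n" for n
        using eq that by (intro m(2) sX \<open>x \<in> shift_space l L k\<close>) auto
      then show ?thesis
        by blast
    qed
    ultimately show "\<exists>x. limitin mtopology s x sequentially"
      using sX by (auto simp: limitin_metric eventually_sequentially)
  qed
  ultimately show ?thesis
    by (simp add: compact_space_eq_mcomplete_mtotally_bounded)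
qed

section \<open>Cylinders as a generator of the Borel sets\<close>

definition cylinders :: "nat \<Rightarrow> (nat \<Rightarrow> nat) set set" where
  "cylinders k = {cylinder l L k m x | m x. k \<le> m}"

lemma cylinders_subset: "cylinders k \<subseteq> Pow (shift_space l L k)"
  by (auto simp: cylinders_def cylinder_def)

text \<open>An open set is a countable union of cylinders. The Parry measures are prescribed on
  cylinders only, so measurability and uniqueness arguments have to start from this
  generator.\<close>

lemma borel_sets_eq_cylinders:
  "metric_borel_sets (shift_space l L k) (shift_dist l L k) = sigma_sets (shift_space l L k) (cylinders k)"
proof (rule antisym)
  interpret Metric_space "shift_space l L k" "shift_dist l L k"
    by (rule Metric_space_shift)
  show "sigma_sets (shift_space l L k) (cylinders k) \<subseteq> metric_borel_sets (shift_space l L k) (shift_dist l L k)"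
    unfolding metric_borel_sets_def using openin_cylinder
    by (intro sigma_sets_mono') (auto simp: cylinders_def)
  show "metric_borel_sets (shift_space l L k) (shift_dist l L k) \<subseteq> sigma_sets (shift_space l L k) (cylinders k)"
    unfolding metric_borel_sets_def
  proof (intro sigma_sets_mono subsetI)
    fix U assume "U \<in> {U. openin mtopology U}"
    then have U: "openin mtopology U"
      by simp
    \<comment> \<open>Cylinders are indexed by words instead of points: there are finitely many
      words for each \<open>m\<close>, which makes the union countable.\<close>
    define I where "I = {p \<in> Sigma {k..} (words l L k). cylinder l L k (fst p) (snd p) \<subseteq> U}"
    have "countable (Sigma {k..} (words l L k))"
      by (intro countable_SIGMA) (auto intro: countable_finite finite_words)
    then have "countable I"
      unfolding I_def by (rule countable_subset[rotated]) auto
    moreover have "U = \<Union> ((\<lambda>p. cylinder l L k (fst p) (snd p)) ` I)"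
    proof
      show "U \<subseteq> \<Union> ((\<lambda>p. cylinder l L k (fst p) (snd p)) ` I)"
      proof
        fix x assume x: "x \<in> U"
        then obtain m where m: "k \<le> m" "cylinder l L k m x \<subseteq> U"
          using cylinder_in_openin U by blast
        have xX: "x \<in> shift_space l L k"
          using x openin_subset[OF U] by auto
        have eq: "cylinder l L k m (restrict x {k..m}) = cylinder l L k m x"
          by (auto simp: cylinder_def)
        have "(m, restrict x {k..m}) \<in> I"
          using m eq point_restrict_word[OF xX] by (auto simp: I_def)
        moreover have "x \<in> cylinder l L k m (restrict x {k..m})"
          unfolding eq by (rule cylinder_self) fact
        ultimately show "x \<in> \<Union> ((\<lambda>p. cylinder l L k (fst p) (snd p)) ` I)"
          by force
      qed
    qed (auto simp: I_def)
    moreover have "cylinder l L k (fst p) (snd p) \<in> sigma_sets (shift_space l L k) (cylinders k)"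
      if "p \<in> I" for p
      using that by (intro sigma_sets.Basic) (auto simp: I_def cylinders_def)
    ultimately show "U \<in> sigma_sets (shift_space l L k) (cylinders k)"
      by (auto intro!: sigma_sets_UNION[of "(\<lambda>p. cylinder l L k (fst p) (snd p)) ` I"])
  qed
qed

lemma Int_stable_cylinders: "Int_stable (cylinders k)"
proof -
  have "cylinder l L k m x \<inter> cylinder l L k m' y \<in> cylinders k"
    if "k \<le> m" "m \<le> m'" for m m' x y
  proof (cases "\<forall>i. k \<le> i \<and> i \<le> m \<longrightarrow> x i = y i")
    case True
    then have "cylinder l L k m x \<inter> cylinder l L k m' y = cylinder l L k m' y"
      using that by (auto simp: cylinder_def)
    then show ?thesis
      using that by (auto simp: cylinders_def)
  next
    case False
    then have "cylinder l L k m x \<inter> cylinder l L k m' y = {}"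
      using that by (auto simp: cylinder_def)
    \<comment> \<open>Alphabets start at 1, so the letter 0 yields an empty cylinder. This keeps the
      generator closed under disjoint intersections.\<close>
    moreover have "{} = cylinder l L k k (\<lambda>_. 0)"
      using point_letter[of _ k k] by (fastforce simp: cylinder_def alphabet_def)
    ultimately show ?thesis
      unfolding cylinders_def by blast
  qed
  then have "cylinder l L k m x \<inter> cylinder l L k m' y \<in> cylinders k"
    if "k \<le> m" "k \<le> m'" for m m' x y
    using that by (metis Int_commute nat_le_linear)
  then show ?thesis
    unfolding Int_stable_def cylinders_def by blast
qed

section \<open>Names of orbits\<close>

lemma iter_left_shift: "iter left_shift n x = restrict x {n..}"
proof (induction n)
  case (Suc n)
  then show ?case
    by (auto simp: left_shift_def fun_eq_iff)
qed (auto simp: fun_eq_iff)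

text \<open>By \<open>resolution_mono\<close> the windows of all times below \<open>n\<close> lie in
  \<open>{0..resolution \<delta> (n - 1)}\<close>, so the whole name is a function of one word. The
  nature of its entries is left open: they are cover elements for the topological and predicted
  parts for the metric upper bound.\<close>

lemma card_names_le:
  assumes \<delta>: "\<delta> > 0" and "n \<ge> 1"
    and G: "\<And>i y z. y \<in> shift_space l L i \<Longrightarrow> z \<in> shift_space l L i \<Longrightarrow>
      (\<And>j. i \<le> j \<Longrightarrow> j \<le> resolution \<delta> i \<Longrightarrow> y j = z j) \<Longrightarrow> G i y = G i z"
  defines "C \<equiv> (\<lambda>x. \<lambda>i\<in>{..<n}. G i (iter left_shift i x)) ` shift_space l L 0"
  shows "finite C" "card C \<le> num_words l L 0 (resolution \<delta> (n - 1))"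
proof -
  define M where "M = resolution \<delta> (n - 1)"
  define f where "f = (\<lambda>x. \<lambda>i\<in>{..<n}. G i (iter left_shift i x))"
  define r where "r = (\<lambda>x. restrict x {0..M} :: nat \<Rightarrow> nat)"
  have fr: "f x = f y" if x: "x \<in> shift_space l L 0" and y: "y \<in> shift_space l L 0" and e: "r x = r y" for x y
  proof -
    have "G i (iter left_shift i x) = G i (iter left_shift i y)" if "i < n" for i
      unfolding iter_left_shift
    proof (rule G)
      fix j assume j: "i \<le> j" "j \<le> resolution \<delta> i"
      have "resolution \<delta> i \<le> M"
        unfolding M_def using that by (intro resolution_mono \<delta>) auto
      then show "restrict x {i..} j = restrict y {i..} j"
        using j fun_cong[OF e, of j] by (simp add: r_def)
    qed (use point_restrict[of _ 0 i] x y in auto)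
    then show ?thesis
      by (auto simp: f_def fun_eq_iff)
  qed
  have rW: "r ` shift_space l L 0 \<subseteq> words l L 0 M"
    using point_restrict_word by (auto simp: r_def)
  \<comment> \<open>A name is recovered from the word by evaluating it at any point that has this
    word.\<close>
  have sub: "f ` shift_space l L 0 \<subseteq> (\<lambda>w. f (inv_into (shift_space l L 0) r w)) ` (r ` shift_space l L 0)"
  proof
    fix c assume "c \<in> f ` shift_space l L 0"
    then obtain x where x: "x \<in> shift_space l L 0" "c = f x"
      by blast
    have "f (inv_into (shift_space l L 0) r (r x)) = f x"
    proof (rule fr)
      show "inv_into (shift_space l L 0) r (r x) \<in> shift_space l L 0"
        using x by (intro inv_into_into) simp
      show "r (inv_into (shift_space l L 0) r (r x)) = r x"
        using x by (intro f_inv_into_f[of "r x" r]) simp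
    qed (use x in simp)
    then show "c \<in> (\<lambda>w. f (inv_into (shift_space l L 0) r w)) ` (r ` shift_space l L 0)"
      using x by (metis imageI)
  qed
  then have "finite (f ` shift_space l L 0)"
    using finite_subset[OF rW finite_words] finite_subset by blast
  then show "finite C"
    by (simp add: C_def f_def)
  have "card (f ` shift_space l L 0) \<le> card (r ` shift_space l L 0)"
    using finite_subset[OF rW finite_words] sub by (rule surj_card_le)
  also have "\<dots> \<le> num_words l L 0 M"
    unfolding num_words_def using rW finite_words by (rule card_mono[rotated])
  finally show "card C \<le> num_words l L 0 (resolution \<delta> (n - 1))"
    by (simp add: C_def f_def M_def)
qed

lemma ln_num_words_resolution:
  assumes \<delta>: "\<delta> > 0"
  shows "ln (real (num_words l L 0 (resolution \<delta> (n - 1))))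
    \<le> ln (real (num_words l L 0 n)) + ln (lmax * (1 + 1 / \<delta>))"
proof -
  define M where "M = resolution \<delta> (n - 1)"
  have M: "n - 1 \<le> M"
    unfolding M_def using \<delta> by (rule resolution_ge)
  \<comment> \<open>An orbit of length \<open>n\<close> visits the times 0 to \<open>n - 1\<close>,
    so the last window starts at \<open>n - 1\<close> and the word is cut there.\<close>
  have "real (num_words l L 0 M) \<le> real (num_words l L 0 (n - 1) * num_words l L (n - 1) M)"
    unfolding of_nat_le_iff using M by (intro num_words_split) auto
  also have "\<dots> \<le> real (num_words l L 0 n) * (lmax * (1 + 1 / \<delta>))"
    unfolding of_nat_mult M_def using num_words_mono[of 0 "n - 1" n] num_words_resolution[OF \<delta>]
    by (intro mult_mono) auto
  finally have "ln (real (num_words l L 0 M)) \<le> ln (real (num_words l L 0 n) * (lmax * (1 + 1 / \<delta>)))"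
    using num_words_pos[of 0 M] by (intro ln_mono) auto
  also have "\<dots> = ln (real (num_words l L 0 n)) + ln (lmax * (1 + 1 / \<delta>))"
    using num_words_pos[of 0 n] lmax_pos \<delta> by (intro ln_mult_pos) (auto simp: add_pos_pos)
  finally show ?thesis
    by (simp add: M_def)
qed

text \<open>Repairs the index in lower bounds: a join of \<open>n\<close> letter partitions sees the
  coordinates 0 to \<open>n - 1\<close> and therefore yields w(0,n-1).\<close>

lemma ln_num_words_pred:
  assumes "n \<ge> 1"
  shows "ln (real (num_words l L 0 n)) \<le> ln (real (num_words l L 0 (n - 1))) + ln lmax"
proof -
  have "real (num_words l L 0 n) \<le> real (num_words l L 0 (n - 1) * lmax)"
    unfolding of_nat_le_iff using num_words_Suc_le[of 0 "n - 1"] assms by simp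
  then have "ln (real (num_words l L 0 n)) \<le> ln (real (num_words l L 0 (n - 1)) * real lmax)"
    using num_words_pos[of 0 n] by (intro ln_mono) auto
  then show ?thesis
    using num_words_pos[of 0 "n - 1"] lmax_pos by (simp add: ln_mult_pos)
qed

section \<open>The partition into one-letter cylinders\<close>

definition letter_partition :: "nat \<Rightarrow> (nat \<Rightarrow> nat) set set" where
  "letter_partition n = (\<lambda>a. cylinder l L n n (\<lambda>_. a)) ` alphabet l n"

lemma letter_cylinder: "cylinder l L n n (\<lambda>_. a) = {x \<in> shift_space l L n. x n = a}"
  by (auto simp: cylinder_def)

lemma letter_cylinder_nonempty:
  assumes "a \<in> alphabet l n"
  shows "cylinder l L n n (\<lambda>_. a) \<noteq> {}"
proof -
  have "(\<lambda>i\<in>{n..n}. a) \<in> words l L n n"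
    using assms by (auto simp: words_def)
  then obtain y where "y \<in> shift_space l L n" "\<And>i. n \<le> i \<Longrightarrow> i \<le> n \<Longrightarrow> y i = (\<lambda>i\<in>{n..n}. a) i"
    using word_extends_to_point by blast
  then show ?thesis
    by (auto simp: letter_cylinder)
qed

lemma letter_partition_on: "partition_on (shift_space l L n) (letter_partition n)"
proof (rule partition_onI)
  show "\<Union> (letter_partition n) = shift_space l L n"
    using point_letter[of _ n n] by (auto simp: letter_partition_def letter_cylinder)
  show "{} \<notin> letter_partition n"
    using letter_cylinder_nonempty by (auto simp: letter_partition_def)
  show "disjnt p q" if "p \<in> letter_partition n" "q \<in> letter_partition n" "p \<noteq> q" for p q
    using that by (auto simp: letter_partition_def letter_cylinder disjnt_def)
qed

lemma finite_letter_partition: "finite (letter_partition n)"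
  by (simp add: letter_partition_def)

lemma card_letter_partition: "card (letter_partition n) \<le> lmax"
  unfolding letter_partition_def
  using card_image_le[OF finite_alphabet, of _ n] l_le_lmax[of n] by (metis card_alphabet order_trans)

lemma letter_partition_dist:
  assumes "p \<in> letter_partition n" "q \<in> letter_partition n" "p \<noteq> q" "x \<in> p" "y \<in> q"
  shows "shift_dist l L n x y \<ge> 1"
proof -
  have "x n \<noteq> y n"
    using assms by (auto simp: letter_partition_def letter_cylinder)
  then show ?thesis
    using shift_dist_lt_1 not_less by blast
qed

text \<open>Points with different first letters are at distance 1, and letter cylinders are compact,
  being closed in a compact space. So each part is its own compact approximation, without loss of
  measure, for every \<open>\<epsilon>\<close>.\<close>

lemma letter_partition_admissible:
  assumes "\<And>n. finite_measure (\<mu> n)"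
  shows "letter_partition \<in> admissible_partitions (shift_space l L) (shift_dist l L) \<mu>"
  unfolding admissible_partitions_def
proof (intro CollectI conjI allI impI)
  fix n
  show "finite (letter_partition n)"
    by (rule finite_letter_partition)
  show "partition_on (shift_space l L n) (letter_partition n)"
    by (rule letter_partition_on)
  show "letter_partition n \<subseteq> metric_borel_sets (shift_space l L n) (shift_dist l L n)"
    unfolding borel_sets_eq_cylinders by (auto simp: letter_partition_def cylinders_def)
next
  show "bdd_above (range (\<lambda>n. card (letter_partition n)))"
    using card_letter_partition by (intro bdd_aboveI) auto
next
  fix \<epsilon> :: real assume "\<epsilon> > 0"
  then show "\<exists>\<delta>>0. \<exists>K. \<forall>n.
      (\<forall>p\<in>letter_partition n. compactin (Metric_space.mtopology (shift_space l L n) (shift_dist l L n)) (K n p) \<and>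
          K n p \<subseteq> p \<and> measure (\<mu> n) (p - K n p) \<le> \<epsilon>) \<and>
      (\<forall>p\<in>letter_partition n. \<forall>q\<in>letter_partition n. p \<noteq> q \<longrightarrow>
          (\<forall>x\<in>K n p. \<forall>y\<in>K n q. shift_dist l L n x y \<ge> \<delta>))"
    using letter_partition_dist closedin_compact_space[OF compact_shift_space closedin_cylinder]
    by (intro exI[of _ 1] conjI exI[of _ "\<lambda>n p. p"]) (auto simp: letter_partition_def)
qed

lemma letter_join_agree:
  assumes s: "s \<in> PiE {..<n} letter_partition" and "j < n"
    and x: "\<forall>i<n. iter left_shift i x \<in> s i" and y: "\<forall>i<n. iter left_shift i y \<in> s i"
  shows "x j = y j"
proof -
  have "s j \<in> letter_partition j"
    using s \<open>j < n\<close> by auto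
  then obtain a where "s j = {z \<in> shift_space l L j. z j = a}"
    by (auto simp: letter_partition_def letter_cylinder)
  then have "restrict x {j..} j = a" "restrict y {j..} j = a"
    using x y \<open>j < n\<close> by (auto simp: iter_left_shift)
  then show ?thesis
    by simp
qed

lemma letter_join_cover:
  "\<Union> (join (shift_space l L) left_shift letter_partition n) = shift_space l L 0"
proof
  show "shift_space l L 0 \<subseteq> \<Union> (join (shift_space l L) left_shift letter_partition n)"
  proof
    fix x assume x: "x \<in> shift_space l L 0"
    define s where "s = (\<lambda>i\<in>{..<n}. cylinder l L i i (\<lambda>_. x i))"
    have "s \<in> PiE {..<n} letter_partition"
      using point_letter[OF x] by (auto simp: s_def letter_partition_def)
    moreover have "\<forall>i<n. iter left_shift i x \<in> s i"
      using point_restrict[OF x] by (auto simp: s_def letter_cylinder iter_left_shift)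
    ultimately show "x \<in> \<Union> (join (shift_space l L) left_shift letter_partition n)"
      using x unfolding join_eq by blast
  qed
qed (auto simp: join_eq)

text \<open>A distance below 1 forces equal first letters, so 1 is a Lebesgue number at all times.
  The same sequence thus serves the topological and the metric lower bound.\<close>

lemma letter_partition_lebesgue_cover:
  "letter_partition \<in> lebesgue_cover_sequences (shift_space l L) (shift_dist l L)"
proof -
  have "is_open_cover (shift_space l L n) (shift_dist l L n) (letter_partition n)" for n
    unfolding is_open_cover_def using partition_onD1[OF letter_partition_on] openin_cylinder
    by (auto simp: letter_partition_def)
  moreover have "is_lebesgue_number (shift_space l L n) (shift_dist l L n) (letter_partition n) 1" for n
    unfolding is_lebesgue_number_def
  proof (intro conjI ballI)
    interpret Metric_space "shift_space l L n" "shift_dist l L n"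
      by (rule Metric_space_shift)
    fix x assume x: "x \<in> shift_space l L n"
    have "mball x 1 \<subseteq> cylinder l L n n (\<lambda>_. x n)"
    proof
      fix y assume "y \<in> mball x 1"
      then show "y \<in> cylinder l L n n (\<lambda>_. x n)"
        using shift_dist_lt_1[of n x y] by (simp add: letter_cylinder)
    qed
    then show "\<exists>u\<in>letter_partition n. mball x 1 \<subseteq> u"
      using point_letter[OF x] by (auto simp: letter_partition_def)
  qed simp
  ultimately show ?thesis
    unfolding lebesgue_cover_sequences_def using zero_less_one by blast
qed

text \<open>The members of the join separate the words on the coordinates 0 to \<open>n - 1\<close>,
  so a subcover needs at least one member per word.\<close>

lemma min_subcover_letter_join:
  assumes "n \<ge> 1"
  shows "num_words l L 0 (n - 1) \<le> min_subcover (shift_space l L 0)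
    (join (shift_space l L) left_shift letter_partition n)"
proof -
  define J where "J = join (shift_space l L) left_shift letter_partition n"
  have "finite J"
    unfolding J_def join_eq using finite_letter_partition by (intro finite_imageI finite_PiE) auto
  then have "\<exists>V\<subseteq>J. finite V \<and> \<Union>V = shift_space l L 0 \<and> card V = card J"
    using letter_join_cover by (auto simp: J_def)
  then have "\<exists>V\<subseteq>J. finite V \<and> \<Union>V = shift_space l L 0 \<and> card V = min_subcover (shift_space l L 0) J"
    unfolding min_subcover_def by (rule LeastI[where P = "\<lambda>n. \<exists>V\<subseteq>J. finite V \<and> \<Union>V = shift_space l L 0 \<and> card V = n"])
  then obtain V where V: "V \<subseteq> J" "finite V" "\<Union>V = shift_space l L 0"
    "card V = min_subcover (shift_space l L 0) J"
    by blast
  \<comment> \<open>All points of a member share their first \<open>n\<close> letters, so it does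
    not matter which one is picked. Every word is hit because it extends to a point, and
    \<open>V\<close> covers that point.\<close>
  have "words l L 0 (n - 1) \<subseteq> (\<lambda>v. restrict (SOME x. x \<in> v) {0..n - 1}) ` V"
  proof
    fix w assume w: "w \<in> words l L 0 (n - 1)"
    then obtain x where x: "x \<in> shift_space l L 0" "\<And>i. 0 \<le> i \<Longrightarrow> i \<le> n - 1 \<Longrightarrow> x i = w i"
      using word_extends_to_point by blast
    obtain v where v: "v \<in> V" "x \<in> v"
      using V(3) x(1) by blast
    then obtain s where s: "s \<in> PiE {..<n} letter_partition"
      "v = {x \<in> shift_space l L 0. \<forall>i<n. iter left_shift i x \<in> s i}"
      using V(1) unfolding J_def join_eq by blast
    have y: "(SOME x. x \<in> v) \<in> v"
      using v by (metis someI)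
    have "(SOME x. x \<in> v) i = w i" if "i \<le> n - 1" for i
    proof -
      have "(SOME x. x \<in> v) i = x i"
        using v y that assms unfolding s(2) by (intro letter_join_agree[OF s(1)]) auto
      then show ?thesis
        using x(2) that by simp
    qed
    then have "restrict (SOME x. x \<in> v) {0..n - 1} = w"
      using w by (intro word_eqI[of _ 0 "n - 1"] point_restrict_word) (use y s(2) in auto)
    then show "w \<in> (\<lambda>v. restrict (SOME x. x \<in> v) {0..n - 1}) ` V"
      using v by blast
  qed
  then have "card (words l L 0 (n - 1)) \<le> card V"
    using V(2) by (rule surj_card_le[rotated])
  then show ?thesis
    using V(4) by (simp add: num_words_def J_def)
qed

section \<open>Subcovers from names and the topological entropy\<close>

lemma cylinder_cong:
  "(\<And>j. k \<le> j \<Longrightarrow> j \<le> m \<Longrightarrow> y j = z j) \<Longrightarrow> cylinder l L k m y = cylinder l L k m z"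
  by (auto simp: cylinder_def)

lemma resolution_cylinder_dist:
  assumes "\<delta> > 0" "y \<in> cylinder l L k (resolution \<delta> k) x" "z \<in> cylinder l L k (resolution \<delta> k) x"
  shows "shift_dist l L k y z < \<delta>"
  using assms by (intro resolution_dist) (auto simp: cylinder_def)

text \<open>A cylinder over a resolving window fits into one cover element by the Lebesgue number.
  The elements chosen along an orbit form a member of the join, so the number of names bounds a
  subcover; the constant depends on \<open>\<delta>\<close> but not on \<open>n\<close>.\<close>

lemma min_subcover_le:
  assumes U: "U \<in> lebesgue_cover_sequences (shift_space l L) (shift_dist l L)"
  obtains c where "\<And>n. n \<ge> 1 \<Longrightarrow>
    ln (real (min_subcover (shift_space l L 0) (join (shift_space l L) left_shift U n)))
      \<le> ln (real (num_words l L 0 n)) + c"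
proof -
  obtain \<delta> where \<delta>: "\<delta> > 0"
    and leb: "\<And>n. is_lebesgue_number (shift_space l L n) (shift_dist l L n) (U n) \<delta>"
    using U by (auto simp: lebesgue_cover_sequences_def)
  \<comment> \<open>The choice is made for the cylinder and not for the point, so
    \<open>G i y\<close> depends only on the window of \<open>y\<close>, as
    \<open>card_names_le\<close> demands.\<close>
  define G where "G = (\<lambda>i y. SOME u. u \<in> U i \<and> cylinder l L i (resolution \<delta> i) y \<subseteq> u)"
  have G: "G i y \<in> U i" "y \<in> G i y" if y: "y \<in> shift_space l L i" for i y
  proof -
    interpret Metric_space "shift_space l L i" "shift_dist l L i"
      by (rule Metric_space_shift)
    obtain u where u: "u \<in> U i" "mball y \<delta> \<subseteq> u"
      using leb[of i] y by (auto simp: is_lebesgue_number_def)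
    have "cylinder l L i (resolution \<delta> i) y \<subseteq> mball y \<delta>"
      using resolution_cylinder_dist[OF \<delta>] cylinder_self[OF y] y cylinder_subset by fastforce
    then have "\<exists>u. u \<in> U i \<and> cylinder l L i (resolution \<delta> i) y \<subseteq> u"
      using u by blast
    then have "G i y \<in> U i \<and> cylinder l L i (resolution \<delta> i) y \<subseteq> G i y"
      unfolding G_def by (rule someI_ex)
    then show "G i y \<in> U i" "y \<in> G i y"
      using cylinder_self[OF y] by blast+
  qed
  have "ln (real (min_subcover (shift_space l L 0) (join (shift_space l L) left_shift U n)))
      \<le> ln (real (num_words l L 0 n)) + ln (lmax * (1 + 1 / \<delta>))" if n: "n \<ge> 1" for n
  proof -
    define C where "C = (\<lambda>x. \<lambda>i\<in>{..<n}. G i (iter left_shift i x)) ` shift_space l L 0"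
    define V where "V = (\<lambda>c. {x \<in> shift_space l L 0. \<forall>i<n. iter left_shift i x \<in> c i}) ` C"
    have G_cong: "G i y = G i z" if "y \<in> shift_space l L i" "z \<in> shift_space l L i"
      "\<And>j. i \<le> j \<Longrightarrow> j \<le> resolution \<delta> i \<Longrightarrow> y j = z j" for i y z
    proof -
      have "cylinder l L i (resolution \<delta> i) y = cylinder l L i (resolution \<delta> i) z"
        by (rule cylinder_cong) (rule that(3))
      then show ?thesis
        by (simp add: G_def)
    qed
    have finC: "finite C"
      unfolding C_def by (rule card_names_le(1)[OF \<delta> n]) (rule G_cong; simp)
    have cardC: "card C \<le> num_words l L 0 (resolution \<delta> (n - 1))"
      unfolding C_def by (rule card_names_le(2)[OF \<delta> n]) (rule G_cong; simp)
    have pt: "iter left_shift i x \<in> shift_space l L i" if "x \<in> shift_space l L 0" for i x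
      using point_restrict[OF that] by (simp add: iter_left_shift)
    have "V \<subseteq> join (shift_space l L) left_shift U n"
      unfolding V_def join_eq
    proof (rule image_mono)
      show "C \<subseteq> PiE {..<n} U"
        using G(1)[OF pt] by (auto simp: C_def)
    qed
    moreover have "\<Union>V = shift_space l L 0"
    proof
      show "shift_space l L 0 \<subseteq> \<Union>V"
      proof
        fix x assume x: "x \<in> shift_space l L 0"
        define c where "c = (\<lambda>i\<in>{..<n}. G i (iter left_shift i x))"
        have "c \<in> C"
          using x by (simp add: C_def c_def)
        moreover have "\<forall>i<n. iter left_shift i x \<in> c i"
          using G(2)[OF pt[OF x]] by (simp add: c_def)
        ultimately show "x \<in> \<Union>V"
          unfolding V_def using x by blast
      qed
    qed (auto simp: V_def)
    moreover have "finite V"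
      unfolding V_def using finC by (rule finite_imageI)
    ultimately have "min_subcover (shift_space l L 0) (join (shift_space l L) left_shift U n) \<le> card V"
      unfolding min_subcover_def
      by (intro Least_le[where P = "\<lambda>m. \<exists>W\<subseteq>join (shift_space l L) left_shift U n.
        finite W \<and> \<Union>W = shift_space l L 0 \<and> card W = m"] exI[of _ V]) simp
    also have "\<dots> \<le> card C"
      unfolding V_def using finC by (rule card_image_le)
    also note cardC
    \<comment> \<open>The case of zero is settled by \<open>ln 0 = 0\<close>, which is at most the
      logarithm of a positive count.\<close>
    finally have "ln (real (min_subcover (shift_space l L 0) (join (shift_space l L) left_shift U n)))
        \<le> ln (real (num_words l L 0 (resolution \<delta> (n - 1))))"
      using num_words_pos[of 0 "resolution \<delta> (n - 1)"]
      by (cases "min_subcover (shift_space l L 0) (join (shift_space l L) left_shift U n) = 0") auto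
    then show ?thesis
      using ln_num_words_resolution[OF \<delta>, of n] by simp
  qed
  then show ?thesis
    using that by blast
qed

lemma topological_entropy_eq:
  "topological_entropy (shift_space l L) (shift_dist l L) left_shift = norm_growth l L"
proof (rule antisym)
  show "topological_entropy (shift_space l L) (shift_dist l L) left_shift \<le> norm_growth l L"
    unfolding topological_entropy_def
  proof (rule SUP_least)
    fix U assume "U \<in> lebesgue_cover_sequences (shift_space l L) (shift_dist l L)"
    then obtain c where c: "\<And>n. n \<ge> 1 \<Longrightarrow>
        ln (real (min_subcover (shift_space l L 0) (join (shift_space l L) left_shift U n)))
          \<le> ln (real (num_words l L 0 n)) + c"
      using min_subcover_le by blast
    have "limsup (\<lambda>n. ereal (1 / real n * c)) \<le> 0"
      using limsup_bounded_over_n[of "\<lambda>_. c" "\<bar>c\<bar>"] by simp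
    from growth_le[OF c this]
    show "limsup (\<lambda>n. ereal (1 / real n *
        ln (real (min_subcover (shift_space l L 0) (join (shift_space l L) left_shift U n))))) \<le> norm_growth l L"
      by (simp add: norm_growth_eq)
  qed
next
  define m where "m = (\<lambda>n. ln (real (min_subcover (shift_space l L 0)
    (join (shift_space l L) left_shift letter_partition n))))"
  have "ln (real (num_words l L 0 n)) \<le> m n + ln lmax" if "n \<ge> 1" for n
  proof -
    have "ln (real (num_words l L 0 (n - 1))) \<le> m n"
      unfolding m_def using min_subcover_letter_join[OF that] num_words_pos[of 0 "n - 1"]
      by (intro ln_mono) auto
    then show ?thesis
      using ln_num_words_pred[OF that] by simp
  qed
  moreover have "limsup (\<lambda>n. ereal (1 / real n * ln lmax)) \<le> 0"
    using limsup_bounded_over_n[of "\<lambda>_. ln lmax" "\<bar>ln lmax\<bar>"] by simp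
  ultimately have "norm_growth l L \<le> limsup (\<lambda>n. ereal (1 / real n * m n)) + 0"
    unfolding norm_growth_eq by (rule growth_le)
  also have "\<dots> \<le> topological_entropy (shift_space l L) (shift_dist l L) left_shift"
    unfolding topological_entropy_def m_def
    using SUP_upper[OF letter_partition_lebesgue_cover] by simp
  finally show "norm_growth l L \<le> topological_entropy (shift_space l L) (shift_dist l L) left_shift" .
qed

end


section \<open>Growth of the Parry eigenvalues\<close>

context parry_vectors
begin

lemma vec_norm_wh: "vec_norm l i (wh i) = (\<Sum>a\<in>alphabet l i. wh i a)"
  unfolding vec_norm_def by (intro sum.cong) (auto simp: wh_pos less_imp_le)

lemma vec_norm_wh_pos: "vec_norm l i (wh i) > 0"
  unfolding vec_norm_wh using wh_pos alphabet_not_empty by (intro sum_pos) auto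

lemma wh_mat_prod:
  "a \<in> alphabet l k \<Longrightarrow> wh k a = (\<Sum>b\<in>alphabet l (k + m). mat_prod l L k m a b * wh (k + m) b)"
proof (induction m)
  case 0
  have "(\<Sum>b\<in>alphabet l k. (if a = b then 1 else 0) * wh k b) = (\<Sum>b\<in>alphabet l k. if a = b then wh k b else 0)"
    by (intro sum.cong) auto
  then show ?case
    using 0 by simp
next
  case (Suc m)
  have "wh k a = (\<Sum>c\<in>alphabet l (k + m). mat_prod l L k m a c *
      (\<Sum>b\<in>alphabet l (Suc (k + m)). L (k + m) c b * wh (Suc (k + m)) b))"
    unfolding Suc.IH[OF Suc.prems] by (intro sum.cong) (auto simp flip: wh_eq)
  also have "\<dots> = (\<Sum>b\<in>alphabet l (k + Suc m). mat_prod l L k (Suc m) a b * wh (k + Suc m) b)"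
    by (simp add: sum_distrib_left sum_distrib_right mult.assoc) (rule sum.swap)
  finally show ?case .
qed

lemma wh_Lprod:
  assumes "k \<le> n" "a \<in> alphabet l k"
  shows "wh k a = (\<Sum>b\<in>alphabet l n. Lprod l L k n a b * wh n b)"
  using wh_mat_prod[OF assms(2), of "n - k"] assms(1) by (simp add: Lprod_def)

text \<open>Divided by the norm at \<open>n\<close>, this exhibits
  \<open>lambda_prod l wh k n\<close> as the mean of the column sums of the matrix product with
  weights \<open>parry_w l wh n\<close>. Bounding the weights by 1 compares it with w(k,n); keeping
  a single column compares it with the largest column sum.\<close>

lemma vec_norm_Lprod:
  assumes "k \<le> n"
  shows "vec_norm l k (wh k) = (\<Sum>b\<in>alphabet l n. (\<Sum>a\<in>alphabet l k. Lprod l L k n a b) * wh n b)"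
proof -
  have "vec_norm l k (wh k) = (\<Sum>a\<in>alphabet l k. \<Sum>b\<in>alphabet l n. Lprod l L k n a b * wh n b)"
    unfolding vec_norm_wh using wh_Lprod[OF assms] by (intro sum.cong) auto
  also have "\<dots> = (\<Sum>b\<in>alphabet l n. \<Sum>a\<in>alphabet l k. Lprod l L k n a b * wh n b)"
    by (rule sum.swap)
  finally show ?thesis
    by (simp add: sum_distrib_right)
qed

lemma lambda_prod_Suc: "k \<le> m \<Longrightarrow> lambda_prod l wh k (Suc m) = lambda_prod l wh k m * parry_lambda l wh m"
  by (simp add: lambda_prod_def)

lemma lambda_prod_eq: "k \<le> m \<Longrightarrow> lambda_prod l wh k m = vec_norm l k (wh k) / vec_norm l m (wh m)"
proof (induction m rule: dec_induct)
  case base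
  then show ?case
    using vec_norm_wh_pos[of k] by (simp add: lambda_prod_def)
next
  case (step m)
  then show ?case
    using vec_norm_wh_pos[of m] by (simp add: lambda_prod_Suc parry_lambda_def)
qed

text \<open>\<open>parry_lambda l wh i\<close> is the mean of the column sums of \<open>L i\<close>
  with weights \<open>parry_w l wh (Suc i)\<close>, and a nonzero 0-1 column has a sum between 1 and
  \<open>lmax\<close>.\<close>

lemma parry_lambda_bounds: "1 \<le> parry_lambda l wh i" "parry_lambda l wh i \<le> lmax"
proof -
  have eq: "vec_norm l i (wh i) = (\<Sum>b\<in>alphabet l (Suc i). (\<Sum>a\<in>alphabet l i. L i a b) * wh (Suc i) b)"
  proof -
    have "vec_norm l i (wh i) = (\<Sum>a\<in>alphabet l i. \<Sum>b\<in>alphabet l (Suc i). L i a b * wh (Suc i) b)"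
      unfolding vec_norm_wh by (intro sum.cong refl wh_eq)
    also have "\<dots> = (\<Sum>b\<in>alphabet l (Suc i). \<Sum>a\<in>alphabet l i. L i a b * wh (Suc i) b)"
      by (rule sum.swap)
    finally show ?thesis
      by (simp add: sum_distrib_right)
  qed
  have ge: "1 \<le> (\<Sum>a\<in>alphabet l i. L i a b)" if b: "b \<in> alphabet l (Suc i)" for b
  proof -
    obtain a where a: "a \<in> alphabet l i" "L i a b = 1"
      using col_nonzero[OF b] zero_one[OF _ b] by blast
    have "L i a b \<le> (\<Sum>a\<in>alphabet l i. L i a b)"
      using zero_one[OF _ b] a by (intro member_le_sum) (auto, fastforce)
    then show ?thesis
      using a by simp
  qed
  have le: "(\<Sum>a\<in>alphabet l i. L i a b) \<le> lmax" if b: "b \<in> alphabet l (Suc i)" for b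
  proof -
    have "(\<Sum>a\<in>alphabet l i. L i a b) \<le> (\<Sum>a\<in>alphabet l i. 1)"
      using zero_one[OF _ b] by (intro sum_mono) fastforce
    then show ?thesis
      using l_le_lmax[of i] by simp
  qed
  have "1 * vec_norm l (Suc i) (wh (Suc i)) \<le> vec_norm l i (wh i)"
    unfolding eq unfolding vec_norm_wh sum_distrib_left
    using ge wh_pos by (intro sum_mono mult_right_mono) (auto simp: less_imp_le)
  moreover have "vec_norm l i (wh i) \<le> lmax * vec_norm l (Suc i) (wh (Suc i))"
    unfolding eq unfolding vec_norm_wh sum_distrib_left
    using le wh_pos by (intro sum_mono mult_right_mono) (auto simp: less_imp_le)
  ultimately show "1 \<le> parry_lambda l wh i" "parry_lambda l wh i \<le> lmax"
    using vec_norm_wh_pos[of "Suc i"] by (simp_all add: parry_lambda_def field_simps)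
qed

lemma lambda_prod_ge_1: "1 \<le> lambda_prod l wh k m"
  unfolding lambda_prod_def using parry_lambda_bounds(1) by (intro prod_ge_1) auto

lemma lambda_prod_le: "lambda_prod l wh k m \<le> real lmax ^ (m - k)"
proof -
  have "lambda_prod l wh k m \<le> (\<Prod>i\<in>{k..<m}. real lmax)"
    unfolding lambda_prod_def using parry_lambda_bounds
    by (intro prod_mono) (auto intro: order_trans[of 0 1])
  then show ?thesis
    by simp
qed

lemma lambda_prod_le_num_words:
  assumes "k \<le> n"
  shows "lambda_prod l wh k n \<le> num_words l L k n"
proof -
  have "vec_norm l k (wh k)
      \<le> (\<Sum>b\<in>alphabet l n. (\<Sum>a\<in>alphabet l k. Lprod l L k n a b) * vec_norm l n (wh n))"
    unfolding vec_norm_Lprod[OF assms]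
  proof (intro sum_mono mult_left_mono sum_nonneg Lprod_nonneg assms)
    fix b assume "b \<in> alphabet l n"
    then show "wh n b \<le> vec_norm l n (wh n)"
      unfolding vec_norm_wh using wh_pos by (intro member_le_sum) (auto simp: less_imp_le)
  qed
  also have "\<dots> = real (num_words l L k n) * vec_norm l n (wh n)"
    by (simp add: sum_Lprod[OF assms, symmetric] sum_distrib_right)
  finally show ?thesis
    using vec_norm_wh_pos[of n] by (simp add: lambda_prod_eq[OF assms] divide_le_eq)
qed

section \<open>Comparing the growth of words with that of the eigenvalues\<close>

lemma parry_w_ge:
  assumes "k \<le> n" "\<gamma> \<in> alphabet l k" "\<And>\<beta>. \<beta> \<in> alphabet l n \<Longrightarrow> Lprod l L k n \<gamma> \<beta> \<ge> 1"
  shows "1 / lambda_prod l wh k n \<le> parry_w l wh k \<gamma>"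
proof -
  \<comment> \<open>A row with entries of at least 1 dominates the row of ones, whose product with
    \<open>wh n\<close> is the norm of \<open>wh n\<close>.\<close>
  have "vec_norm l n (wh n) \<le> wh k \<gamma>"
    unfolding wh_Lprod[OF assms(1,2)] vec_norm_wh
    using assms(3) wh_pos by (intro sum_mono) (auto simp: mult_le_cancel_right1 not_less[symmetric] not_le less_imp_le)
  then show ?thesis
    using vec_norm_wh_pos[of k] vec_norm_wh_pos[of n]
    by (simp add: lambda_prod_eq[OF assms(1)] parry_w_def divide_right_mono)
qed

lemma num_words_mult_parry_w_le:
  assumes \<gamma>: "\<gamma> \<in> alphabet l k" and max: "maximizes_colsum l L k \<gamma>"
  shows "num_words l L 0 k * parry_w l wh k \<gamma> \<le> lmax * lambda_prod l wh 0 k"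
proof -
  define s where "s = (\<lambda>\<beta>. \<Sum>\<alpha>\<in>alphabet l 0. Lprod l L 0 k \<alpha> \<beta>)"
  have s0: "0 \<le> s \<beta>" if "\<beta> \<in> alphabet l k" for \<beta>
    unfolding s_def using that by (intro sum_nonneg Lprod_nonneg) auto
  have sle: "s \<beta> \<le> s \<gamma>" if "\<beta> \<in> alphabet l k" for \<beta>
    using max that unfolding maximizes_colsum_def s_def by simp
  have "real (num_words l L 0 k) = (\<Sum>\<beta>\<in>alphabet l k. s \<beta>)"
    using sum_Lprod[of 0 k] by (simp add: s_def)
  also have "\<dots> \<le> (\<Sum>\<beta>\<in>alphabet l k. s \<gamma>)"
    using sle by (rule sum_mono)
  also have "\<dots> \<le> lmax * s \<gamma>"
    using l_le_lmax[of k] s0[OF \<gamma>] by (simp add: mult_right_mono)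
  finally have "num_words l L 0 k * parry_w l wh k \<gamma> \<le> lmax * s \<gamma> * parry_w l wh k \<gamma>"
    using wh_pos[OF \<gamma>] vec_norm_wh_pos[of k] by (intro mult_right_mono) (auto simp: parry_w_def)
  \<comment> \<open>Only the column \<open>\<gamma>\<close> is kept in the weighted mean of column
    sums.\<close>
  moreover have "s \<gamma> * parry_w l wh k \<gamma> \<le> lambda_prod l wh 0 k"
  proof -
    have "s \<gamma> * wh k \<gamma> \<le> (\<Sum>\<beta>\<in>alphabet l k. s \<beta> * wh k \<beta>)"
      using \<gamma> s0 wh_pos by (intro member_le_sum[where f = "\<lambda>\<beta>. s \<beta> * wh k \<beta>"]) (auto simp: less_imp_le)
    then show ?thesis
      using vec_norm_wh_pos[of k]
      by (simp add: lambda_prod_eq vec_norm_Lprod[of 0 k] s_def parry_w_def divide_right_mono)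
  qed
  then have "lmax * (s \<gamma> * parry_w l wh k \<gamma>) \<le> lmax * lambda_prod l wh 0 k"
    by (rule mult_left_mono) simp
  ultimately show ?thesis
    by (simp add: mult.assoc)
qed

lemma ln_num_words_le_lambda:
  assumes n: "k \<le> n" and row: "\<And>\<gamma> \<beta>. \<gamma> \<in> alphabet l k \<Longrightarrow> maximizes_colsum l L k \<gamma> \<Longrightarrow>
    \<beta> \<in> alphabet l n \<Longrightarrow> Lprod l L k n \<gamma> \<beta> \<ge> 1"
  shows "ln (num_words l L 0 k) \<le> ln (lambda_prod l wh 0 k) + (ln lmax + ln (lambda_prod l wh k n))"
proof -
  have "Max ((\<lambda>\<beta>. \<Sum>\<alpha>\<in>alphabet l 0. Lprod l L 0 k \<alpha> \<beta>) ` alphabet l k)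
      \<in> (\<lambda>\<beta>. \<Sum>\<alpha>\<in>alphabet l 0. Lprod l L 0 k \<alpha> \<beta>) ` alphabet l k"
    using alphabet_not_empty by (intro Max_in) auto
  then obtain \<gamma> where \<gamma>: "\<gamma> \<in> alphabet l k" "maximizes_colsum l L k \<gamma>"
    unfolding maximizes_colsum_def by force
  have pos: "lambda_prod l wh 0 k > 0" "lambda_prod l wh k n > 0"
    using lambda_prod_ge_1 by (auto intro: less_le_trans[of 0 1])
  have "num_words l L 0 k * (1 / lambda_prod l wh k n) \<le> num_words l L 0 k * parry_w l wh k \<gamma>"
    using parry_w_ge[OF n \<gamma>(1) row[OF \<gamma>]] by (intro mult_left_mono) auto
  also have "\<dots> \<le> lmax * lambda_prod l wh 0 k"
    using num_words_mult_parry_w_le \<gamma> by blast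
  finally have "num_words l L 0 k \<le> lmax * lambda_prod l wh 0 k * lambda_prod l wh k n"
    using pos by (simp add: divide_le_eq)
  then have "ln (num_words l L 0 k) \<le> ln (lmax * lambda_prod l wh 0 k * lambda_prod l wh k n)"
    using num_words_pos[of 0 k] by (intro ln_mono) auto
  also have "\<dots> = ln lmax + ln (lambda_prod l wh 0 k) + ln (lambda_prod l wh k n)"
    using pos lmax_pos by (simp add: ln_mult_pos)
  finally show ?thesis
    by simp
qed

text \<open>The common core of both equality cases, which differ only in \<open>n k\<close>. Under
  the hypothesis on maximizing rows it is chosen with \<open>lambda_prod l wh k (n k)\<close>
  bounded; in the other case it is \<open>k + prim_index l L k\<close>, and the growth bound is the
  assumption.\<close>

lemma norm_growth_le_lambda_growth:
  fixes n :: "nat \<Rightarrow> nat"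
  assumes "\<And>k. k \<ge> k0 \<Longrightarrow> k \<le> n k"
    and "\<And>k \<gamma> \<beta>. k \<ge> k0 \<Longrightarrow> \<gamma> \<in> alphabet l k \<Longrightarrow> maximizes_colsum l L k \<gamma> \<Longrightarrow>
      \<beta> \<in> alphabet l (n k) \<Longrightarrow> Lprod l L k (n k) \<gamma> \<beta> \<ge> 1"
    and "limsup (\<lambda>k. ereal (1 / real k * ln (lambda_prod l wh k (n k)))) \<le> 0"
  shows "norm_growth l L \<le> lambda_growth l wh"
proof -
  have "limsup (\<lambda>k. ereal (1 / real k * (ln lmax + ln (lambda_prod l wh k (n k)))))
      \<le> limsup (\<lambda>k. ereal (1 / real k * ln (lambda_prod l wh k (n k)))) + 0"
    using limsup_bounded_over_n[of "\<lambda>_. ln lmax" "\<bar>ln lmax\<bar>"] by (intro growth_le[where ?n0.0 = 0]) auto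
  then have *: "limsup (\<lambda>k. ereal (1 / real k * (ln lmax + ln (lambda_prod l wh k (n k))))) \<le> 0"
    using assms(3) by simp
  have "norm_growth l L \<le> lambda_growth l wh + 0"
    unfolding norm_growth_eq lambda_growth_def
    using ln_num_words_le_lambda assms(1,2) by (intro growth_le[OF _ *, where ?n0.0 = k0]) blast
  then show ?thesis
    by simp
qed

text \<open>The loss \<open>lambda_prod l wh k n\<close> is at most w(k,n), so \<open>n\<close> is
  placed just after w(k,.) has passed 1 / \<epsilon>: late enough for the hypothesis on rows, early
  enough for a uniform bound.\<close>

lemma norm_growth_le_of_maximal_rows:
  assumes \<epsilon>: "\<epsilon> > 0"
    and rows: "\<And>k m \<gamma> \<beta>. k \<ge> k0 \<Longrightarrow> m \<ge> 1 \<Longrightarrow> real (num_words l L k (k + m)) > 1 / \<epsilon> \<Longrightarrow>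
      \<gamma> \<in> alphabet l k \<Longrightarrow> maximizes_colsum l L k \<gamma> \<Longrightarrow> \<beta> \<in> alphabet l (k + m) \<Longrightarrow>
      Lprod l L k (k + m) \<gamma> \<beta> \<ge> 1"
  shows "norm_growth l L \<le> lambda_growth l wh"
proof -
  \<comment> \<open>The first count beyond 1 / \<epsilon> is at most
    \<open>lmax * (1 + 1 / \<epsilon>)\<close>; the outer factor \<open>lmax\<close> pays for the
    step from \<open>j\<close> to \<open>Suc j\<close>.\<close>
  define B where "B = real lmax * (lmax * (1 + 1 / \<epsilon>))"
  have B: "1 / \<epsilon> \<le> B"
  proof -
    have "1 / \<epsilon> \<le> 1 * (1 * (1 + 1 / \<epsilon>))"
      by simp
    also have "\<dots> \<le> B"
      unfolding B_def using lmax_pos \<epsilon> by (intro mult_mono) auto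
    finally show ?thesis .
  qed
  have "\<exists>n\<ge>k. lambda_prod l wh k n \<le> B \<and>
      (\<forall>\<gamma>\<in>alphabet l k. maximizes_colsum l L k \<gamma> \<longrightarrow> (\<forall>\<beta>\<in>alphabet l n. Lprod l L k n \<gamma> \<beta> \<ge> 1))"
    if k: "k \<ge> k0" for k
  proof (cases "\<exists>m\<ge>k. real (num_words l L k m) > 1 / \<epsilon>")
    case True
    then obtain j where j: "k \<le> j" "real (num_words l L k j) > 1 / \<epsilon>"
      "real (num_words l L k j) \<le> lmax * (1 + 1 / \<epsilon>)"
      using first_many_words[of "1 / \<epsilon>" k] \<epsilon> by auto
    \<comment> \<open>\<open>Suc j\<close> replaces \<open>j\<close> because \<open>j = k\<close> is
      possible, while the hypothesis on rows speaks of \<open>m \<ge> 1\<close>.\<close>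
    have m: "Suc j = k + (Suc j - k)" "Suc j - k \<ge> 1"
      using j(1) by auto
    have "real (num_words l L k (Suc j)) > 1 / \<epsilon>"
      using num_words_mono[of k j "Suc j"] j by linarith
    moreover have "lambda_prod l wh k (Suc j) \<le> B"
    proof -
      have "lambda_prod l wh k (Suc j) \<le> real (num_words l L k (Suc j))"
        using j by (intro lambda_prod_le_num_words) auto
      also have "\<dots> \<le> real (num_words l L k j * lmax)"
        unfolding of_nat_le_iff using j by (intro num_words_Suc_le)
      also have "\<dots> \<le> B"
        using mult_left_mono[OF j(3), of "real lmax"] by (simp add: B_def mult.commute)
      finally show ?thesis .
    qed
    ultimately show ?thesis
      using rows[OF k m(2), folded m(1)] j(1) by (intro exI[of _ "Suc j"]) simp
  next
    case False
    \<comment> \<open>Here all counts w(k,.) stay at most 1 / \<epsilon>, so the loss is bounded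
      however large \<open>n\<close> is, and primitivity supplies the full rows.\<close>
    obtain n where n: "n > k" "all_positive l L k n"
      using primitive by blast
    have "lambda_prod l wh k n \<le> 1 / \<epsilon>"
      using lambda_prod_le_num_words[of k n] False n(1) by (meson less_imp_le not_less order_trans)
    then show ?thesis
      using n B Lprod_ge_1 by (intro exI[of _ n]) (auto simp: all_positive_def)
  qed
  then obtain n where n: "\<And>k. k \<ge> k0 \<Longrightarrow> k \<le> n k" "\<And>k. k \<ge> k0 \<Longrightarrow> lambda_prod l wh k (n k) \<le> B"
    "\<And>k \<gamma> \<beta>. k \<ge> k0 \<Longrightarrow> \<gamma> \<in> alphabet l k \<Longrightarrow> maximizes_colsum l L k \<gamma> \<Longrightarrow>
      \<beta> \<in> alphabet l (n k) \<Longrightarrow> Lprod l L k (n k) \<gamma> \<beta> \<ge> 1"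
    by metis
  have "limsup (\<lambda>k. ereal (1 / real k * ln (lambda_prod l wh k (n k))))
      \<le> limsup (\<lambda>k. ereal (1 / real k * ln B)) + 0"
  proof (rule growth_le)
    fix k assume "k \<ge> k0"
    then show "ln (lambda_prod l wh k (n k)) \<le> ln B + 0"
      using n(2)[of k] lambda_prod_ge_1[of k "n k"] ln_mono[of "lambda_prod l wh k (n k)" B] by linarith
  qed (simp add: limsup_bounded_over_n[of "\<lambda>_. 0" 0, simplified])
  also have "\<dots> = 0"
    using limsup_bounded_over_n[of "\<lambda>_. ln B" "\<bar>ln B\<bar>"] by simp
  finally show ?thesis
    using n by (intro norm_growth_le_lambda_growth[of k0 n]) auto
qed

lemma prim_index_positive: "all_positive l L k (k + prim_index l L k)"
proof -
  obtain n where "n > k" "all_positive l L k n"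
    using primitive by blast
  then have "n - k \<ge> 1 \<and> all_positive l L k (k + (n - k))"
    by simp
  then show ?thesis
    unfolding prim_index_def by (rule LeastI2) simp
qed

lemma norm_growth_le_of_prim_index:
  assumes "limsup (\<lambda>k. ereal (1 / real k * ln (lambda_prod l wh k (k + prim_index l L k)))) = 0"
  shows "norm_growth l L \<le> lambda_growth l wh"
  using assms prim_index_positive Lprod_ge_1
  by (intro norm_growth_le_lambda_growth[of 0 "\<lambda>k. k + prim_index l L k"]) (auto simp: all_positive_def)

lemma lambda_prod_prim_index_bounded:
  assumes "bdd_above (range (prim_index l L))"
  shows "limsup (\<lambda>k. ereal (1 / real k * ln (lambda_prod l wh k (k + prim_index l L k)))) = 0"
proof -
  obtain N where N: "prim_index l L k \<le> N" for k
    using assms by (auto simp: bdd_above_def)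
  have "\<bar>ln (lambda_prod l wh k (k + prim_index l L k))\<bar> \<le> N * ln lmax" for k
  proof -
    have "lambda_prod l wh k (k + prim_index l L k) \<le> real lmax ^ prim_index l L k"
      using lambda_prod_le[of k "k + prim_index l L k"] by simp
    also have "\<dots> \<le> real lmax ^ N"
      using N lmax_pos by (intro power_increasing) auto
    finally have "ln (lambda_prod l wh k (k + prim_index l L k)) \<le> ln (real lmax ^ N)"
      using lambda_prod_ge_1[of k "k + prim_index l L k"] by (intro ln_mono) auto
    moreover have "ln (lambda_prod l wh k (k + prim_index l L k)) \<ge> 0"
      using lambda_prod_ge_1 by simp
    ultimately show ?thesis
      using lmax_pos by (simp add: ln_realpow)
  qed
  then show ?thesis
    by (rule limsup_bounded_over_n)
qed

lemma ln_lambda_prod_pred: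
  assumes "n \<ge> 1"
  shows "ln (lambda_prod l wh 0 n) \<le> ln (lambda_prod l wh 0 (n - 1)) + ln lmax"
proof -
  have pos: "lambda_prod l wh 0 (n - 1) > 0" "lambda_prod l wh 0 n > 0"
    using lambda_prod_ge_1 by (auto intro: less_le_trans[of 0 1])
  have "lambda_prod l wh 0 n \<le> lambda_prod l wh 0 (n - 1) * lmax"
    using lambda_prod_Suc[of 0 "n - 1"] assms parry_lambda_bounds(2)[of "n - 1"] pos
    by (simp add: mult_left_mono)
  then have "ln (lambda_prod l wh 0 n) \<le> ln (lambda_prod l wh 0 (n - 1) * lmax)"
    using pos by (intro ln_mono) auto
  then show ?thesis
    using pos lmax_pos by (simp add: ln_mult_pos)
qed

section \<open>The normalized left and right vectors\<close>

lemma parry_w_pos: "a \<in> alphabet l i \<Longrightarrow> parry_w l wh i a > 0"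
  using wh_pos vec_norm_wh_pos by (simp add: parry_w_def)

lemma parry_w_le_1: "a \<in> alphabet l i \<Longrightarrow> parry_w l wh i a \<le> 1"
  using member_le_sum[of a "alphabet l i" "wh i"] wh_pos vec_norm_wh_pos[of i]
  by (simp add: parry_w_def vec_norm_wh divide_le_eq_1 less_imp_le)

text \<open>The pairing of \<open>vh i\<close> with \<open>wh i\<close> is the same for all
  \<open>i\<close>, since \<open>L i\<close> can be moved from one vector to the other. Only the
  normalization of the right vector changes it, by the factor
  \<open>parry_lambda l wh i\<close>.\<close>

lemma vh_w_sum_Suc:
  "(\<Sum>b\<in>alphabet l (Suc i). vh (Suc i) b * parry_w l wh (Suc i) b)
    = parry_lambda l wh i * (\<Sum>a\<in>alphabet l i. vh i a * parry_w l wh i a)"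
proof -
  have "(\<Sum>a\<in>alphabet l i. vh i a * wh i a)
      = (\<Sum>a\<in>alphabet l i. \<Sum>b\<in>alphabet l (Suc i). vh i a * L i a b * wh (Suc i) b)"
    by (intro sum.cong refl) (simp add: wh_eq[where i = i] sum_distrib_left mult.assoc)
  also have "\<dots> = (\<Sum>b\<in>alphabet l (Suc i). vh (Suc i) b * wh (Suc i) b)"
    by (subst sum.swap) (simp add: vh_eq flip: sum_distrib_right)
  finally have eq: "(\<Sum>a\<in>alphabet l i. vh i a * wh i a)
      = (\<Sum>b\<in>alphabet l (Suc i). vh (Suc i) b * wh (Suc i) b)" .
  have w: "(\<Sum>a\<in>alphabet l j. vh j a * parry_w l wh j a)
      = (\<Sum>a\<in>alphabet l j. vh j a * wh j a) / vec_norm l j (wh j)" for j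
    by (simp add: parry_w_def sum_divide_distrib)
  show ?thesis
    unfolding w eq parry_lambda_def using vec_norm_wh_pos[of i] by simp
qed

lemma vh_w_sum_pos: "(\<Sum>a\<in>alphabet l i. vh i a * parry_w l wh i a) > 0"
  using alphabet_not_empty vh_pos parry_w_pos by (intro sum_pos) auto

lemma parry_v_pos: "a \<in> alphabet l i \<Longrightarrow> parry_v l wh vh i a > 0"
  using vh_pos vh_w_sum_pos by (simp add: parry_v_def)

lemma parry_v_eq:
  assumes "b \<in> alphabet l (Suc i)"
  shows "(\<Sum>a\<in>alphabet l i. parry_v l wh vh i a * L i a b) = parry_lambda l wh i * parry_v l wh vh (Suc i) b"
proof -
  have "(\<Sum>a\<in>alphabet l i. parry_v l wh vh i a * L i a b)
      = vh (Suc i) b / (\<Sum>a\<in>alphabet l i. vh i a * parry_w l wh i a)"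
    by (simp add: parry_v_def sum_divide_distrib flip: vh_eq[OF assms])
  moreover have "parry_lambda l wh i > 0"
    using parry_lambda_bounds(1)[of i] by simp
  ultimately show ?thesis
    using vh_w_sum_pos[of i] by (simp add: parry_v_def vh_w_sum_Suc)
qed

end


section \<open>Entropy of Parry measures\<close>

locale parry_measure = parry_vectors l L wh vh
  for l :: "nat \<Rightarrow> nat" and L :: "nat \<Rightarrow> nat \<Rightarrow> nat \<Rightarrow> real" and wh vh :: "nat \<Rightarrow> nat \<Rightarrow> real" +
  fixes \<mu> :: "nat \<Rightarrow> (nat \<Rightarrow> nat) measure"
  assumes parry_ims: "parry_ims l L wh vh \<mu>"

context parry_measure
begin

lemma prob_space_mu: "prob_space (\<mu> k)"
  and space_mu: "space (\<mu> k) = shift_space l L k"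
  and sets_mu: "sets (\<mu> k) = metric_borel_sets (shift_space l L k) (shift_dist l L k)"
  using parry_ims by (auto simp: parry_ims_def borel_prob_def)

lemma measure_cylinder:
  "k \<le> m \<Longrightarrow> x \<in> words l L k m \<Longrightarrow> measure (\<mu> k) (cylinder l L k m x)
    = 1 / lambda_prod l wh k m * parry_v l wh vh k (x k) * parry_w l wh m (x m)"
  using parry_ims by (auto simp: parry_ims_def)

lemma cylinder_sets: "k \<le> m \<Longrightarrow> cylinder l L k m x \<in> sets (\<mu> k)"
  unfolding sets_mu borel_sets_eq_cylinders by (auto simp: cylinders_def)

section \<open>Invariance under the shift\<close>

lemma left_shift_vimage:
  assumes "Suc k \<le> m"
  shows "left_shift k -` cylinder l L (Suc k) m x \<inter> shift_space l L k
    = (\<Union>a\<in>alphabet l k. cylinder l L k m (x(k := a)))"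
proof (intro equalityI subsetI)
  fix y assume "y \<in> left_shift k -` cylinder l L (Suc k) m x \<inter> shift_space l L k"
  then have y: "y \<in> shift_space l L k" and eq: "restrict y {Suc k..} \<in> cylinder l L (Suc k) m x"
    by (auto simp: left_shift_def)
  have *: "y i = x i" if "Suc k \<le> i" "i \<le> m" for i
    using eq that by (auto simp: cylinder_def)
  have "y \<in> cylinder l L k m (x(k := y k))"
    unfolding cylinder_def
  proof (intro CollectI conjI ballI y)
    fix i assume "i \<in> {k..m}"
    then show "y i = (x(k := y k)) i"
      using *[of i] by (cases "i = k") auto
  qed
  then show "y \<in> (\<Union>a\<in>alphabet l k. cylinder l L k m (x(k := a)))"
    by (rule UN_I[OF point_letter[OF y order_refl]])
next
  fix y assume "y \<in> (\<Union>a\<in>alphabet l k. cylinder l L k m (x(k := a)))"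
  then show "y \<in> left_shift k -` cylinder l L (Suc k) m x \<inter> shift_space l L k"
    using point_restrict[of y k "Suc k"] by (auto simp: cylinder_def left_shift_def)
qed

lemma measurable_left_shift: "left_shift k \<in> measurable (\<mu> k) (\<mu> (Suc k))"
proof (rule measurable_sigma_sets)
  show "sets (\<mu> (Suc k)) = sigma_sets (shift_space l L (Suc k)) (cylinders (Suc k))"
    by (simp add: sets_mu borel_sets_eq_cylinders)
  show "cylinders (Suc k) \<subseteq> Pow (shift_space l L (Suc k))"
    by (rule cylinders_subset)
  show "left_shift k \<in> space (\<mu> k) \<rightarrow> shift_space l L (Suc k)"
    using point_restrict[of _ k "Suc k"] by (auto simp: space_mu left_shift_def)
  fix Y assume "Y \<in> cylinders (Suc k)"
  then obtain m x where "Suc k \<le> m" "Y = cylinder l L (Suc k) m x"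
    by (auto simp: cylinders_def)
  then show "left_shift k -` Y \<inter> space (\<mu> k) \<in> sets (\<mu> k)"
    unfolding space_mu using left_shift_vimage cylinder_sets by auto
qed

text \<open>Summing the cylinder formula over the prepended letters multiplies
  \<open>parry_v\<close> by \<open>L k\<close>. By \<open>parry_v_eq\<close> this is the next
  \<open>parry_v\<close> times a factor that cancels the first factor of
  \<open>lambda_prod l wh k m\<close>.\<close>

lemma measure_left_shift_vimage:
  assumes m: "Suc k \<le> m"
  shows "measure (\<mu> k) (left_shift k -` cylinder l L (Suc k) m x \<inter> shift_space l L k)
    = measure (\<mu> (Suc k)) (cylinder l L (Suc k) m x)"
proof -
  interpret prob_space "\<mu> k"
    by (rule prob_space_mu)
  \<comment> \<open>The cylinder formula speaks of admissible words, while \<open>x\<close> is an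
    arbitrary function. It is cut to the coordinates that matter; if the result is not admissible,
    both sets are empty.\<close>
  define w where "w = restrict x {Suc k..m}"
  have wx: "cylinder l L (Suc k) m x = cylinder l L (Suc k) m w"
    by (rule cylinder_cong) (simp add: w_def)
  show ?thesis
  proof (cases "w \<in> words l L (Suc k) m")
    case False
    have "cylinder l L (Suc k) m x = {}"
      using False cylinder_nonempty_word[of _ "Suc k" m x] by (auto simp: w_def)
    then show ?thesis
      by simp
  next
    case w: True
    have wS: "w (Suc k) \<in> alphabet l (Suc k)"
      using word_letter[OF w] m by simp
    have each: "measure (\<mu> k) (cylinder l L k m (w(k := a)))
        = parry_v l wh vh k a * L k a (w (Suc k)) * (parry_w l wh m (w m) / lambda_prod l wh k m)"
      if a: "a \<in> alphabet l k" for a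
    proof (cases "L k a (w (Suc k)) = 1")
      case True
      then have "w(k := a) \<in> words l L k m"
        using w a m by (auto simp: words_def PiE_iff extensional_def)
      then show ?thesis
        using measure_cylinder[of k m "w(k := a)"] m True by simp
    next
      case False
      then have "L k a (w (Suc k)) = 0"
        using zero_one[OF a wS] by simp
      \<comment> \<open>A letter that may not precede the word gives an empty cylinder, in agreement
        with the factor zero of \<open>L k\<close>.\<close>
      moreover have "cylinder l L k m (w(k := a)) = {}"
      proof (rule ccontr)
        assume "cylinder l L k m (w(k := a)) \<noteq> {}"
        then obtain y where y: "y \<in> shift_space l L k" "\<forall>i\<in>{k..m}. y i = (w(k := a)) i"
          unfolding cylinder_def by blast
        have "y k = a" "y (Suc k) = w (Suc k)"
          using y(2) m by (auto dest!: bspec[of _ _ k] bspec[of _ _ "Suc k"])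
        moreover have "L k (y k) (y (Suc k)) = 1"
          using y(1) by (simp add: shift_space_def)
        ultimately show False
          using False by simp
      qed
      ultimately show ?thesis
        by simp
    qed
    have "disjoint_family_on (\<lambda>a. cylinder l L k m (w(k := a))) (alphabet l k)"
      unfolding disjoint_family_on_def cylinder_def using m by (auto dest!: bspec[of _ _ k])
    then have "measure (\<mu> k) (\<Union>a\<in>alphabet l k. cylinder l L k m (w(k := a)))
        = (\<Sum>a\<in>alphabet l k. measure (\<mu> k) (cylinder l L k m (w(k := a))))"
      using cylinder_sets m by (intro finite_measure_finite_Union) auto
    also have "\<dots> = (\<Sum>a\<in>alphabet l k. parry_v l wh vh k a * L k a (w (Suc k)))
        * (parry_w l wh m (w m) / lambda_prod l wh k m)"
      unfolding sum_distrib_right by (intro sum.cong refl each)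
    also have "\<dots> = parry_v l wh vh (Suc k) (w (Suc k)) * parry_w l wh m (w m)
        * (parry_lambda l wh k / lambda_prod l wh k m)"
      by (simp add: parry_v_eq[OF wS])
    also have "parry_lambda l wh k / lambda_prod l wh k m = 1 / lambda_prod l wh (Suc k) m"
      using m vec_norm_wh_pos by (simp add: lambda_prod_eq parry_lambda_def less_imp_neq[symmetric])
    also have "parry_v l wh vh (Suc k) (w (Suc k)) * parry_w l wh m (w m) * (1 / lambda_prod l wh (Suc k) m)
        = measure (\<mu> (Suc k)) (cylinder l L (Suc k) m w)"
      using measure_cylinder[OF m w] by simp
    finally show ?thesis
      unfolding wx left_shift_vimage[OF m, of w] .
  qed
qed

text \<open>\<open>parry_ims\<close> prescribes each measure on cylinders only, so invariance is
  obtained there and extended, the cylinders being a generator stable under intersection.\<close>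

lemma distr_left_shift: "distr (\<mu> k) (\<mu> (Suc k)) (left_shift k) = \<mu> (Suc k)"
proof (rule measure_eqI_generator_eq_countable[OF Int_stable_cylinders cylinders_subset])
  interpret M: prob_space "\<mu> k"
    by (rule prob_space_mu)
  interpret N: prob_space "\<mu> (Suc k)"
    by (rule prob_space_mu)
  fix X assume "X \<in> cylinders (Suc k)"
  then obtain m x where X: "Suc k \<le> m" "X = cylinder l L (Suc k) m x"
    by (auto simp: cylinders_def)
  show "emeasure (distr (\<mu> k) (\<mu> (Suc k)) (left_shift k)) X = emeasure (\<mu> (Suc k)) X"
    using measure_left_shift_vimage[OF X(1)] cylinder_sets[OF X(1)] measurable_left_shift
    by (simp add: emeasure_distr M.emeasure_eq_measure N.emeasure_eq_measure X(2) space_mu)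
next
  interpret N: prob_space "distr (\<mu> k) (\<mu> (Suc k)) (left_shift k)"
    using prob_space_mu measurable_left_shift by (rule prob_space.prob_space_distr)
  show "emeasure (distr (\<mu> k) (\<mu> (Suc k)) (left_shift k)) a \<noteq> \<infinity>" for a
    using N.emeasure_finite[of a] by simp
  show "(\<lambda>a. cylinder l L (Suc k) (Suc k) (\<lambda>_. a)) ` alphabet l (Suc k) \<subseteq> cylinders (Suc k)"
    by (auto simp: cylinders_def)
  show "\<Union> ((\<lambda>a. cylinder l L (Suc k) (Suc k) (\<lambda>_. a)) ` alphabet l (Suc k)) = shift_space l L (Suc k)"
    using partition_onD1[OF letter_partition_on, of "Suc k"] by (simp add: letter_partition_def)
qed (simp_all add: sets_mu borel_sets_eq_cylinders countable_finite)

lemma measurable_iter: "iter left_shift i \<in> measurable (\<mu> 0) (\<mu> i)"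
proof (induction i)
  case (Suc i)
  then show ?case
    using measurable_comp[OF Suc measurable_left_shift] by (simp add: o_def)
qed (simp add: id_def)

lemma distr_iter: "distr (\<mu> 0) (\<mu> i) (iter left_shift i) = \<mu> i"
proof (induction i)
  case 0
  have "distr (\<mu> 0) (\<mu> 0) (\<lambda>x. x) = \<mu> 0"
    by (rule distr_id)
  then show ?case
    by (simp add: id_def)
next
  case (Suc i)
  have "distr (\<mu> 0) (\<mu> (Suc i)) (left_shift i \<circ> iter left_shift i)
      = distr (distr (\<mu> 0) (\<mu> i) (iter left_shift i)) (\<mu> (Suc i)) (left_shift i)"
    by (rule distr_distr[symmetric, OF measurable_left_shift measurable_iter])
  then show ?case
    unfolding Suc iter.simps by (simp only: distr_left_shift)
qed

lemma measure_iter_vimage: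
  assumes "B \<in> sets (\<mu> i)"
  shows "{x \<in> shift_space l L 0. iter left_shift i x \<in> B} \<in> sets (\<mu> 0)"
    and "measure (\<mu> 0) {x \<in> shift_space l L 0. iter left_shift i x \<in> B} = measure (\<mu> i) B"
proof -
  have eq: "{x \<in> shift_space l L 0. iter left_shift i x \<in> B} = iter left_shift i -` B \<inter> space (\<mu> 0)"
    by (auto simp: space_mu)
  show "{x \<in> shift_space l L 0. iter left_shift i x \<in> B} \<in> sets (\<mu> 0)"
    unfolding eq using measurable_iter assms by (rule measurable_sets)
  show "measure (\<mu> 0) {x \<in> shift_space l L 0. iter left_shift i x \<in> B} = measure (\<mu> i) B"
    unfolding eq using measure_distr[OF measurable_iter assms] by (simp add: distr_iter)
qed

section \<open>Metric entropy from below and from above\<close>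

lemma letter_join_entropy_ge:
  obtains c where "\<And>n. n \<ge> 1 \<Longrightarrow> ln (lambda_prod l wh 0 n)
    \<le> part_entropy (\<mu> 0) (join (shift_space l L) left_shift letter_partition n) + c"
proof -
  interpret prob_space "\<mu> 0"
    by (rule prob_space_mu)
  \<comment> \<open>The cylinder formula at time 0 contains the left vector only at index 0, so this
    bound on its entries serves all \<open>n\<close>.\<close>
  define V where "V = (\<Sum>a\<in>alphabet l 0. parry_v l wh vh 0 a)"
  have V: "V > 0"
    unfolding V_def using parry_v_pos alphabet_not_empty by (intro sum_pos) auto
  have "ln (lambda_prod l wh 0 n)
      \<le> part_entropy (\<mu> 0) (join (shift_space l L) left_shift letter_partition n) + (ln V + ln lmax)"
    if n: "n \<ge> 1" for n
  proof -
    define A where "A = (\<lambda>s. {x \<in> shift_space l L 0. \<forall>i<n. iter left_shift i x \<in> s i})"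
    define S where "S = PiE {..<n} letter_partition"
    have \<Lambda>: "lambda_prod l wh 0 (n - 1) > 0"
      using lambda_prod_ge_1 by (auto intro: less_le_trans[of 0 1])
    have disj: "disjoint (letter_partition i)" for i
      using letter_partition_on by (rule partition_onD2)
    have finS: "finite S"
      unfolding S_def using finite_letter_partition by (intro finite_PiE) auto
    have "disjoint_family_on A S"
      unfolding A_def S_def using disj by (rule disjoint_join_atoms)
    moreover have "A s \<in> events" if "s \<in> S" for s
    proof -
      have si: "s i \<in> sets (\<mu> i)" if "i < n" for i
      proof -
        have "s i \<in> letter_partition i"
          using \<open>s \<in> S\<close> that by (auto simp: S_def)
        then show ?thesis
          using cylinder_sets by (auto simp: letter_partition_def)
      qed
      have "A s = (\<Inter>i\<in>{..<n}. {x \<in> shift_space l L 0. iter left_shift i x \<in> s i})"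
      proof (intro equalityI subsetI)
        fix x assume x: "x \<in> (\<Inter>i\<in>{..<n}. {x \<in> shift_space l L 0. iter left_shift i x \<in> s i})"
        have "x \<in> shift_space l L 0"
          using INT_D[OF x, of 0] n by simp
        then show "x \<in> A s"
          using x by (simp add: A_def)
      qed (simp add: A_def)
      also have "\<dots> \<in> events"
        using n si by (intro sets.finite_INT measure_iter_vimage) (auto simp: lessThan_empty_iff)
      finally show ?thesis .
    qed
    moreover have "(\<Union>s\<in>S. A s) = space (\<mu> 0)"
      using letter_join_cover[of n] by (simp add: join_eq space_mu A_def S_def)
    moreover have "prob (A s) \<le> V / lambda_prod l wh 0 (n - 1)" if s: "s \<in> S" for s
    proof (cases "A s = {}")
      case True
      then show ?thesis
        using V \<Lambda> by simp
    next
      case False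
      then obtain x where x: "x \<in> A s"
        by blast
      then have xX: "x \<in> shift_space l L 0"
        by (simp add: A_def)
      define u where "u = restrict x {0..n - 1}"
      have u: "u \<in> words l L 0 (n - 1)"
        unfolding u_def using xX by (rule point_restrict_word) simp
      have "A s \<subseteq> cylinder l L 0 (n - 1) u"
      proof
        fix y assume y: "y \<in> A s"
        have "y j = u j" if "j \<le> n - 1" for j
        proof -
          have "y j = x j"
            using s x y that n unfolding S_def A_def by (intro letter_join_agree[of s n]) auto
          then show ?thesis
            using that by (simp add: u_def)
        qed
        then show "y \<in> cylinder l L 0 (n - 1) u"
          using y by (simp add: cylinder_def A_def)
      qed
      then have "prob (A s) \<le> prob (cylinder l L 0 (n - 1) u)"
        using cylinder_sets by (intro finite_measure_mono) auto
      also have "\<dots> = parry_v l wh vh 0 (u 0) * parry_w l wh (n - 1) (u (n - 1)) / lambda_prod l wh 0 (n - 1)"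
        using measure_cylinder[OF _ u] by simp
      also have "\<dots> \<le> V * 1 / lambda_prod l wh 0 (n - 1)"
      proof (intro divide_right_mono mult_mono)
        have u0: "u 0 \<in> alphabet l 0" and un: "u (n - 1) \<in> alphabet l (n - 1)"
          using word_letter[OF u] by auto
        show "parry_v l wh vh 0 (u 0) \<le> V"
          unfolding V_def using u0 parry_v_pos by (intro member_le_sum) (auto simp: less_imp_le)
        show "parry_w l wh (n - 1) (u (n - 1)) \<le> 1" "0 \<le> parry_w l wh (n - 1) (u (n - 1))"
          using parry_w_le_1[OF un] parry_w_pos[OF un] by auto
      qed (use V \<Lambda> in auto)
      finally show ?thesis
        by simp
    qed
    ultimately have "- ln (V / lambda_prod l wh 0 (n - 1)) \<le> - (\<Sum>s\<in>S. prob (A s) * ln (prob (A s)))"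
      using finS V \<Lambda> by (intro entropy_ge_of_prob_le) auto
    also have "\<dots> = part_entropy (\<mu> 0) (join (shift_space l L) left_shift letter_partition n)"
      unfolding S_def A_def using finite_letter_partition disj by (intro part_entropy_join[symmetric])
    \<comment> \<open>One factor of at most \<open>lmax\<close> leads from the index
      \<open>n - 1\<close> to \<open>n\<close>.\<close>
    finally show ?thesis
      using ln_lambda_prod_pred[OF n] V \<Lambda> by (simp add: ln_div)
  qed
  then show ?thesis
    using that by blast
qed

lemma lambda_growth_le_metric_entropy:
  "lambda_growth l wh \<le> metric_entropy (shift_space l L) (shift_dist l L) left_shift \<mu>"
proof -
  obtain c where c: "\<And>n. n \<ge> 1 \<Longrightarrow> ln (lambda_prod l wh 0 n)
      \<le> part_entropy (\<mu> 0) (join (shift_space l L) left_shift letter_partition n) + c"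
    using letter_join_entropy_ge by blast
  have "limsup (\<lambda>n. ereal (1 / real n * c)) \<le> 0"
    using limsup_bounded_over_n[of "\<lambda>_. c" "\<bar>c\<bar>"] by simp
  with c have "lambda_growth l wh \<le> limsup (\<lambda>n. ereal (1 / real n *
      part_entropy (\<mu> 0) (join (shift_space l L) left_shift letter_partition n))) + 0"
    unfolding lambda_growth_def by (rule growth_le)
  also have "\<dots> \<le> metric_entropy (shift_space l L) (shift_dist l L) left_shift \<mu>"
    unfolding metric_entropy_def
    using SUP_upper[OF letter_partition_admissible, of \<mu>] prob_space_mu
    by (simp add: prob_space.finite_measure)
  finally show ?thesis .
qed

text \<open>
  The part of \<open>P i\<close> containing the \<open>i\<close>-th iterate is predicted from a cylinder of diameter less than
  \<open>\<delta>\<close> around it: such a cylinder meets at most one of the compact sets \<open>K i p\<close>.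
\<close>

lemma join_entropy_le:
  fixes \<zeta> :: real
  assumes P: "P \<in> admissible_partitions (shift_space l L) (shift_dist l L) \<mu>" and \<zeta>: "\<zeta> > 0"
  obtains c where "\<And>n. n \<ge> 1 \<Longrightarrow> part_entropy (\<mu> 0) (join (shift_space l L) left_shift P n)
    \<le> ln (real (num_words l L 0 n)) + (c + n * \<zeta>)"
proof -
  interpret prob_space "\<mu> 0"
    by (rule prob_space_mu)
  have finP: "finite (P n)" and partP: "partition_on (shift_space l L n) (P n)"
    and setsP: "p \<in> P n \<Longrightarrow> p \<in> sets (\<mu> n)" for n p
    using P by (auto simp: admissible_partitions_def sets_mu)
  obtain N where N: "\<And>n. card (P n) \<le> N"
    using P by (auto simp: admissible_partitions_def bdd_above_def)
  \<comment> \<open>The successor keeps the divisor in the next definitions positive.\<close>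
  define Kc where "Kc = Suc N"
  have Kc: "card (P n) \<le> Kc" "Kc > 0" for n
    using N[of n] by (auto simp: Kc_def)
  \<comment> \<open>Half of \<open>\<zeta>\<close> is reserved for the weight spread over wrong
    names, which costs \<open>Kc * \<eta>\<close> per time.\<close>
  define \<eta> where "\<eta> = min 1 (\<zeta> / (2 * Kc))"
  have \<eta>: "0 < \<eta>" "\<eta> \<le> 1"
    using \<zeta> Kc by (auto simp: \<eta>_def)
  have K\<eta>: "Kc * \<eta> \<le> \<zeta> / 2"
  proof -
    have "Kc * \<eta> \<le> Kc * (\<zeta> / (2 * Kc))"
      by (intro mult_left_mono) (auto simp: \<eta>_def)
    then show ?thesis
      using Kc by simp
  qed
  \<comment> \<open>The other half is for errors: the price \<open>- ln \<eta>\<close> times the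
    error probability \<open>Kc * \<epsilon>\<close>. The summand 1 keeps the denominator positive
    when \<open>\<eta> = 1\<close>. Only now \<open>\<delta>\<close> and the compact sets are
    obtained, for this \<open>\<epsilon>\<close>.\<close>
  define \<epsilon> where "\<epsilon> = \<zeta> / (2 * Kc * (1 - ln \<eta>))"
  have ln\<eta>: "ln \<eta> \<le> 0"
    using \<eta> by simp
  have \<epsilon>: "\<epsilon> > 0"
    unfolding \<epsilon>_def using \<zeta> Kc ln\<eta> by (intro divide_pos_pos mult_pos_pos) auto
  have K\<epsilon>: "- ln \<eta> * (Kc * \<epsilon>) \<le> \<zeta> / 2"
  proof -
    have "- ln \<eta> * (Kc * \<epsilon>) \<le> (1 - ln \<eta>) * (Kc * \<epsilon>)"
      using \<epsilon> by (intro mult_right_mono) auto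
    also have "\<dots> = \<zeta> / 2"
      using Kc ln\<eta> by (simp add: \<epsilon>_def field_simps)
    finally show ?thesis .
  qed
  have "\<exists>\<delta>>0. \<exists>K :: nat \<Rightarrow> (nat \<Rightarrow> nat) set \<Rightarrow> (nat \<Rightarrow> nat) set. \<forall>n.
      (\<forall>p\<in>P n. compactin (Metric_space.mtopology (shift_space l L n) (shift_dist l L n)) (K n p) \<and>
          K n p \<subseteq> p \<and> measure (\<mu> n) (p - K n p) \<le> \<epsilon>) \<and>
      (\<forall>p\<in>P n. \<forall>q\<in>P n. p \<noteq> q \<longrightarrow> (\<forall>x\<in>K n p. \<forall>y\<in>K n q. shift_dist l L n x y \<ge> \<delta>))"
    using P \<epsilon> unfolding admissible_partitions_def by blast
  then obtain \<delta> and K :: "nat \<Rightarrow> (nat \<Rightarrow> nat) set \<Rightarrow> (nat \<Rightarrow> nat) set" where \<delta>: "\<delta> > 0"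
    and K: "\<And>n p. p \<in> P n \<Longrightarrow> compactin (Metric_space.mtopology (shift_space l L n) (shift_dist l L n)) (K n p)"
      "\<And>n p. p \<in> P n \<Longrightarrow> K n p \<subseteq> p" "\<And>n p. p \<in> P n \<Longrightarrow> measure (\<mu> n) (p - K n p) \<le> \<epsilon>"
    and sep: "\<And>n p q x y. p \<in> P n \<Longrightarrow> q \<in> P n \<Longrightarrow> p \<noteq> q \<Longrightarrow> x \<in> K n p \<Longrightarrow> y \<in> K n q \<Longrightarrow> shift_dist l L n x y \<ge> \<delta>"
    by metis
  have setsK: "K n p \<in> sets (\<mu> n)" if "p \<in> P n" for n p
  proof -
    interpret Metric_space "shift_space l L n" "shift_dist l L n"
      by (rule Metric_space_shift)
    have "closedin mtopology (K n p)"
      using K(1)[OF that] Hausdorff_space_mtopology by (rule compactin_imp_closedin[rotated])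
    then have "openin mtopology (shift_space l L n - K n p)" "K n p \<subseteq> shift_space l L n"
      by (auto simp: closedin_def)
    then have "shift_space l L n - K n p \<in> sets (\<mu> n)"
      unfolding sets_mu metric_borel_sets_def by (intro sigma_sets.Basic) simp
    then have "space (\<mu> n) - (shift_space l L n - K n p) \<in> sets (\<mu> n)"
      by (rule sets.compl_sets)
    also have "space (\<mu> n) - (shift_space l L n - K n p) = K n p"
      using \<open>K n p \<subseteq> _\<close> by (auto simp: space_mu)
    finally show ?thesis .
  qed
  define lab where "lab = (\<lambda>n y. THE p. p \<in> P n \<and> y \<in> p)"
  have lab_eq: "lab n y = p" if "p \<in> P n" "y \<in> p" for n y p
    unfolding lab_def
  proof (rule the_equality)
    fix q assume "q \<in> P n \<and> y \<in> q"
    then show "q = p"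
      using that partition_onD2[OF partP] unfolding disjoint_def by blast
  qed (use that in blast)
  have lab: "lab n y \<in> P n" "y \<in> lab n y" if "y \<in> shift_space l L n" for n y
  proof -
    obtain p where "p \<in> P n" "y \<in> p"
      using partition_onD1[OF partP] \<open>y \<in> shift_space l L n\<close> by blast
    then show "lab n y \<in> P n" "y \<in> lab n y"
      using lab_eq by auto
  qed
  define Q where "Q = (\<lambda>n y p. p \<in> P n \<and> K n p \<inter> cylinder l L n (resolution \<delta> n) y \<noteq> {})"
  \<comment> \<open>If no compact set meets the cylinder, any part will do as prediction, since the
    point then lies in \<open>bad n\<close>, defined below.\<close>
  define G where "G = (\<lambda>n y. if \<exists>p. Q n y p then SOME p. Q n y p else SOME p. p \<in> P n)"
  have G_in: "G n y \<in> P n" if "y \<in> shift_space l L n" for n y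
  proof (cases "\<exists>p. Q n y p")
    case True
    then have "Q n y (G n y)"
      unfolding G_def by (simp add: someI_ex)
    then show ?thesis
      by (simp add: Q_def)
  next
    case False
    then show ?thesis
      unfolding G_def if_not_P[OF False] by (intro someI[of "\<lambda>p. p \<in> P n", OF lab(1)[OF that]])
  qed
  have G_eq: "G n y = p" if p: "p \<in> P n" and y: "y \<in> K n p" for n y p
  proof -
    have yX: "y \<in> shift_space l L n"
      using y K(2)[OF p] p partition_onD1[OF partP, of n] by blast
    have "Q n y p"
      using p y cylinder_self[OF yX] by (auto simp: Q_def)
    then have ex: "\<exists>p. Q n y p" ..
    then have "Q n y (G n y)"
      unfolding G_def if_P[OF ex] by (rule someI_ex)
    then obtain z where z: "G n y \<in> P n" "z \<in> K n (G n y)" "z \<in> cylinder l L n (resolution \<delta> n) y"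
      unfolding Q_def by blast
    have "shift_dist l L n y z < \<delta>"
      using resolution_cylinder_dist[OF \<delta> cylinder_self[OF yX] z(3)] .
    then show ?thesis
      using sep[OF p z(1) _ y z(2)] by force
  qed
  have G_cong: "G i y = G i z" if "y \<in> shift_space l L i" "z \<in> shift_space l L i"
    "\<And>j. i \<le> j \<Longrightarrow> j \<le> resolution \<delta> i \<Longrightarrow> y j = z j" for i y z
  proof -
    have "cylinder l L i (resolution \<delta> i) y = cylinder l L i (resolution \<delta> i) z"
      by (rule cylinder_cong) (rule that(3))
    then have "Q i y = Q i z"
      by (simp add: Q_def)
    then show ?thesis
      by (simp only: G_def)
  qed
  define bad where "bad = (\<lambda>n. \<Union>p\<in>P n. p - K n p)"
  have bad_sets: "bad n \<in> sets (\<mu> n)" for n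
    unfolding bad_def using finP setsP setsK by (intro sets.finite_UN) auto
  have bad_le: "measure (\<mu> n) (bad n) \<le> Kc * \<epsilon>" for n
  proof -
    interpret M: prob_space "\<mu> n"
      by (rule prob_space_mu)
    have "measure (\<mu> n) (bad n) \<le> (\<Sum>p\<in>P n. measure (\<mu> n) (p - K n p))"
      unfolding bad_def using finP setsP setsK by (intro M.finite_measure_subadditive_finite) auto
    also have "\<dots> \<le> (\<Sum>p\<in>P n. \<epsilon>)"
      using K(3) by (rule sum_mono)
    also have "\<dots> \<le> Kc * \<epsilon>"
      using Kc \<epsilon> by (simp add: mult_right_mono)
    finally show ?thesis .
  qed
  have pt: "iter left_shift i x \<in> shift_space l L i" if "x \<in> shift_space l L 0" for i x
    using point_restrict[OF that] by (simp add: iter_left_shift)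
  have "part_entropy (\<mu> 0) (join (shift_space l L) left_shift P n)
      \<le> ln (real (num_words l L 0 n)) + (ln (lmax * (1 + 1 / \<delta>)) + n * \<zeta>)" if n: "n \<ge> 1" for n
  proof -
    define M where "M = num_words l L 0 (resolution \<delta> (n - 1))"
    have names: "card ((\<lambda>x. \<lambda>i\<in>{..<n}. G i (iter left_shift i x)) ` space (\<mu> 0)) \<le> M"
      unfolding M_def space_mu by (rule card_names_le(2)[OF \<delta> n]) (rule G_cong; simp)
    have "part_entropy (\<mu> 0) (join (shift_space l L) left_shift P n)
        = - (\<Sum>s\<in>PiE {..<n} P. prob {x \<in> shift_space l L 0. \<forall>i<n. iter left_shift i x \<in> s i}
            * ln (prob {x \<in> shift_space l L 0. \<forall>i<n. iter left_shift i x \<in> s i}))"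
      using finP partition_onD2[OF partP] by (intro part_entropy_join)
    \<comment> \<open>Parts are replaced by labels because the prediction lemma compares functions;
      a point lies in the part \<open>s i\<close> exactly when its label is
      \<open>s i\<close>.\<close>
    also have "\<dots> = - (\<Sum>s\<in>PiE {..<n} P. prob {x \<in> space (\<mu> 0). \<forall>i<n. lab i (iter left_shift i x) = s i}
            * ln (prob {x \<in> space (\<mu> 0). \<forall>i<n. lab i (iter left_shift i x) = s i}))"
    proof -
      have "{x \<in> shift_space l L 0. \<forall>i<n. iter left_shift i x \<in> s i}
          = {x \<in> space (\<mu> 0). \<forall>i<n. lab i (iter left_shift i x) = s i}" if s: "s \<in> PiE {..<n} P" for s
      proof -
        have "iter left_shift i x \<in> s i \<longleftrightarrow> lab i (iter left_shift i x) = s i"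
          if "x \<in> shift_space l L 0" "i < n" for x i
          using lab(2)[OF pt[OF that(1)]] lab_eq[of "s i" i] s that(2) by auto
        then show ?thesis
          by (auto simp: space_mu)
      qed
      then show ?thesis
        by simp
    qed
    also have "\<dots> \<le> ln M + n * (Kc * \<eta>)
        - ln \<eta> * (\<Sum>i<n. prob {x \<in> shift_space l L 0. iter left_shift i x \<in> bad i})"
    proof (rule entropy_le_of_prediction[where g = "\<lambda>i x. G i (iter left_shift i x)"])
      show "lab i (iter left_shift i x) \<in> P i" "G i (iter left_shift i x) \<in> P i"
        if "x \<in> space (\<mu> 0)" for i x
        using lab(1) G_in pt that by (auto simp: space_mu)
      show "{x \<in> space (\<mu> 0). lab i (iter left_shift i x) = b} \<in> events" if "b \<in> P i" for i b
      proof -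
        have "{x \<in> space (\<mu> 0). lab i (iter left_shift i x) = b}
            = {x \<in> shift_space l L 0. iter left_shift i x \<in> b}"
          using lab(2)[OF pt] lab_eq[OF that] by (auto simp: space_mu)
        then show ?thesis
          using measure_iter_vimage(1)[OF setsP[OF that]] by simp
      qed
      show "{x \<in> shift_space l L 0. iter left_shift i x \<in> bad i} \<in> events" for i
        using bad_sets by (rule measure_iter_vimage)
      show "x \<in> {x \<in> shift_space l L 0. iter left_shift i x \<in> bad i}"
        if "x \<in> space (\<mu> 0)" "lab i (iter left_shift i x) \<noteq> G i (iter left_shift i x)" for i x
      proof -
        have x: "x \<in> shift_space l L 0"
          using that(1) by (simp add: space_mu)
        have "iter left_shift i x \<notin> K i (lab i (iter left_shift i x))"
          using G_eq[OF lab(1)[OF pt[OF x]]] that(2) by metis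
        then show ?thesis
          using x lab[OF pt[OF x]] by (auto simp: bad_def)
      qed
    qed (use finP Kc \<eta> names in auto)
    \<comment> \<open>The first half bounds the term with \<open>\<eta>\<close>. The second bounds
      the errors, whose probability at time \<open>i\<close> is read off from \<open>\<mu> i\<close>
      by invariance.\<close>
    also have "\<dots> \<le> ln M + (n * (\<zeta> / 2) + n * (\<zeta> / 2))"
    proof -
      have "(\<Sum>i<n. prob {x \<in> shift_space l L 0. iter left_shift i x \<in> bad i}) \<le> (\<Sum>i<n. Kc * \<epsilon>)"
        using measure_iter_vimage(2)[OF bad_sets] bad_le by (intro sum_mono) simp
      then have "- ln \<eta> * (\<Sum>i<n. prob {x \<in> shift_space l L 0. iter left_shift i x \<in> bad i})
          \<le> - ln \<eta> * (n * (Kc * \<epsilon>))"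
        using ln\<eta> by (intro mult_left_mono) auto
      also have "\<dots> = n * (- ln \<eta> * (Kc * \<epsilon>))"
        by simp
      also have "\<dots> \<le> n * (\<zeta> / 2)"
        using K\<epsilon> by (intro mult_left_mono) auto
      finally show ?thesis
        using mult_left_mono[OF K\<eta>, of "real n"] by linarith
    qed
    also have "\<dots> \<le> ln (real (num_words l L 0 n)) + (ln (lmax * (1 + 1 / \<delta>)) + n * \<zeta>)"
      using ln_num_words_resolution[OF \<delta>, of n] by (simp add: M_def)
    finally show ?thesis .
  qed
  then show ?thesis
    using that by blast
qed

text \<open>The constant \<open>c\<close> depends on \<open>\<zeta>\<close> and the partition but
  not on \<open>n\<close>, so it vanishes in the limit over \<open>n\<close>, before
  \<open>\<zeta>\<close> tends to zero.\<close>

lemma metric_entropy_le_norm_growth: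
  "metric_entropy (shift_space l L) (shift_dist l L) left_shift \<mu> \<le> norm_growth l L"
  unfolding metric_entropy_def
proof (rule SUP_least)
  fix P assume P: "P \<in> admissible_partitions (shift_space l L) (shift_dist l L) \<mu>"
  show "limsup (\<lambda>n. ereal (1 / real n * part_entropy (\<mu> 0) (join (shift_space l L) left_shift P n)))
      \<le> norm_growth l L"
  proof (rule ereal_le_epsilon2)
    fix \<zeta> :: real assume \<zeta>: "\<zeta> > 0"
    obtain c where c: "\<And>n. n \<ge> 1 \<Longrightarrow> part_entropy (\<mu> 0) (join (shift_space l L) left_shift P n)
        \<le> ln (real (num_words l L 0 n)) + (c + n * \<zeta>)"
      using join_entropy_le[OF P \<zeta>] by blast
    \<comment> \<open>The term \<open>n * \<zeta>\<close> is linear in \<open>n\<close> and survives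
      division by \<open>n\<close>, as the slack \<open>e\<close> of
      \<open>growth_le\<close>.\<close>
    have "limsup (\<lambda>n. ereal (1 / real n * (c + n * \<zeta>))) \<le> limsup (\<lambda>n. ereal (1 / real n * c)) + \<zeta>"
    proof (rule growth_le[where ?n0.0 = 0])
      show "limsup (\<lambda>n. ereal (1 / real n * (n * \<zeta>))) \<le> \<zeta>"
        using \<zeta> by (intro Limsup_bounded) (auto simp: eventually_sequentially)
    qed simp
    also have "\<dots> = \<zeta>"
      using limsup_bounded_over_n[of "\<lambda>_. c" "\<bar>c\<bar>"] by simp
    finally have *: "limsup (\<lambda>n. ereal (1 / real n * (c + n * \<zeta>))) \<le> \<zeta>" .
    show "limsup (\<lambda>n. ereal (1 / real n * part_entropy (\<mu> 0) (join (shift_space l L) left_shift P n)))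
        \<le> norm_growth l L + ereal \<zeta>"
      unfolding norm_growth_eq
      by (rule growth_le[where c = "\<lambda>n. c + n * \<zeta>" and ?n0.0 = 1, OF c *])
  qed
qed

end


theorem theorem4p13:
  fixes l :: "nat \<Rightarrow> nat"
    and L :: "nat \<Rightarrow> nat \<Rightarrow> nat \<Rightarrow> real"
    and wh vh :: "nat \<Rightarrow> nat \<Rightarrow> real"
    and \<mu> :: "nat \<Rightarrow> (nat \<Rightarrow> nat) measure"
  defines "h \<equiv> metric_entropy (shift_space l L) (shift_dist l L) left_shift \<mu>"
    and "htop \<equiv> topological_entropy (shift_space l L) (shift_dist l L) left_shift"
  assumes "nsft l L"
    and "parry_vectors l L wh vh"
    and "parry_ims l L wh vh \<mu>"
  shows
    "(lambda_growth l wh \<le> h \<and> h \<le> norm_growth l L) \<and>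
     ((\<exists>\<epsilon>>0. \<exists>k0. \<forall>k\<ge>k0. \<forall>m\<ge>1. real (num_words l L k (k + m)) > 1 / \<epsilon> \<longrightarrow>
         (\<forall>\<gamma>\<in>alphabet l k. maximizes_colsum l L k \<gamma> \<longrightarrow>
            (\<forall>\<beta>\<in>alphabet l (k + m). Lprod l L k (k + m) \<gamma> \<beta> \<ge> 1)))
      \<longrightarrow> lambda_growth l wh = h \<and> h = norm_growth l L \<and> h = htop) \<and>
     (limsup (\<lambda>k. ereal (1 / real k * ln (lambda_prod l wh k (k + prim_index l L k)))) = 0
      \<longrightarrow> lambda_growth l wh = h \<and> h = norm_growth l L) \<and>
     (bdd_above (range (prim_index l L))
      \<longrightarrow> limsup (\<lambda>k. ereal (1 / real k * ln (lambda_prod l wh k (k + prim_index l L k)))) = 0)"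
proof -
  interpret parry_measure l L wh vh \<mu>
    using \<open>parry_vectors l L wh vh\<close> \<open>parry_ims l L wh vh \<mu>\<close>
    by (intro parry_measure.intro parry_measure_axioms.intro)
  have bounds: "lambda_growth l wh \<le> h" "h \<le> norm_growth l L"
    unfolding h_def by (rule lambda_growth_le_metric_entropy, rule metric_entropy_le_norm_growth)
  have htop: "htop = norm_growth l L"
    unfolding htop_def by (rule topological_entropy_eq)
  \<comment> \<open>A reversed inequality between the two outer terms collapses the chain of bounds,
    and the topological entropy is its right end.\<close>
  have eq: "lambda_growth l wh = h \<and> h = norm_growth l L \<and> h = htop"
    if "norm_growth l L \<le> lambda_growth l wh"
    using that bounds htop by (metis order_antisym order_trans)
  show ?thesis
  proof (intro conjI bounds impI)
    assume "\<exists>\<epsilon>>0. \<exists>k0. \<forall>k\<ge>k0. \<forall>m\<ge>1. real (num_words l L k (k + m)) > 1 / \<epsilon> \<longrightarrow>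
         (\<forall>\<gamma>\<in>alphabet l k. maximizes_colsum l L k \<gamma> \<longrightarrow>
            (\<forall>\<beta>\<in>alphabet l (k + m). Lprod l L k (k + m) \<gamma> \<beta> \<ge> 1))"
    then have "norm_growth l L \<le> lambda_growth l wh"
      using norm_growth_le_of_maximal_rows by blast
    then show "lambda_growth l wh = h" "h = norm_growth l L" "h = htop"
      using eq by blast+
  next
    assume "limsup (\<lambda>k. ereal (1 / real k * ln (lambda_prod l wh k (k + prim_index l L k)))) = 0"
    then show "lambda_growth l wh = h" "h = norm_growth l L"
      using eq norm_growth_le_of_prim_index by blast+
  next
    assume "bdd_above (range (prim_index l L))"
    then show "limsup (\<lambda>k. ereal (1 / real k * ln (lambda_prod l wh k (k + prim_index l L k)))) = 0"
      by (rule lambda_prod_prim_index_bounded)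
  qed
qed

end
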